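(* Let $p$ and $q$ be two different primes, let $G$ be a pro-$p$-group and let $H$ be a pro-$q$-group. Then \[\widehat{\mathrm{d}}(G\times H)=\widehat{\mathrm{d}}(G)\,\widehat{\mathrm{d}}(H).\]
   Context: Conventions: $x^y=y^{-1}xy$. For a prime $p$, a pro-$p$-group is a projective limit $G=\lim_{N}G/N$ over the closed normal subgroups $N$ with $G/N$ a finite $p$-group. For a pro-$p$-group $K$ (and likewise for a profinite group such as $K=G\times H$), the complete nonabelian tensor square $K\widehat{\otimes}K$ is the pro-$p$-group (respectively profinite group) topologically generated by symbols $x\widehat{\otimes}y$ ($x,y\in K$) subject to the relations $xy\widehat{\otimes}z=(x^y\widehat{\otimes}z^y)(y\widehat{\otimes}z)$ and $y\widehat{\otimes}tz=(y\widehat{\otimes}z)(y^z\widehat{\otimes}t^z)$ for all $x,y,z,t\in K$; equivalently $K\widehat{\otimes}K=\lim_{(N,M)}K/N\otimes K/M$ (projective limit of the ordinary nonabelian tensor products, $N,M$ ranging over the open normal subgroups of $K$), and $(x,y)\mapsto x\widehat{\otimes}y$ is continuous. Let $\widehat{\nabla}(K)$ be the closed (central) subgroup generated by all $x\widehat{\otimes}x$, $x\in K$. The complete nonabelian exterior square is $K\widehat{\wedge}K=(K\widehat{\otimes}K)/\widehat{\nabla}(K)$, and $x\widehat{\wedge}y$ is the image of $x\widehat{\otimes}y$. With $\mu$ the unique normalized Haar measure on $K$, the exterior degree is $\widehat{\mathrm{d}}(K)=(\mu\times\mu)(\{(x,y)\in K\times K\mid x\widehat{\wedge}y=1_{K\widehat{\wedge}K}\})$.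 *)

theory Defs
  imports "HOL-Analysis.Analysis" "HOL-Algebra.Coset"
begin

section \<open>Topological groups and inverse limits\<close>

definition topological_group :: "('a, 'm) monoid_scheme \<Rightarrow> 'a topology \<Rightarrow> bool" where
  "topological_group G T \<longleftrightarrow>
     group G \<and> topspace T = carrier G \<and>
     continuous_map (prod_topology T T) T (\<lambda>(x, y). x \<otimes>\<^bsub>G\<^esub> y) \<and>
     continuous_map T T (\<lambda>x. inv\<^bsub>G\<^esub> x)"

text \<open>The inverse limit of groups \<open>A i\<close>, \<open>i \<in> I\<close>. The relation \<open>r i j\<close> says that there is a
  transition map \<open>\<pi> i j\<close> from \<open>A i\<close> to \<open>A j\<close>.\<close>

definition inv_lim ::
  "'i set \<Rightarrow> ('i \<Rightarrow> 'i \<Rightarrow> bool) \<Rightarrow> ('i \<Rightarrow> ('x, 'm) monoid_scheme) \<Rightarrow> ('i \<Rightarrow> 'i \<Rightarrow> 'x \<Rightarrow> 'x) \<Rightarrow> ('i \<Rightarrow> 'x) monoid"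
  where
  "inv_lim I r A \<pi> =
     \<lparr>carrier = {f \<in> (\<Pi>\<^sub>E i\<in>I. carrier (A i)). \<forall>i\<in>I. \<forall>j\<in>I. r i j \<longrightarrow> \<pi> i j (f i) = f j},
      monoid.mult = (\<lambda>f g. \<lambda>i\<in>I. f i \<otimes>\<^bsub>A i\<^esub> g i),
      one = (\<lambda>i\<in>I. \<one>\<^bsub>A i\<^esub>)\<rparr>"

text \<open>Only limits of finite groups occur below, so all factors carry the discrete topology.\<close>

definition inv_lim_topology ::
  "'i set \<Rightarrow> ('i \<Rightarrow> 'i \<Rightarrow> bool) \<Rightarrow> ('i \<Rightarrow> ('x, 'm) monoid_scheme) \<Rightarrow> ('i \<Rightarrow> 'i \<Rightarrow> 'x \<Rightarrow> 'x) \<Rightarrow> ('i \<Rightarrow> 'x) topology"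
  where
  "inv_lim_topology I r A \<pi> =
     subtopology (product_topology (\<lambda>i. discrete_topology (carrier (A i))) I)
       (carrier (inv_lim I r A \<pi>))"


section \<open>Pro-p-groups\<close>

definition p_index_subgroups :: "nat \<Rightarrow> ('a, 'm) monoid_scheme \<Rightarrow> 'a topology \<Rightarrow> 'a set set" where
  "p_index_subgroups p G T =
     {N. N \<lhd> G \<and> closedin T N \<and> finite (carrier (G Mod N)) \<and> (\<exists>k. card (carrier (G Mod N)) = p ^ k)}"

text \<open>The transition map \<open>G/N \<rightarrow> G/N'\<close> sends a coset \<open>C = Nx\<close> to \<open>N'C = N'x\<close>. The topological group
  \<open>G\<close> is a pro-p-group if the canonical map to the limit of the \<open>G/N\<close> is an isomorphism of
  topological groups.\<close>

definition pro_p_group :: "nat \<Rightarrow> ('a, 'm) monoid_scheme \<Rightarrow> 'a topology \<Rightarrow> bool" where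
  "pro_p_group p G T \<longleftrightarrow>
     topological_group G T \<and>
     (let I = p_index_subgroups p G T;
          \<pi> = (\<lambda>N N' C. N' <#>\<^bsub>G\<^esub> C);
          \<phi> = (\<lambda>g. \<lambda>N\<in>I. N #>\<^bsub>G\<^esub> g)
      in \<phi> \<in> iso G (inv_lim I (\<subseteq>) (\<lambda>N. G Mod N) \<pi>) \<and>
         homeomorphic_map T (inv_lim_topology I (\<subseteq>) (\<lambda>N. G Mod N) \<pi>) \<phi>)"


section \<open>Groups given by generators and relations\<close>

text \<open>Words over \<open>X\<close>: the letter \<open>(x, True)\<close> stands for \<open>x\<close>, and \<open>(x, False)\<close> for its inverse.
  A pair \<open>(u, v)\<close> in \<open>R\<close> stands for the relation \<open>u = v\<close>.\<close>

inductive_set pres_cong ::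
  "'x set \<Rightarrow> (('x \<times> bool) list \<times> ('x \<times> bool) list) set \<Rightarrow> (('x \<times> bool) list \<times> ('x \<times> bool) list) set"
  for X R where
  refl: "w \<in> lists (X \<times> UNIV) \<Longrightarrow> (w, w) \<in> pres_cong X R"
| sym: "(u, v) \<in> pres_cong X R \<Longrightarrow> (v, u) \<in> pres_cong X R"
| trans: "(u, v) \<in> pres_cong X R \<Longrightarrow> (v, w) \<in> pres_cong X R \<Longrightarrow> (u, w) \<in> pres_cong X R"
| append: "(u, u') \<in> pres_cong X R \<Longrightarrow> (v, v') \<in> pres_cong X R \<Longrightarrow> (u @ v, u' @ v') \<in> pres_cong X R"
| cancel: "x \<in> X \<Longrightarrow> ([(x, b), (x, \<not> b)], []) \<in> pres_cong X R"
| relator: "(u, v) \<in> R \<Longrightarrow> u \<in> lists (X \<times> UNIV) \<Longrightarrow> v \<in> lists (X \<times> UNIV) \<Longrightarrow> (u, v) \<in> pres_cong X R"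

definition presented_group ::
  "'x set \<Rightarrow> (('x \<times> bool) list \<times> ('x \<times> bool) list) set \<Rightarrow> ('x \<times> bool) list set monoid" where
  "presented_group X R =
     \<lparr>carrier = lists (X \<times> UNIV) // pres_cong X R,
      monoid.mult = (\<lambda>A B. \<Union>a\<in>A. \<Union>b\<in>B. pres_cong X R `` {a @ b}),
      one = pres_cong X R `` {[]}\<rparr>"


section \<open>The complete nonabelian tensor and exterior squares\<close>

definition conj_by :: "('a, 'm) monoid_scheme \<Rightarrow> 'a \<Rightarrow> 'a \<Rightarrow> 'a" where
  "conj_by K x y = inv\<^bsub>K\<^esub> y \<otimes>\<^bsub>K\<^esub> x \<otimes>\<^bsub>K\<^esub> y"

text \<open>The group \<open>K/N \<otimes> K/M\<close> is generated by the symbols \<open>Nx \<otimes> My\<close>, written here as pairs of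
  cosets. \<open>K/N\<close> and \<open>K/M\<close> act on each other by conjugation of representatives; the relations are
  indexed by representatives, so that they can be written down for every pair \<open>(N, M)\<close>. For \<open>N = M\<close>
  this is the ordinary nonabelian tensor square of \<open>K/N\<close>, and the pairs \<open>(N, N)\<close> are cofinal.\<close>

definition tensor_gens :: "('a, 'm) monoid_scheme \<Rightarrow> 'a set \<Rightarrow> 'a set \<Rightarrow> ('a set \<times> 'a set) set" where
  "tensor_gens K N M = carrier (K Mod N) \<times> carrier (K Mod M)"

definition tensor_symbol ::
  "('a, 'm) monoid_scheme \<Rightarrow> 'a set \<Rightarrow> 'a set \<Rightarrow> 'a \<Rightarrow> 'a \<Rightarrow> ('a set \<times> 'a set) \<times> bool" where
  "tensor_symbol K N M x y = ((N #>\<^bsub>K\<^esub> x, M #>\<^bsub>K\<^esub> y), True)"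

definition tensor_rels ::
  "('a, 'm) monoid_scheme \<Rightarrow> 'a set \<Rightarrow> 'a set \<Rightarrow>
     ((('a set \<times> 'a set) \<times> bool) list \<times> (('a set \<times> 'a set) \<times> bool) list) set" where
  "tensor_rels K N M =
     {([tensor_symbol K N M (x \<otimes>\<^bsub>K\<^esub> y) z],
       [tensor_symbol K N M (conj_by K x y) (conj_by K z y), tensor_symbol K N M y z])
      | x y z. x \<in> carrier K \<and> y \<in> carrier K \<and> z \<in> carrier K} \<union>
     {([tensor_symbol K N M y (t \<otimes>\<^bsub>K\<^esub> z)],
       [tensor_symbol K N M y z, tensor_symbol K N M (conj_by K y z) (conj_by K t z)])
      | y t z. y \<in> carrier K \<and> t \<in> carrier K \<and> z \<in> carrier K}"

definition quotient_tensor ::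
  "('a, 'm) monoid_scheme \<Rightarrow> 'a set \<times> 'a set \<Rightarrow> (('a set \<times> 'a set) \<times> bool) list set monoid" where
  "quotient_tensor K = (\<lambda>(N, M). presented_group (tensor_gens K N M) (tensor_rels K N M))"

text \<open>The homomorphism \<open>K/N \<otimes> K/M \<rightarrow> K/N' \<otimes> K/M'\<close> with \<open>Nx \<otimes> My \<mapsto> N'x \<otimes> M'y\<close>, for \<open>N \<subseteq> N'\<close> and
  \<open>M \<subseteq> M'\<close>. An element of the source is a set of words; it is mapped letter by letter.\<close>

definition quotient_tensor_map ::
  "('a, 'm) monoid_scheme \<Rightarrow> 'a set \<times> 'a set \<Rightarrow> 'a set \<times> 'a set \<Rightarrow>
     (('a set \<times> 'a set) \<times> bool) list set \<Rightarrow> (('a set \<times> 'a set) \<times> bool) list set" where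
  "quotient_tensor_map K = (\<lambda>_ (N', M') C.
     pres_cong (tensor_gens K N' M') (tensor_rels K N' M') ``
       (map (\<lambda>((A, B), b). ((N' <#>\<^bsub>K\<^esub> A, M' <#>\<^bsub>K\<^esub> B), b)) ` C))"

definition open_normal_pairs :: "('a, 'm) monoid_scheme \<Rightarrow> 'a topology \<Rightarrow> ('a set \<times> 'a set) set" where
  "open_normal_pairs K T = {(N, M). N \<lhd> K \<and> openin T N \<and> M \<lhd> K \<and> openin T M}"

definition pair_le :: "'a set \<times> 'a set \<Rightarrow> 'a set \<times> 'a set \<Rightarrow> bool" where
  "pair_le = (\<lambda>(N, M) (N', M'). N \<subseteq> N' \<and> M \<subseteq> M')"

type_synonym 'a tensor_family = "'a set \<times> 'a set \<Rightarrow> (('a set \<times> 'a set) \<times> bool) list set"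

definition complete_tensor_square :: "('a, 'm) monoid_scheme \<Rightarrow> 'a topology \<Rightarrow> 'a tensor_family monoid"
  where
  "complete_tensor_square K T =
     inv_lim (open_normal_pairs K T) pair_le (quotient_tensor K) (quotient_tensor_map K)"

definition complete_tensor_topology ::
  "('a, 'm) monoid_scheme \<Rightarrow> 'a topology \<Rightarrow> 'a tensor_family topology" where
  "complete_tensor_topology K T =
     inv_lim_topology (open_normal_pairs K T) pair_le (quotient_tensor K) (quotient_tensor_map K)"

definition complete_tensor ::
  "('a, 'm) monoid_scheme \<Rightarrow> 'a topology \<Rightarrow> 'a \<Rightarrow> 'a \<Rightarrow> 'a tensor_family" where
  "complete_tensor K T x y =
     (\<lambda>(N, M)\<in>open_normal_pairs K T.
        pres_cong (tensor_gens K N M) (tensor_rels K N M) `` {[tensor_symbol K N M x y]})"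

definition complete_nabla :: "('a, 'm) monoid_scheme \<Rightarrow> 'a topology \<Rightarrow> 'a tensor_family set" where
  "complete_nabla K T =
     \<Inter>{S. subgroup S (complete_tensor_square K T) \<and> closedin (complete_tensor_topology K T) S \<and>
          (\<forall>x\<in>carrier K. complete_tensor K T x x \<in> S)}"

definition complete_exterior_square ::
  "('a, 'm) monoid_scheme \<Rightarrow> 'a topology \<Rightarrow> 'a tensor_family set monoid" where
  "complete_exterior_square K T = complete_tensor_square K T Mod complete_nabla K T"

definition complete_wedge ::
  "('a, 'm) monoid_scheme \<Rightarrow> 'a topology \<Rightarrow> 'a \<Rightarrow> 'a \<Rightarrow> 'a tensor_family set" where
  "complete_wedge K T x y =
     complete_nabla K T #>\<^bsub>complete_tensor_square K T\<^esub> complete_tensor K T x y"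


section \<open>Haar measure and exterior degree\<close>

text \<open>A finite Borel measure on a Hausdorff space that is inner regular with respect to compact sets.\<close>

definition finite_radon_measure :: "'a topology \<Rightarrow> 'a measure \<Rightarrow> bool" where
  "finite_radon_measure T M \<longleftrightarrow>
     space M = topspace T \<and> sets M = sigma_sets (topspace T) {U. openin T U} \<and>
     finite_measure M \<and>
     (\<forall>A\<in>sets M. emeasure M A = (SUP C\<in>{C. compactin T C \<and> C \<subseteq> A}. emeasure M C))"

definition normalized_haar :: "('a, 'm) monoid_scheme \<Rightarrow> 'a topology \<Rightarrow> 'a measure \<Rightarrow> bool" where
  "normalized_haar K T M \<longleftrightarrow>
     finite_radon_measure T M \<and> emeasure M (carrier K) = 1 \<and>
     (\<forall>g\<in>carrier K. \<forall>A\<in>sets M. emeasure M (g <#\<^bsub>K\<^esub> A) = emeasure M A)"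

definition haar :: "('a, 'm) monoid_scheme \<Rightarrow> 'a topology \<Rightarrow> 'a measure" where
  "haar K T = (THE M. normalized_haar K T M)"

text \<open>If the topologies are not second countable, the product sigma-algebra of the two Borel
  sigma-algebras need not contain all closed sets of the product space. Therefore the product
  of two finite Radon measures is taken to be the Radon product: the Radon measure on the product
  space with the given values on measurable rectangles.\<close>

definition radon_product ::
  "'a topology \<Rightarrow> 'b topology \<Rightarrow> 'a measure \<Rightarrow> 'b measure \<Rightarrow> ('a \<times> 'b) measure" where
  "radon_product S T M N =
     (THE P. finite_radon_measure (prod_topology S T) P \<and>
        (\<forall>A\<in>sets M. \<forall>B\<in>sets N. emeasure P (A \<times> B) = emeasure M A * emeasure N B))"

definition exterior_degree :: "('a, 'm) monoid_scheme \<Rightarrow> 'a topology \<Rightarrow> real" where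
  "exterior_degree K T =
     measure (radon_product T T (haar K T) (haar K T))
       {(x, y). x \<in> carrier K \<and> y \<in> carrier K \<and>
          complete_wedge K T x y = \<one>\<^bsub>complete_exterior_square K T\<^esub>}"

end

theory Submission
  imports Defs "HOL-Algebra.Multiplicative_Group"
begin

text \<open>
  The exterior degree of \<open>K\<close> is the measure of the set of pairs with trivial exterior product. For
  \<open>K = G \<times> H\<close> this set turns out to be, after reordering coordinates, the product of the corresponding sets for
  \<open>G\<close> and \<open>H\<close>, and Haar measure on \<open>K \<times> K\<close> is the product of Haar measure on \<open>G \<times> G\<close> and on \<open>H \<times> H\<close>.

  For the first part, \<open>x \<and> y = 1\<close> holds in the complete exterior square iff it holds in the exterior square of
  \<open>K/N\<close> for every open normal subgroup \<open>N\<close> (\<open>complete_wedge_eq_one_iff\<close>), because the closed subgroup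
  generated by the elements \<open>x \<otimes> x\<close> is determined by its images in the quotients. It suffices to consider
  \<open>N = N\<^sub>1 \<times> N\<^sub>2\<close> with \<open>N\<^sub>1\<close> small in \<open>G\<close> and \<open>N\<^sub>2\<close> small in \<open>H\<close>. In such a quotient a symbol
  \<open>a \<otimes> b\<close> with \<open>a\<close> and \<open>b\<close> from different factors is multiplicative in powers of either argument, because
  the arguments commute. It is therefore killed by a power of \<open>p\<close> and by a power of \<open>q\<close>, hence trivial
  (\<open>tensor_symbol_coprime_torsion\<close>). Thus \<open>(a, b) \<otimes> (a', b')\<close> is the product of the images of \<open>a \<otimes> a'\<close> and
  \<open>b \<otimes> b'\<close>, and functoriality along inclusions and projections gives the equivalence
  (\<open>wedge_trivial_DirProd\<close>, \<open>exterior_kernel_DirProd\<close>).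

  For the second part, the groups may fail to be second countable, and Haar measure and the Radon product have to
  be shown to exist and to be unique as Radon measures on the full Borel sigma-algebra. All spaces involved are
  compact with a base of clopen sets. Existence is the extension of a finitely additive content on clopen
  sets to a Radon measure (\<open>radon_extension\<close>): for Haar measure the content counts cosets, for the Radon product it
  is the ordinary product measure. Uniqueness is the principle that a finite Radon measure is determined by its
  values on a base that is stable under finite intersections (\<open>finite_radon_eqI\<close>); it is also what identifies
  the Haar measure of a direct product and justifies the exchange of coordinates.
\<close>

section \<open>Groups given by generators and relations\<close>

lemma pres_cong_lists:
  "(u, v) \<in> pres_cong X R \<Longrightarrow> u \<in> lists (X \<times> UNIV) \<and> v \<in> lists (X \<times> UNIV)"
  by (induction rule: pres_cong.induct) simp_all

lemma equiv_pres_cong: "equiv (lists (X \<times> UNIV)) (pres_cong X R)"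
proof (rule equivI)
  show "pres_cong X R \<subseteq> lists (X \<times> UNIV) \<times> lists (X \<times> UNIV)"
    by (rule subrelI) (use pres_cong_lists in blast)
  show "refl_on (lists (X \<times> UNIV)) (pres_cong X R)"
    by (rule refl_onI) (rule pres_cong.refl)
  show "sym (pres_cong X R)"
    by (rule symI) (rule pres_cong.sym)
  show "trans (pres_cong X R)"
    by (rule transI) (rule pres_cong.trans)
qed

lemma presented_group_mult:
  assumes "u \<in> lists (X \<times> UNIV)" "v \<in> lists (X \<times> UNIV)"
  shows "pres_cong X R `` {u} \<otimes>\<^bsub>presented_group X R\<^esub> pres_cong X R `` {v} = pres_cong X R `` {u @ v}"
proof -
  have eq: "pres_cong X R `` {a @ b} = pres_cong X R `` {u @ v}"
    if "(u, a) \<in> pres_cong X R" "(v, b) \<in> pres_cong X R" for a b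
    by (rule equiv_class_eq[OF equiv_pres_cong, symmetric]) (rule pres_cong.append[OF that])
  have "(\<Union>a\<in>pres_cong X R `` {u}. \<Union>b\<in>pres_cong X R `` {v}. pres_cong X R `` {a @ b}) =
      pres_cong X R `` {u @ v}"
  proof (intro equalityI subsetI)
    fix c assume "c \<in> (\<Union>a\<in>pres_cong X R `` {u}. \<Union>b\<in>pres_cong X R `` {v}. pres_cong X R `` {a @ b})"
    then obtain a b where "(u, a) \<in> pres_cong X R" "(v, b) \<in> pres_cong X R" "c \<in> pres_cong X R `` {a @ b}"
      by blast
    then show "c \<in> pres_cong X R `` {u @ v}"
      using eq by blast
  next
    fix c assume "c \<in> pres_cong X R `` {u @ v}"
    then show "c \<in> (\<Union>a\<in>pres_cong X R `` {u}. \<Union>b\<in>pres_cong X R `` {v}. pres_cong X R `` {a @ b})"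
      using pres_cong.refl[OF assms(1), of R] pres_cong.refl[OF assms(2), of R] by blast
  qed
  then show ?thesis
    by (simp add: presented_group_def)
qed

lemma presented_group_carrier:
  "c \<in> carrier (presented_group X R) \<longleftrightarrow> (\<exists>u\<in>lists (X \<times> UNIV). c = pres_cong X R `` {u})"
  by (auto simp: presented_group_def quotient_def)

text \<open>The two words cancel letter by letter, starting where they meet.\<close>

lemma pres_cong_inverse:
  assumes "u \<in> lists (X \<times> UNIV)"
  shows "(rev (map (\<lambda>(x, b). (x, \<not> b)) u) @ u, []) \<in> pres_cong X R"
  using assms
proof (induction u rule: list.induct)
  case Nil
  then show ?case by (simp add: pres_cong.refl)
next
  case (Cons xb u)
  obtain x b where xb: "xb = (x, b)" by force
  let ?w = "rev (map (\<lambda>(x, b). (x, \<not> b)) u)"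
  have u: "u \<in> lists (X \<times> UNIV)" and x: "x \<in> X"
    using Cons.prems by (simp_all add: xb)
  then have w: "?w \<in> lists (X \<times> UNIV)"
    by (auto simp: in_lists_conv_set)
  have "([(x, \<not> b), (x, b)], []) \<in> pres_cong X R"
    using pres_cong.cancel[OF x, of "\<not> b"] by simp
  with w u have "(?w @ [(x, \<not> b), (x, b)] @ u, ?w @ [] @ u) \<in> pres_cong X R"
    by (intro pres_cong.append pres_cong.refl)
  then have "(?w @ [(x, \<not> b), (x, b)] @ u, ?w @ u) \<in> pres_cong X R"
    by simp
  from pres_cong.trans[OF this Cons.IH[OF u]] show ?case
    by (simp add: xb)
qed

lemma group_presented_group: "group (presented_group X R)"
proof (rule groupI)
  show "\<one>\<^bsub>presented_group X R\<^esub> \<in> carrier (presented_group X R)"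
    by (auto simp: presented_group_def quotient_def)
next
  fix a assume "a \<in> carrier (presented_group X R)"
  then obtain u where u: "u \<in> lists (X \<times> UNIV)" "a = pres_cong X R `` {u}"
    by (auto simp: presented_group_carrier)
  have one: "\<one>\<^bsub>presented_group X R\<^esub> = pres_cong X R `` {[]}"
    by (simp add: presented_group_def)
  show "\<one>\<^bsub>presented_group X R\<^esub> \<otimes>\<^bsub>presented_group X R\<^esub> a = a"
    using u by (simp add: one presented_group_mult)
  let ?w = "rev (map (\<lambda>(x, b). (x, \<not> b)) u)"
  have w: "?w \<in> lists (X \<times> UNIV)"
    using u by auto
  have "pres_cong X R `` {?w} \<otimes>\<^bsub>presented_group X R\<^esub> a = \<one>\<^bsub>presented_group X R\<^esub>"
    using w u pres_cong_inverse[OF u(1)]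
    by (simp add: one presented_group_mult equiv_class_eq[OF equiv_pres_cong])
  with w show "\<exists>b\<in>carrier (presented_group X R). b \<otimes>\<^bsub>presented_group X R\<^esub> a = \<one>\<^bsub>presented_group X R\<^esub>"
    by (intro bexI[where x = "pres_cong X R `` {?w}"]) (auto simp: presented_group_carrier)
next
  fix a b assume "a \<in> carrier (presented_group X R)" "b \<in> carrier (presented_group X R)"
  then obtain u v where "u \<in> lists (X \<times> UNIV)" "a = pres_cong X R `` {u}"
    "v \<in> lists (X \<times> UNIV)" "b = pres_cong X R `` {v}"
    by (auto simp: presented_group_carrier)
  then show "a \<otimes>\<^bsub>presented_group X R\<^esub> b \<in> carrier (presented_group X R)"
    by (simp add: presented_group_mult)
      (metis append_in_lists_conv presented_group_carrier)
next
  fix a b c assume "a \<in> carrier (presented_group X R)" "b \<in> carrier (presented_group X R)"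
    "c \<in> carrier (presented_group X R)"
  then obtain u v w where "u \<in> lists (X \<times> UNIV)" "a = pres_cong X R `` {u}"
    "v \<in> lists (X \<times> UNIV)" "b = pres_cong X R `` {v}"
    "w \<in> lists (X \<times> UNIV)" "c = pres_cong X R `` {w}"
    by (auto simp: presented_group_carrier)
  then show "a \<otimes>\<^bsub>presented_group X R\<^esub> b \<otimes>\<^bsub>presented_group X R\<^esub> c =
      a \<otimes>\<^bsub>presented_group X R\<^esub> (b \<otimes>\<^bsub>presented_group X R\<^esub> c)"
    by (simp add: presented_group_mult)
qed

text \<open>Functoriality of presentations. It is stated for words rather than for classes of words, because
  the arguments below produce and consume congruences between explicit words.\<close>

lemma pres_cong_map:
  assumes "(u, v) \<in> pres_cong X R"
    and "\<And>x. x \<in> X \<Longrightarrow> \<phi> x \<in> X'"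
    and "\<And>u v. (u, v) \<in> R \<Longrightarrow> (map (map_prod \<phi> id) u, map (map_prod \<phi> id) v) \<in> pres_cong X' R'"
  shows "(map (map_prod \<phi> id) u, map (map_prod \<phi> id) v) \<in> pres_cong X' R'"
  using assms(1)
proof (induction rule: pres_cong.induct)
  case (refl w)
  have "map (map_prod \<phi> id) w \<in> lists (X' \<times> UNIV)"
    using refl assms(2) by (auto simp: in_lists_conv_set)
  then show ?case by (rule pres_cong.refl)
next
  case (sym u v)
  from sym.IH show ?case by (rule pres_cong.sym)
next
  case (trans u v w)
  from trans.IH show ?case by (rule pres_cong.trans)
next
  case (append u u' v v')
  then show ?case by (simp add: pres_cong.append)
next
  case (cancel x b)
  then show ?case using pres_cong.cancel[OF assms(2)] by simp
next
  case (relator u v)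
  then show ?case using assms(3) by blast
qed


section \<open>Tensor squares of quotients\<close>

abbreviation tensor_cong where
  "tensor_cong K N M \<equiv> pres_cong (tensor_gens K N M) (tensor_rels K N M)"

lemma coset_in_Mod: "x \<in> carrier K \<Longrightarrow> N #>\<^bsub>K\<^esub> x \<in> carrier (K Mod N)"
  by (auto simp: FactGroup_def RCOSETS_def)

lemma tensor_symbol_letter:
  "x \<in> carrier K \<Longrightarrow> y \<in> carrier K \<Longrightarrow> tensor_symbol K N M x y \<in> tensor_gens K N M \<times> UNIV"
  by (simp add: tensor_symbol_def tensor_gens_def coset_in_Mod)

lemma conj_by_closed [simp]:
  assumes "group K" "x \<in> carrier K" "y \<in> carrier K"
  shows "conj_by K x y \<in> carrier K"
proof -
  interpret group K by fact
  show ?thesis using assms by (simp add: conj_by_def)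
qed

lemma tensor_cong_left:
  assumes "group K" "x \<in> carrier K" "y \<in> carrier K" "z \<in> carrier K"
  shows "([tensor_symbol K N M (x \<otimes>\<^bsub>K\<^esub> y) z],
       [tensor_symbol K N M (conj_by K x y) (conj_by K z y), tensor_symbol K N M y z]) \<in> tensor_cong K N M"
proof (rule pres_cong.relator)
  interpret group K by fact
  show "[tensor_symbol K N M (x \<otimes>\<^bsub>K\<^esub> y) z] \<in> lists (tensor_gens K N M \<times> UNIV)"
    using assms by (simp add: tensor_symbol_letter del: mem_Sigma_iff)
  show "[tensor_symbol K N M (conj_by K x y) (conj_by K z y), tensor_symbol K N M y z]
      \<in> lists (tensor_gens K N M \<times> UNIV)"
    using assms by (simp add: tensor_symbol_letter del: mem_Sigma_iff)
qed (use assms in \<open>unfold tensor_rels_def, blast\<close>)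

lemma tensor_cong_right:
  assumes "group K" "y \<in> carrier K" "t \<in> carrier K" "z \<in> carrier K"
  shows "([tensor_symbol K N M y (t \<otimes>\<^bsub>K\<^esub> z)],
       [tensor_symbol K N M y z, tensor_symbol K N M (conj_by K y z) (conj_by K t z)]) \<in> tensor_cong K N M"
proof (rule pres_cong.relator)
  interpret group K by fact
  show "[tensor_symbol K N M y (t \<otimes>\<^bsub>K\<^esub> z)] \<in> lists (tensor_gens K N M \<times> UNIV)"
    using assms by (simp add: tensor_symbol_letter del: mem_Sigma_iff)
  show "[tensor_symbol K N M y z, tensor_symbol K N M (conj_by K y z) (conj_by K t z)]
      \<in> lists (tensor_gens K N M \<times> UNIV)"
    using assms by (simp add: tensor_symbol_letter del: mem_Sigma_iff)
qed (use assms in \<open>unfold tensor_rels_def, blast\<close>)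

lemma set_mult_hom_coset:
  assumes "group K" "group K'" "h \<in> hom K K'" "N \<lhd> K" "N' \<lhd> K'" "h ` N \<subseteq> N'" "x \<in> carrier K"
  shows "N' <#>\<^bsub>K'\<^esub> h ` (N #>\<^bsub>K\<^esub> x) = N' #>\<^bsub>K'\<^esub> h x"
proof -
  interpret K: group K by fact
  interpret K': group K' by fact
  interpret N: normal N K by fact
  interpret N': normal N' K' by fact
  interpret h: group_hom K K' h by unfold_locales (fact assms(3))
  show ?thesis
  proof safe
    fix c assume "c \<in> N' <#>\<^bsub>K'\<^esub> h ` (N #>\<^bsub>K\<^esub> x)"
    then obtain n' n where n: "n' \<in> N'" "n \<in> N" "c = n' \<otimes>\<^bsub>K'\<^esub> h (n \<otimes>\<^bsub>K\<^esub> x)"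
      by (auto simp: set_mult_def r_coset_def)
    then have "c = n' \<otimes>\<^bsub>K'\<^esub> h n \<otimes>\<^bsub>K'\<^esub> h x"
      using assms(6,7) N.subset N'.subset by (auto simp: K'.m_assoc subset_iff)
    moreover have "n' \<otimes>\<^bsub>K'\<^esub> h n \<in> N'"
      using n assms(6) by auto
    ultimately show "c \<in> N' #>\<^bsub>K'\<^esub> h x"
      by (auto simp: r_coset_def)
  next
    fix c assume "c \<in> N' #>\<^bsub>K'\<^esub> h x"
    then obtain n' where n: "n' \<in> N'" "c = n' \<otimes>\<^bsub>K'\<^esub> h x"
      by (auto simp: r_coset_def)
    moreover have "h x \<in> h ` (N #>\<^bsub>K\<^esub> x)"
      using K.rcos_self[OF assms(7) N.subgroup_axioms] by blast
    ultimately show "c \<in> N' <#>\<^bsub>K'\<^esub> h ` (N #>\<^bsub>K\<^esub> x)"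
      unfolding set_mult_def by blast
  qed
qed

text \<open>The effect of a homomorphism \<open>h\<close> on the letters \<open>Nx \<otimes> My\<close>. Multiplying \<open>h ` A\<close> by the target subgroup
  enlarges it to a full coset without choosing a representative of \<open>A\<close>; for the identity homomorphism
  this is the transition map of the inverse system.\<close>

definition tensor_letter_map where
  "tensor_letter_map K N M h = (\<lambda>(A, B). (N <#>\<^bsub>K\<^esub> h ` A, M <#>\<^bsub>K\<^esub> h ` B))"

lemma tensor_letter_map_symbol:
  assumes "group K" "group K'" "h \<in> hom K K'" "x \<in> carrier K" "y \<in> carrier K"
    and "N \<lhd> K" "N' \<lhd> K'" "h ` N \<subseteq> N'" "M \<lhd> K" "M' \<lhd> K'" "h ` M \<subseteq> M'"
  shows "map_prod (tensor_letter_map K' N' M' h) id (tensor_symbol K N M x y) =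
    tensor_symbol K' N' M' (h x) (h y)"
  using assms by (simp add: tensor_symbol_def tensor_letter_map_def set_mult_hom_coset)

lemma hom_conj_by:
  assumes "group K" "group K'" "h \<in> hom K K'" "x \<in> carrier K" "y \<in> carrier K"
  shows "h (conj_by K x y) = conj_by K' (h x) (h y)"
proof -
  interpret K: group K by fact
  interpret K': group K' by fact
  interpret h: group_hom K K' h by unfold_locales (fact assms(3))
  show ?thesis using assms by (simp add: conj_by_def)
qed

text \<open>The defining relations are equations between conjugates, and these are preserved by homomorphisms.
  This one lemma provides the maps \<open>K/N \<otimes> K/M \<rightarrow> K/N' \<otimes> K/M'\<close> of the inverse system (for the identity)
  as well as the maps induced by the inclusions and projections of a direct product.\<close>

lemma tensor_cong_map:
  assumes "group K" "group K'" "h \<in> hom K K'"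
    and "N \<lhd> K" "N' \<lhd> K'" "h ` N \<subseteq> N'" "M \<lhd> K" "M' \<lhd> K'" "h ` M \<subseteq> M'"
    and "(u, v) \<in> tensor_cong K N M"
  shows "(map (map_prod (tensor_letter_map K' N' M' h) id) u,
    map (map_prod (tensor_letter_map K' N' M' h) id) v) \<in> tensor_cong K' N' M'"
  using assms(10)
proof (rule pres_cong_map)
  interpret K: group K by fact
  interpret K': group K' by fact
  interpret h: group_hom K K' h by unfold_locales (fact assms(3))
  note sym = tensor_letter_map_symbol[OF assms(1-3) _ _ assms(4-9)]
  {
    fix x assume "x \<in> tensor_gens K N M"
    then obtain a b where "x = (N #>\<^bsub>K\<^esub> a, M #>\<^bsub>K\<^esub> b)" "a \<in> carrier K" "b \<in> carrier K"
      by (auto simp: tensor_gens_def FactGroup_def RCOSETS_def)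
    then show "tensor_letter_map K' N' M' h x \<in> tensor_gens K' N' M'"
      using assms by (simp add: tensor_letter_map_def set_mult_hom_coset tensor_gens_def coset_in_Mod)
  }
  fix u v assume "(u, v) \<in> tensor_rels K N M"
  then show "(map (map_prod (tensor_letter_map K' N' M' h) id) u,
      map (map_prod (tensor_letter_map K' N' M' h) id) v) \<in> tensor_cong K' N' M'"
    using assms(1-3) unfolding tensor_rels_def[of K]
    by (auto simp: sym hom_conj_by[OF assms(1-3)] intro!: tensor_cong_left tensor_cong_right)
qed

text \<open>Words in the letters \<open>C \<otimes> C\<close> and their inverses: their classes form the subgroup of \<open>K/N \<otimes> K/N\<close> by
  which the exterior square of \<open>K/N\<close> is obtained.\<close>

definition diagonal_words where
  "diagonal_words K N = lists ((\<lambda>C. (C, C)) ` carrier (K Mod N) \<times> UNIV)"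

text \<open>This says that \<open>Nx \<and> Ny = 1\<close> in the nonabelian exterior square of \<open>K/N\<close>.\<close>

definition wedge_trivial where
  "wedge_trivial K N x y \<longleftrightarrow>
     (\<exists>w\<in>diagonal_words K N. ([tensor_symbol K N N x y], w) \<in> tensor_cong K N N)"

lemma wedge_trivial_hom:
  assumes "group K" "group K'" "h \<in> hom K K'" "N \<lhd> K" "N' \<lhd> K'" "h ` N \<subseteq> N'"
    and "x \<in> carrier K" "y \<in> carrier K" "wedge_trivial K N x y"
  shows "wedge_trivial K' N' (h x) (h y)"
proof -
  interpret K: group K by fact
  interpret K': group K' by fact
  interpret h: group_hom K K' h by unfold_locales (fact assms(3))
  let ?f = "map (map_prod (tensor_letter_map K' N' N' h) id)"
  obtain w where w: "w \<in> diagonal_words K N" "([tensor_symbol K N N x y], w) \<in> tensor_cong K N N"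
    using assms(9) by (auto simp: wedge_trivial_def)
  have "(?f [tensor_symbol K N N x y], ?f w) \<in> tensor_cong K' N' N'"
    using tensor_cong_map[OF assms(1-6) assms(4-6) w(2)] .
  moreover have "?f w \<in> diagonal_words K' N'"
  proof -
    have "tensor_letter_map K' N' N' h (C, C) \<in> (\<lambda>C. (C, C)) ` carrier (K' Mod N')"
      if C: "C \<in> carrier (K Mod N)" for C
    proof -
      obtain a where "a \<in> carrier K" "C = N #>\<^bsub>K\<^esub> a"
        using C by (auto simp: FactGroup_def RCOSETS_def)
      then show ?thesis
        using assms by (simp add: tensor_letter_map_def set_mult_hom_coset coset_in_Mod)
    qed
    then show ?thesis
      using w(1) by (force simp: diagonal_words_def)
  qed
  ultimately show ?thesis
    using assms(1-8) by (auto simp: wedge_trivial_def tensor_letter_map_symbol)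
qed


section \<open>Coprime torsion\<close>

lemma conj_by_commute:
  assumes "group K" "x \<in> carrier K" "y \<in> carrier K" "x \<otimes>\<^bsub>K\<^esub> y = y \<otimes>\<^bsub>K\<^esub> x"
  shows "conj_by K x y = x"
proof -
  interpret group K by fact
  show ?thesis using assms by (simp add: conj_by_def m_assoc inv_solve_left')
qed

text \<open>If \<open>x\<close> and \<open>z\<close> commute, the conjugations in the relation for \<open>x\<^sup>nx \<otimes> z\<close> act trivially and what remains is
  \<open>x\<^sup>nx \<otimes> z = (x\<^sup>n \<otimes> z)(x \<otimes> z)\<close>.\<close>

lemma tensor_pow_left:
  assumes K: "group K" and x: "x \<in> carrier K" and z: "z \<in> carrier K" and xz: "x \<otimes>\<^bsub>K\<^esub> z = z \<otimes>\<^bsub>K\<^esub> x"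
  shows "tensor_cong K N M `` {[tensor_symbol K N M (x [^]\<^bsub>K\<^esub> (n::nat)) z]} =
    tensor_cong K N M `` {[tensor_symbol K N M x z]} [^]\<^bsub>quotient_tensor K (N, M)\<^esub> n"
proof -
  interpret group K by fact
  let ?Q = "quotient_tensor K (N, M)"
  let ?c = "\<lambda>x. tensor_cong K N M `` {[tensor_symbol K N M x z]}"
  interpret Q: group ?Q
    by (simp add: quotient_tensor_def group_presented_group)
  have c: "?c a \<in> carrier ?Q" if "a \<in> carrier K" for a
    using that z tensor_symbol_letter[of a K z N M]
    by (auto simp: quotient_tensor_def presented_group_carrier simp del: mem_Sigma_iff
        intro!: bexI[where x = "[tensor_symbol K N M a z]"])
  have step: "?c (a \<otimes>\<^bsub>K\<^esub> b) = ?c a \<otimes>\<^bsub>?Q\<^esub> ?c b"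
    if "a \<in> carrier K" "b \<in> carrier K" "a \<otimes>\<^bsub>K\<^esub> b = b \<otimes>\<^bsub>K\<^esub> a" "z \<otimes>\<^bsub>K\<^esub> b = b \<otimes>\<^bsub>K\<^esub> z" for a b
  proof -
    have "?c (a \<otimes>\<^bsub>K\<^esub> b) = tensor_cong K N M `` {[tensor_symbol K N M a z] @ [tensor_symbol K N M b z]}"
      using tensor_cong_left[OF K that(1,2) z, of N M] that z K
      by (intro equiv_class_eq[OF equiv_pres_cong]) (simp add: conj_by_commute)
    also have "\<dots> = ?c a \<otimes>\<^bsub>?Q\<^esub> ?c b"
      using that z tensor_symbol_letter[of a K z N M] tensor_symbol_letter[of b K z N M]
      by (simp add: quotient_tensor_def presented_group_mult del: mem_Sigma_iff append.simps)
    finally show ?thesis .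
  qed
  show ?thesis
  proof (induction n)
    case 0
    have "?c \<one>\<^bsub>K\<^esub> = ?c \<one>\<^bsub>K\<^esub> \<otimes>\<^bsub>?Q\<^esub> ?c \<one>\<^bsub>K\<^esub>"
      using step[of "\<one>\<^bsub>K\<^esub>" "\<one>\<^bsub>K\<^esub>"] z by simp
    then have "?c \<one>\<^bsub>K\<^esub> = \<one>\<^bsub>?Q\<^esub>"
      using c[of "\<one>\<^bsub>K\<^esub>"] Q.r_cancel_one' by simp
    then show ?case by simp
  next
    case (Suc n)
    have "x [^]\<^bsub>K\<^esub> n \<otimes>\<^bsub>K\<^esub> x = x \<otimes>\<^bsub>K\<^esub> x [^]\<^bsub>K\<^esub> n"
      using x nat_pow_comm[of x n 1] by simp
    with Suc show ?case
      using step[of "x [^]\<^bsub>K\<^esub> n" x] x xz by simp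
  qed
qed

lemma tensor_pow_right:
  assumes K: "group K" and x: "x \<in> carrier K" and z: "z \<in> carrier K" and xz: "x \<otimes>\<^bsub>K\<^esub> z = z \<otimes>\<^bsub>K\<^esub> x"
  shows "tensor_cong K N M `` {[tensor_symbol K N M x (z [^]\<^bsub>K\<^esub> (n::nat))]} =
    tensor_cong K N M `` {[tensor_symbol K N M x z]} [^]\<^bsub>quotient_tensor K (N, M)\<^esub> n"
proof -
  interpret group K by fact
  let ?Q = "quotient_tensor K (N, M)"
  let ?c = "\<lambda>z. tensor_cong K N M `` {[tensor_symbol K N M x z]}"
  interpret Q: group ?Q
    by (simp add: quotient_tensor_def group_presented_group)
  have c: "?c a \<in> carrier ?Q" if "a \<in> carrier K" for a
    using that x tensor_symbol_letter[of x K a N M]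
    by (auto simp: quotient_tensor_def presented_group_carrier simp del: mem_Sigma_iff
        intro!: bexI[where x = "[tensor_symbol K N M x a]"])
  have step: "?c (a \<otimes>\<^bsub>K\<^esub> b) = ?c b \<otimes>\<^bsub>?Q\<^esub> ?c a"
    if "a \<in> carrier K" "b \<in> carrier K" "a \<otimes>\<^bsub>K\<^esub> b = b \<otimes>\<^bsub>K\<^esub> a" "x \<otimes>\<^bsub>K\<^esub> b = b \<otimes>\<^bsub>K\<^esub> x" for a b
  proof -
    have "?c (a \<otimes>\<^bsub>K\<^esub> b) = tensor_cong K N M `` {[tensor_symbol K N M x b] @ [tensor_symbol K N M x a]}"
      using tensor_cong_right[OF K x that(1,2), of N M] that x K
      by (intro equiv_class_eq[OF equiv_pres_cong]) (simp add: conj_by_commute)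
    also have "\<dots> = ?c b \<otimes>\<^bsub>?Q\<^esub> ?c a"
      using that x tensor_symbol_letter[of x K a N M] tensor_symbol_letter[of x K b N M]
      by (simp add: quotient_tensor_def presented_group_mult del: mem_Sigma_iff append.simps)
    finally show ?thesis .
  qed
  show ?thesis
  proof (induction n)
    case 0
    have "?c \<one>\<^bsub>K\<^esub> = ?c \<one>\<^bsub>K\<^esub> \<otimes>\<^bsub>?Q\<^esub> ?c \<one>\<^bsub>K\<^esub>"
      using step[of "\<one>\<^bsub>K\<^esub>" "\<one>\<^bsub>K\<^esub>"] x by simp
    then have "?c \<one>\<^bsub>K\<^esub> = \<one>\<^bsub>?Q\<^esub>"
      using c[of "\<one>\<^bsub>K\<^esub>"] Q.r_cancel_one' by simp
    then show ?case by simp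
  next
    case (Suc n)
    have "z [^]\<^bsub>K\<^esub> n \<otimes>\<^bsub>K\<^esub> z = z \<otimes>\<^bsub>K\<^esub> z [^]\<^bsub>K\<^esub> n"
      using z nat_pow_comm[of z n 1] by simp
    moreover have "?c z \<otimes>\<^bsub>?Q\<^esub> ?c z [^]\<^bsub>?Q\<^esub> n = ?c z [^]\<^bsub>?Q\<^esub> n \<otimes>\<^bsub>?Q\<^esub> ?c z"
      using c[OF z] Q.nat_pow_comm[of "?c z" 1 n] by simp
    ultimately show ?case
      using step[of "z [^]\<^bsub>K\<^esub> n" z] z xz Suc by simp
  qed
qed

text \<open>By the two power rules, \<open>x \<otimes> z\<close> is killed by every \<open>m\<close> with \<open>x\<^sup>m \<in> N\<close> and by every \<open>n\<close> with
  \<open>z\<^sup>n \<in> M\<close>. This is where coprimality enters.\<close>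

lemma tensor_symbol_coprime_torsion:
  assumes K: "group K" and x: "x \<in> carrier K" and z: "z \<in> carrier K" and xz: "x \<otimes>\<^bsub>K\<^esub> z = z \<otimes>\<^bsub>K\<^esub> x"
    and N: "N \<lhd> K" "x [^]\<^bsub>K\<^esub> (m::nat) \<in> N" and M: "M \<lhd> K" "z [^]\<^bsub>K\<^esub> (n::nat) \<in> M" and "coprime m n"
  shows "([tensor_symbol K N M x z], []) \<in> tensor_cong K N M"
proof -
  interpret group K by fact
  interpret N: normal N K by fact
  interpret M: normal M K by fact
  let ?Q = "quotient_tensor K (N, M)"
  let ?c = "\<lambda>x z. tensor_cong K N M `` {[tensor_symbol K N M x z]}"
  interpret Q: group ?Q
    by (simp add: quotient_tensor_def group_presented_group)
  have c: "?c x z \<in> carrier ?Q"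
    using x z tensor_symbol_letter[of x K z N M]
    by (auto simp: quotient_tensor_def presented_group_carrier simp del: mem_Sigma_iff
        intro!: bexI[where x = "[tensor_symbol K N M x z]"])
  have "tensor_symbol K N M (x [^]\<^bsub>K\<^esub> m) z = tensor_symbol K N M (x [^]\<^bsub>K\<^esub> (0::nat)) z"
    using N N.subset by (simp add: tensor_symbol_def N.rcos_const coset_mult_one)
  then have "?c x z [^]\<^bsub>?Q\<^esub> m = \<one>\<^bsub>?Q\<^esub>"
    using tensor_pow_left[OF K x z xz, of N M m] tensor_pow_left[OF K x z xz, of N M 0] by simp
  moreover have "tensor_symbol K N M x (z [^]\<^bsub>K\<^esub> n) = tensor_symbol K N M x (z [^]\<^bsub>K\<^esub> (0::nat))"
    using M M.subset by (simp add: tensor_symbol_def M.rcos_const coset_mult_one)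
  then have "?c x z [^]\<^bsub>?Q\<^esub> n = \<one>\<^bsub>?Q\<^esub>"
    using tensor_pow_right[OF K x z xz, of N M n] tensor_pow_right[OF K x z xz, of N M 0] by simp
  ultimately have "Q.ord (?c x z) dvd m" "Q.ord (?c x z) dvd n"
    using c by (simp_all add: Q.pow_eq_id)
  with \<open>coprime m n\<close> have "Q.ord (?c x z) = 1"
    using coprime_common_divisor_nat by blast
  then have "?c x z = \<one>\<^bsub>?Q\<^esub>"
    using c Q.pow_eq_id[of "?c x z" 1] by simp
  then have "?c x z = tensor_cong K N M `` {[]}"
    by (simp add: quotient_tensor_def presented_group_def)
  then show ?thesis
    using eq_equiv_class[OF _ equiv_pres_cong] by (metis lists.Nil)
qed

text \<open>Write \<open>(a, b) = (a, 1)(1, b)\<close> and expand \<open>(a, b) \<otimes> (a', b')\<close> by the defining relations, first on the left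
  and then on the right. Elements of different factors commute, so conjugation affects a symbol only
  inside a factor; once the mixed symbols vanish, two factors are left and neither of them is conjugated.\<close>

lemma tensor_symbol_DirProd_split:
  assumes G: "group G" and H: "group H" and N: "N \<lhd> G" and M: "M \<lhd> H"
    and a: "a \<in> carrier G" "a' \<in> carrier G" and b: "b \<in> carrier H" "b' \<in> carrier H"
    and cross: "\<And>a b. a \<in> carrier G \<Longrightarrow> b \<in> carrier H \<Longrightarrow>
      ([tensor_symbol (G \<times>\<times> H) (N \<times> M) (N \<times> M) (a, \<one>\<^bsub>H\<^esub>) (\<one>\<^bsub>G\<^esub>, b)], []) \<in> tensor_cong (G \<times>\<times> H) (N \<times> M) (N \<times> M)"
      "\<And>a b. a \<in> carrier G \<Longrightarrow> b \<in> carrier H \<Longrightarrow>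
      ([tensor_symbol (G \<times>\<times> H) (N \<times> M) (N \<times> M) (\<one>\<^bsub>G\<^esub>, b) (a, \<one>\<^bsub>H\<^esub>)], []) \<in> tensor_cong (G \<times>\<times> H) (N \<times> M) (N \<times> M)"
  shows "([tensor_symbol (G \<times>\<times> H) (N \<times> M) (N \<times> M) (a, b) (a', b')],
    [tensor_symbol (G \<times>\<times> H) (N \<times> M) (N \<times> M) (a, \<one>\<^bsub>H\<^esub>) (a', \<one>\<^bsub>H\<^esub>),
     tensor_symbol (G \<times>\<times> H) (N \<times> M) (N \<times> M) (\<one>\<^bsub>G\<^esub>, b) (\<one>\<^bsub>G\<^esub>, b')])
    \<in> tensor_cong (G \<times>\<times> H) (N \<times> M) (N \<times> M)"
proof -
  interpret G: group G by fact
  interpret H: group H by fact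
  let ?K = "G \<times>\<times> H"
  let ?s = "tensor_symbol ?K (N \<times> M) (N \<times> M)"
  let ?c = "tensor_cong ?K (N \<times> M) (N \<times> M)"
  have K: "group ?K" by (rule DirProd_group[OF G H])
  have conj: "conj_by ?K (x, y) (z, t) = (conj_by G x z, conj_by H y t)"
    if "z \<in> carrier G" "t \<in> carrier H" for x y z t
    using that by (simp add: conj_by_def inv_DirProd[OF G H])
  have [simp]: "conj_by G x \<one>\<^bsub>G\<^esub> = x" "conj_by G \<one>\<^bsub>G\<^esub> x = \<one>\<^bsub>G\<^esub>" if "x \<in> carrier G" for x
    using that by (simp_all add: conj_by_def)
  have [simp]: "conj_by H x \<one>\<^bsub>H\<^esub> = x" "conj_by H \<one>\<^bsub>H\<^esub> x = \<one>\<^bsub>H\<^esub>" if "x \<in> carrier H" for x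
    using that by (simp_all add: conj_by_def)
  define b'' where "b'' = conj_by H b' b"
  have b'': "b'' \<in> carrier H" using b H by (simp add: b''_def)
  have s: "([?s x y], [?s x y]) \<in> ?c" if "x \<in> carrier ?K" "y \<in> carrier ?K" for x y
    using that tensor_symbol_letter[of x ?K y] by (intro pres_cong.refl) (simp del: mem_Sigma_iff carrier_DirProd)
  have "([?s (a, b) (a', b')], [?s (a, \<one>\<^bsub>H\<^esub>) (a', b'')] @ [?s (\<one>\<^bsub>G\<^esub>, b) (a', b')]) \<in> ?c"
    using tensor_cong_left[OF K, of "(a, \<one>\<^bsub>H\<^esub>)" "(\<one>\<^bsub>G\<^esub>, b)" "(a', b')" "N \<times> M" "N \<times> M"] a b
    by (simp add: conj b''_def)
  moreover have "([?s (a, \<one>\<^bsub>H\<^esub>) (a', b'')], [?s (a, \<one>\<^bsub>H\<^esub>) (\<one>\<^bsub>G\<^esub>, b'')] @ [?s (a, \<one>\<^bsub>H\<^esub>) (a', \<one>\<^bsub>H\<^esub>)]) \<in> ?c"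
    using tensor_cong_right[OF K, of "(a, \<one>\<^bsub>H\<^esub>)" "(a', \<one>\<^bsub>H\<^esub>)" "(\<one>\<^bsub>G\<^esub>, b'')" "N \<times> M" "N \<times> M"] a b b''
    by (simp add: conj)
  moreover have "([?s (a, \<one>\<^bsub>H\<^esub>) (\<one>\<^bsub>G\<^esub>, b'')] @ [?s (a, \<one>\<^bsub>H\<^esub>) (a', \<one>\<^bsub>H\<^esub>)], [] @ [?s (a, \<one>\<^bsub>H\<^esub>) (a', \<one>\<^bsub>H\<^esub>)]) \<in> ?c"
    using a b'' by (intro pres_cong.append cross s) auto
  ultimately have "([?s (a, \<one>\<^bsub>H\<^esub>) (a', b'')], [?s (a, \<one>\<^bsub>H\<^esub>) (a', \<one>\<^bsub>H\<^esub>)]) \<in> ?c"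
    and *: "([?s (a, b) (a', b')], [?s (a, \<one>\<^bsub>H\<^esub>) (a', b'')] @ [?s (\<one>\<^bsub>G\<^esub>, b) (a', b')]) \<in> ?c"
    using pres_cong.trans unfolding append_Nil by fast+
  then have "([?s (a, \<one>\<^bsub>H\<^esub>) (a', b'')] @ [?s (\<one>\<^bsub>G\<^esub>, b) (a', b')],
      [?s (a, \<one>\<^bsub>H\<^esub>) (a', \<one>\<^bsub>H\<^esub>)] @ [?s (\<one>\<^bsub>G\<^esub>, b) (a', b')]) \<in> ?c"
    using a b by (intro pres_cong.append s) auto
  from pres_cong.trans[OF * this] have 1: "([?s (a, b) (a', b')], [?s (a, \<one>\<^bsub>H\<^esub>) (a', \<one>\<^bsub>H\<^esub>)] @ [?s (\<one>\<^bsub>G\<^esub>, b) (a', b')]) \<in> ?c"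
    .
  have "([?s (\<one>\<^bsub>G\<^esub>, b) (a', b')], [?s (\<one>\<^bsub>G\<^esub>, b) (\<one>\<^bsub>G\<^esub>, b')] @ [?s (\<one>\<^bsub>G\<^esub>, conj_by H b b') (a', \<one>\<^bsub>H\<^esub>)]) \<in> ?c"
    using tensor_cong_right[OF K, of "(\<one>\<^bsub>G\<^esub>, b)" "(a', \<one>\<^bsub>H\<^esub>)" "(\<one>\<^bsub>G\<^esub>, b')" "N \<times> M" "N \<times> M"] a b b''
    by (simp add: conj)
  moreover have "([?s (\<one>\<^bsub>G\<^esub>, b) (\<one>\<^bsub>G\<^esub>, b')] @ [?s (\<one>\<^bsub>G\<^esub>, conj_by H b b') (a', \<one>\<^bsub>H\<^esub>)], [?s (\<one>\<^bsub>G\<^esub>, b) (\<one>\<^bsub>G\<^esub>, b')] @ []) \<in> ?c"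
    using a b H by (intro pres_cong.append cross s) auto
  ultimately have 2: "([?s (\<one>\<^bsub>G\<^esub>, b) (a', b')], [?s (\<one>\<^bsub>G\<^esub>, b) (\<one>\<^bsub>G\<^esub>, b')]) \<in> ?c"
    unfolding append_Nil2 by (rule pres_cong.trans)
  have "([?s (a, \<one>\<^bsub>H\<^esub>) (a', \<one>\<^bsub>H\<^esub>)] @ [?s (\<one>\<^bsub>G\<^esub>, b) (a', b')],
      [?s (a, \<one>\<^bsub>H\<^esub>) (a', \<one>\<^bsub>H\<^esub>)] @ [?s (\<one>\<^bsub>G\<^esub>, b) (\<one>\<^bsub>G\<^esub>, b')]) \<in> ?c"
    using a b by (intro pres_cong.append 2 s) auto
  from pres_cong.trans[OF 1 this] show ?thesis by simp
qed

text \<open>Triviality passes from the product to the factors along the projections, and from the factors to the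
  product along the inclusions. For the second direction the symbol of the product has to be the product
  of the symbols of the factors, which holds because the mixed symbols are torsion of coprime orders.
  The exponents \<open>k\<close> may depend on the element; in this form the hypotheses pass easily from finitely many
  subgroups to their intersection.\<close>

lemma wedge_trivial_DirProd:
  fixes p q :: nat
  assumes G: "group G" and H: "group H" and N: "N \<lhd> G" and M: "M \<lhd> H" and "coprime p q"
    and p: "\<And>x. x \<in> carrier G \<Longrightarrow> \<exists>k. x [^]\<^bsub>G\<^esub> (p ^ k) \<in> N"
    and q: "\<And>x. x \<in> carrier H \<Longrightarrow> \<exists>k. x [^]\<^bsub>H\<^esub> (q ^ k) \<in> M"
    and a: "a \<in> carrier G" "a' \<in> carrier G" and b: "b \<in> carrier H" "b' \<in> carrier H"
  shows "wedge_trivial (G \<times>\<times> H) (N \<times> M) (a, b) (a', b') \<longleftrightarrow>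
    wedge_trivial G N a a' \<and> wedge_trivial H M b b'"
proof
  interpret G: group G by fact
  interpret H: group H by fact
  interpret N: normal N G by fact
  interpret M: normal M H by fact
  let ?K = "G \<times>\<times> H"
  have K: "group ?K" by (rule DirProd_group[OF G H])
  have NM: "N \<times> M \<lhd> ?K" by (rule G.DirProd_normal[OF H N M])
  have one: "\<one>\<^bsub>G\<^esub> \<in> N" "\<one>\<^bsub>H\<^esub> \<in> M" by (rule N.one_closed, rule M.one_closed)
  {
    assume *: "wedge_trivial ?K (N \<times> M) (a, b) (a', b')"
    have "fst \<in> hom ?K G" "snd \<in> hom ?K H"
      by (auto simp: hom_def mult_DirProd')
    then show "wedge_trivial G N a a' \<and> wedge_trivial H M b b'"
      using wedge_trivial_hom[OF K G _ NM N _ _ _ *, of fst] wedge_trivial_hom[OF K H _ NM M _ _ _ *, of snd] a b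
      by (simp add: image_subset_iff)
  next
    assume *: "wedge_trivial G N a a' \<and> wedge_trivial H M b b'"
    have "(\<lambda>x. (x, \<one>\<^bsub>H\<^esub>)) \<in> hom G ?K" "(\<lambda>x. (\<one>\<^bsub>G\<^esub>, x)) \<in> hom H ?K"
      by (auto simp: hom_def)
    then have "wedge_trivial ?K (N \<times> M) (a, \<one>\<^bsub>H\<^esub>) (a', \<one>\<^bsub>H\<^esub>)" "wedge_trivial ?K (N \<times> M) (\<one>\<^bsub>G\<^esub>, b) (\<one>\<^bsub>G\<^esub>, b')"
      using wedge_trivial_hom[OF G K _ N NM, of "\<lambda>x. (x, \<one>\<^bsub>H\<^esub>)" a a']
        wedge_trivial_hom[OF H K _ M NM, of "\<lambda>x. (\<one>\<^bsub>G\<^esub>, x)" b b'] * a b one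
      by (simp_all add: image_subset_iff)
    then obtain u v where u: "u \<in> diagonal_words ?K (N \<times> M)" 
        "([tensor_symbol ?K (N \<times> M) (N \<times> M) (a, \<one>\<^bsub>H\<^esub>) (a', \<one>\<^bsub>H\<^esub>)], u) \<in> tensor_cong ?K (N \<times> M) (N \<times> M)"
      and v: "v \<in> diagonal_words ?K (N \<times> M)" 
        "([tensor_symbol ?K (N \<times> M) (N \<times> M) (\<one>\<^bsub>G\<^esub>, b) (\<one>\<^bsub>G\<^esub>, b')], v) \<in> tensor_cong ?K (N \<times> M) (N \<times> M)"
      by (auto simp: wedge_trivial_def)
    have pow: "(x, y) [^]\<^bsub>?K\<^esub> (k::nat) = (x [^]\<^bsub>G\<^esub> k, y [^]\<^bsub>H\<^esub> k)" for x y k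
      by (induction k) (simp_all add: nat_pow_def)
    have cross: "([tensor_symbol ?K (N \<times> M) (N \<times> M) (x, \<one>\<^bsub>H\<^esub>) (\<one>\<^bsub>G\<^esub>, y)], []) \<in> tensor_cong ?K (N \<times> M) (N \<times> M)"
      "([tensor_symbol ?K (N \<times> M) (N \<times> M) (\<one>\<^bsub>G\<^esub>, y) (x, \<one>\<^bsub>H\<^esub>)], []) \<in> tensor_cong ?K (N \<times> M) (N \<times> M)"
      if xy: "x \<in> carrier G" "y \<in> carrier H" for x y
    proof -
      obtain k l where kl: "x [^]\<^bsub>G\<^esub> (p ^ k) \<in> N" "y [^]\<^bsub>H\<^esub> (q ^ l) \<in> M"
        using p q xy by blast
      have cop: "coprime (p ^ k) (q ^ l)" "coprime (q ^ l) (p ^ k)"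
        using \<open>coprime p q\<close> by (auto simp: coprime_commute)
      show "([tensor_symbol ?K (N \<times> M) (N \<times> M) (x, \<one>\<^bsub>H\<^esub>) (\<one>\<^bsub>G\<^esub>, y)], []) \<in> tensor_cong ?K (N \<times> M) (N \<times> M)"
        using xy kl one by (intro tensor_symbol_coprime_torsion[OF K _ _ _ NM _ NM _ cop(1)]) (simp_all add: pow)
      show "([tensor_symbol ?K (N \<times> M) (N \<times> M) (\<one>\<^bsub>G\<^esub>, y) (x, \<one>\<^bsub>H\<^esub>)], []) \<in> tensor_cong ?K (N \<times> M) (N \<times> M)"
        using xy kl one by (intro tensor_symbol_coprime_torsion[OF K _ _ _ NM _ NM _ cop(2)]) (simp_all add: pow)
    qed
    have "([tensor_symbol ?K (N \<times> M) (N \<times> M) (a, b) (a', b')],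
      [tensor_symbol ?K (N \<times> M) (N \<times> M) (a, \<one>\<^bsub>H\<^esub>) (a', \<one>\<^bsub>H\<^esub>)] @
      [tensor_symbol ?K (N \<times> M) (N \<times> M) (\<one>\<^bsub>G\<^esub>, b) (\<one>\<^bsub>G\<^esub>, b')]) \<in> tensor_cong ?K (N \<times> M) (N \<times> M)"
      using tensor_symbol_DirProd_split[OF G H N M a b cross] by simp
    from pres_cong.trans[OF this pres_cong.append[OF u(2) v(2)]]
    have "([tensor_symbol ?K (N \<times> M) (N \<times> M) (a, b) (a', b')], u @ v) \<in> tensor_cong ?K (N \<times> M) (N \<times> M)" .
    moreover have "u @ v \<in> diagonal_words ?K (N \<times> M)"
      using u v by (simp add: diagonal_words_def)
    ultimately show "wedge_trivial ?K (N \<times> M) (a, b) (a', b')"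
      unfolding wedge_trivial_def by blast
  }
qed


section \<open>The complete exterior square\<close>

lemma group_inv_lim:
  assumes A: "\<And>i. i \<in> I \<Longrightarrow> group (A i)"
    and \<pi>: "\<And>i j. i \<in> I \<Longrightarrow> j \<in> I \<Longrightarrow> r i j \<Longrightarrow> \<pi> i j \<in> hom (A i) (A j)"
  shows "group (inv_lim I r A \<pi>)"
proof (rule groupI)
  have hom: "group_hom (A i) (A j) (\<pi> i j)" if "i \<in> I" "j \<in> I" "r i j" for i j
    using that A \<pi> by (simp add: group_hom_def group_hom_axioms_def)
  show "\<one>\<^bsub>inv_lim I r A \<pi>\<^esub> \<in> carrier (inv_lim I r A \<pi>)"
    using A group_hom.hom_one[OF hom] by (auto simp: inv_lim_def group.is_monoid)
  fix f assume f: "f \<in> carrier (inv_lim I r A \<pi>)"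
  have fi: "f i \<in> carrier (A i)" if "i \<in> I" for i
    using f that by (auto simp: inv_lim_def)
  show "\<one>\<^bsub>inv_lim I r A \<pi>\<^esub> \<otimes>\<^bsub>inv_lim I r A \<pi>\<^esub> f = f"
  proof
    fix i show "(\<one>\<^bsub>inv_lim I r A \<pi>\<^esub> \<otimes>\<^bsub>inv_lim I r A \<pi>\<^esub> f) i = f i"
      using f A fi by (cases "i \<in> I") (auto simp: inv_lim_def group.is_monoid monoid.l_one dest: PiE_arb)
  qed
  have "(\<lambda>i\<in>I. inv\<^bsub>A i\<^esub> f i) \<in> carrier (inv_lim I r A \<pi>)"
    using f A fi group_hom.hom_inv[OF hom] by (auto simp: inv_lim_def)
  moreover have "(\<lambda>i\<in>I. inv\<^bsub>A i\<^esub> f i) \<otimes>\<^bsub>inv_lim I r A \<pi>\<^esub> f = \<one>\<^bsub>inv_lim I r A \<pi>\<^esub>"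
    using A fi by (auto simp: inv_lim_def group.l_inv)
  ultimately show "\<exists>g\<in>carrier (inv_lim I r A \<pi>). g \<otimes>\<^bsub>inv_lim I r A \<pi>\<^esub> f = \<one>\<^bsub>inv_lim I r A \<pi>\<^esub>"
    by blast
next
  have hom: "group_hom (A i) (A j) (\<pi> i j)" if "i \<in> I" "j \<in> I" "r i j" for i j
    using that A \<pi> by (simp add: group_hom_def group_hom_axioms_def)
  fix f g assume f: "f \<in> carrier (inv_lim I r A \<pi>)" and g: "g \<in> carrier (inv_lim I r A \<pi>)"
  have fi: "f i \<in> carrier (A i)" "g i \<in> carrier (A i)" if "i \<in> I" for i
    using f g that by (auto simp: inv_lim_def)
  show "f \<otimes>\<^bsub>inv_lim I r A \<pi>\<^esub> g \<in> carrier (inv_lim I r A \<pi>)"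
    using f g fi A group_hom.hom_mult[OF hom] by (auto simp: inv_lim_def group.is_monoid monoid.m_closed)
  fix h assume h: "h \<in> carrier (inv_lim I r A \<pi>)"
  have hi: "h i \<in> carrier (A i)" if "i \<in> I" for i
    using h that by (auto simp: inv_lim_def)
  show "f \<otimes>\<^bsub>inv_lim I r A \<pi>\<^esub> g \<otimes>\<^bsub>inv_lim I r A \<pi>\<^esub> h = f \<otimes>\<^bsub>inv_lim I r A \<pi>\<^esub> (g \<otimes>\<^bsub>inv_lim I r A \<pi>\<^esub> h)"
    using fi hi A by (auto simp: inv_lim_def group.is_monoid monoid.m_assoc)
qed

text \<open>An element of the tensor product is a whole class of words, and the transition map is applied to all of
  them; the image is one class because congruent words have congruent images.\<close>

lemma quotient_tensor_map_class:
  assumes K: "group K" and N: "N \<lhd> K" "N' \<lhd> K" "N \<subseteq> N'" and M: "M \<lhd> K" "M' \<lhd> K" "M \<subseteq> M'"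
    and u: "u \<in> lists (tensor_gens K N M \<times> UNIV)"
  shows "quotient_tensor_map K i (N', M') (tensor_cong K N M `` {u}) =
    tensor_cong K N' M' `` {map (map_prod (tensor_letter_map K N' M' (\<lambda>x. x)) id) u}"
proof -
  let ?f = "map (map_prod (tensor_letter_map K N' M' (\<lambda>x. x)) id)"
  have id: "(\<lambda>x. x) \<in> hom K K"
    by (auto simp: hom_def)
  have f: "(?f v, ?f w) \<in> tensor_cong K N' M'" if "(v, w) \<in> tensor_cong K N M" for v w
    using tensor_cong_map[OF K K id N(1,2) _ M(1,2) _ that] N(3) M(3) by simp
  have f_eq: "?f = map (\<lambda>((A, B), b). ((N' <#>\<^bsub>K\<^esub> A, M' <#>\<^bsub>K\<^esub> B), b))"
    by (intro arg_cong[where f = map]) (auto simp: tensor_letter_map_def)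
  have "quotient_tensor_map K i (N', M') (tensor_cong K N M `` {u}) =
      tensor_cong K N' M' `` (map (\<lambda>((A, B), b). ((N' <#>\<^bsub>K\<^esub> A, M' <#>\<^bsub>K\<^esub> B), b)) ` (tensor_cong K N M `` {u}))"
    by (simp add: quotient_tensor_map_def)
  also have "\<dots> = tensor_cong K N' M' `` (?f ` (tensor_cong K N M `` {u}))"
    by (simp only: f_eq)
  also have "\<dots> = tensor_cong K N' M' `` {?f u}"
  proof (intro equalityI subsetI)
    fix w assume "w \<in> tensor_cong K N' M' `` (?f ` (tensor_cong K N M `` {u}))"
    then obtain v where "(u, v) \<in> tensor_cong K N M" "(?f v, w) \<in> tensor_cong K N' M'"
      by blast
    then show "w \<in> tensor_cong K N' M' `` {?f u}"
      using f[of u v] pres_cong.trans by blast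
  next
    fix w assume "w \<in> tensor_cong K N' M' `` {?f u}"
    then show "w \<in> tensor_cong K N' M' `` (?f ` (tensor_cong K N M `` {u}))"
      using pres_cong.refl[OF u, of "tensor_rels K N M"] by blast
  qed
  finally show ?thesis .
qed

lemma quotient_tensor_map_hom:
  assumes K: "group K" and i: "i \<in> open_normal_pairs K T" and j: "j \<in> open_normal_pairs K T" and "pair_le i j"
  shows "quotient_tensor_map K i j \<in> hom (quotient_tensor K i) (quotient_tensor K j)"
proof -
  obtain N M N' M' where ij: "i = (N, M)" "j = (N', M')" by force
  then have N: "N \<lhd> K" "N' \<lhd> K" "N \<subseteq> N'" and M: "M \<lhd> K" "M' \<lhd> K" "M \<subseteq> M'"
    using assms by (auto simp: open_normal_pairs_def pair_le_def)
  let ?f = "map (map_prod (tensor_letter_map K N' M' (\<lambda>x. x)) id)"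
  have id: "(\<lambda>x. x) \<in> hom K K"
    by (auto simp: hom_def)
  have f: "?f u \<in> lists (tensor_gens K N' M' \<times> UNIV)" if "u \<in> lists (tensor_gens K N M \<times> (UNIV :: bool set))" for u
    using pres_cong_lists[OF tensor_cong_map[OF K K id N(1,2) _ M(1,2) _ pres_cong.refl[OF that]]] N(3) M(3) by simp
  show ?thesis
    unfolding ij
  proof (rule homI)
    fix x assume "x \<in> carrier (quotient_tensor K (N, M))"
    then obtain u where u: "u \<in> lists (tensor_gens K N M \<times> UNIV)" "x = tensor_cong K N M `` {u}"
      by (auto simp: quotient_tensor_def presented_group_carrier)
    then show "quotient_tensor_map K (N, M) (N', M') x \<in> carrier (quotient_tensor K (N', M'))"
      using f[OF u(1)] by (auto simp: quotient_tensor_map_class[OF K N M] quotient_tensor_def presented_group_carrier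
          simp del: in_lists_conv_set map_map)
    fix y assume "y \<in> carrier (quotient_tensor K (N, M))"
    then obtain v where v: "v \<in> lists (tensor_gens K N M \<times> UNIV)" "y = tensor_cong K N M `` {v}"
      by (auto simp: quotient_tensor_def presented_group_carrier)
    show "quotient_tensor_map K (N, M) (N', M') (x \<otimes>\<^bsub>quotient_tensor K (N, M)\<^esub> y) =
        quotient_tensor_map K (N, M) (N', M') x \<otimes>\<^bsub>quotient_tensor K (N', M')\<^esub> quotient_tensor_map K (N, M) (N', M') y"
      using u v f[OF u(1)] f[OF v(1)]
      by (simp add: quotient_tensor_def presented_group_mult quotient_tensor_map_class[OF K N M])
  qed
qed

lemma group_complete_tensor_square:
  assumes "group K"
  shows "group (complete_tensor_square K T)"
  unfolding complete_tensor_square_def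
proof (rule group_inv_lim)
  fix i show "group (quotient_tensor K i)"
    by (cases i) (simp add: quotient_tensor_def group_presented_group)
qed (rule quotient_tensor_map_hom[OF assms])

lemma complete_tensor_closed:
  assumes K: "group K" and x: "x \<in> carrier K" and y: "y \<in> carrier K"
  shows "complete_tensor K T x y \<in> carrier (complete_tensor_square K T)"
proof -
  let ?I = "open_normal_pairs K T"
  have id: "(\<lambda>x. x) \<in> hom K K"
    by (auto simp: hom_def)
  have sym: "[tensor_symbol K N M x y] \<in> lists (tensor_gens K N M \<times> UNIV)" for N M
    using tensor_symbol_letter[OF x y, of N M] by simp
  have "complete_tensor K T x y \<in> (\<Pi>\<^sub>E i\<in>?I. carrier (quotient_tensor K i))"
    using sym unfolding complete_tensor_def quotient_tensor_def by (auto simp only: presented_group_carrier restrict_PiE_iff) blast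
  moreover have "quotient_tensor_map K i j (complete_tensor K T x y i) = complete_tensor K T x y j"
    if ij: "i \<in> ?I" "j \<in> ?I" "pair_le i j" for i j
  proof -
    obtain N M N' M' where NM: "i = (N, M)" "j = (N', M')" by force
    then have N: "N \<lhd> K" "N' \<lhd> K" "N \<subseteq> N'" and M: "M \<lhd> K" "M' \<lhd> K" "M \<subseteq> M'"
      using ij by (auto simp: open_normal_pairs_def pair_le_def)
    show ?thesis
      using ij tensor_letter_map_symbol[OF K K id x y N(1,2) _ M(1,2)] N(3) M(3)
      by (simp add: NM complete_tensor_def quotient_tensor_map_class[OF K N M sym])
  qed
  ultimately show ?thesis
    by (simp add: complete_tensor_square_def inv_lim_def)
qed

lemma presented_group_inv:
  assumes "u \<in> lists (X \<times> UNIV)"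
  shows "inv\<^bsub>presented_group X R\<^esub> (pres_cong X R `` {u}) = pres_cong X R `` {rev (map (\<lambda>(x, b). (x, \<not> b)) u)}"
proof -
  let ?w = "rev (map (\<lambda>(x, b). (x, \<not> b)) u)"
  interpret group "presented_group X R" by (rule group_presented_group)
  have w: "?w \<in> lists (X \<times> UNIV)"
    using assms by (auto simp: in_lists_conv_set)
  have "pres_cong X R `` {?w} \<otimes>\<^bsub>presented_group X R\<^esub> pres_cong X R `` {u} = \<one>\<^bsub>presented_group X R\<^esub>"
    unfolding presented_group_mult[OF w assms] equiv_class_eq[OF equiv_pres_cong pres_cong_inverse[OF assms]]
    by (simp add: presented_group_def)
  then show ?thesis
    by (rule inv_equality) (use w assms presented_group_carrier in metis)+
qed

text \<open>The diagonal pairs \<open>(N, N)\<close> are cofinal, so an element of the limit can be tested on them.\<close>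

lemma finite_inter_open_normal:
  assumes "topological_group K T" "finite F" "F \<subseteq> open_normal_pairs K T"
  shows "\<exists>N. N \<lhd> K \<and> openin T N \<and> (\<forall>i\<in>F. pair_le (N, N) i)"
  using assms(2,3)
proof (induction F)
  case empty
  interpret group K using assms(1) by (simp add: topological_group_def)
  have "openin T (carrier K)"
    using assms(1) openin_topspace[of T] by (simp add: topological_group_def)
  with normal_self show ?case by auto
next
  case (insert i F)
  interpret group K using assms(1) by (simp add: topological_group_def)
  obtain N where N: "N \<lhd> K" "openin T N" "\<forall>i\<in>F. pair_le (N, N) i"
    using insert by auto
  obtain A B where i: "i = (A, B)" "A \<lhd> K" "openin T A" "B \<lhd> K" "openin T B"
    using insert.prems by (auto simp: open_normal_pairs_def)
  have "N \<inter> (A \<inter> B) \<lhd> K" "openin T (N \<inter> (A \<inter> B))"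
    using N i by (auto intro!: normal_subgroup_intersect)
  moreover have "\<forall>j\<in>insert i F. pair_le (N \<inter> (A \<inter> B), N \<inter> (A \<inter> B)) j"
    using N(3) i(1) by (auto simp: pair_le_def)
  ultimately show ?case by blast
qed

text \<open>The set on the right is closed, being cut out by conditions on single coordinates. Conversely, a closed
  subgroup \<open>S\<close> containing all \<open>x \<otimes> x\<close> contains every such \<open>f\<close>: a basic neighbourhood of \<open>f\<close> restricts finitely
  many coordinates, all of them images of the coordinate at some \<open>(N, N)\<close>, and the word that represents
  \<open>f (N, N)\<close> lifts to an element of \<open>S\<close> with the same coordinate there. Hence membership can be decided
  in the quotients.\<close>

lemma complete_nabla_eq:
  assumes tg: "topological_group K T"
  shows "complete_nabla K T = {f \<in> carrier (complete_tensor_square K T).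
    \<forall>N. N \<lhd> K \<and> openin T N \<longrightarrow> (\<exists>w\<in>diagonal_words K N. f (N, N) = tensor_cong K N N `` {w})}" (is "_ = ?Z")
proof -
  let ?L = "complete_tensor_square K T"
  let ?I = "open_normal_pairs K T"
  have K: "group K" using tg by (simp add: topological_group_def)
  interpret K: group K by fact
  interpret L: group ?L by (rule group_complete_tensor_square[OF K])
  have diag_lists: "w \<in> lists (tensor_gens K N N \<times> UNIV)" if "w \<in> diagonal_words K N" for w N
    using that by (auto simp: diagonal_words_def tensor_gens_def in_lists_conv_set)
  have gQ: "group (quotient_tensor K i)" for i
    by (cases i) (simp add: quotient_tensor_def group_presented_group)
  have L_at: "f i \<in> carrier (quotient_tensor K i)" if "f \<in> carrier ?L" "i \<in> ?I" for f i
    using that by (auto simp: complete_tensor_square_def inv_lim_def)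
  have mult_at: "(f \<otimes>\<^bsub>?L\<^esub> g) i = f i \<otimes>\<^bsub>quotient_tensor K i\<^esub> g i" if "i \<in> ?I" for f g i
    using that by (simp add: complete_tensor_square_def inv_lim_def)
  have one_at: "\<one>\<^bsub>?L\<^esub> i = \<one>\<^bsub>quotient_tensor K i\<^esub>" if "i \<in> ?I" for i
    using that by (simp add: complete_tensor_square_def inv_lim_def)
  have inv_at: "(inv\<^bsub>?L\<^esub> f) i = inv\<^bsub>quotient_tensor K i\<^esub> f i" if "f \<in> carrier ?L" "i \<in> ?I" for f i
  proof -
    have "(inv\<^bsub>?L\<^esub> f) i \<otimes>\<^bsub>quotient_tensor K i\<^esub> f i = \<one>\<^bsub>quotient_tensor K i\<^esub>"
      using that mult_at[of i "inv\<^bsub>?L\<^esub> f" f] one_at[of i] by simp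
    then show ?thesis
      using group.inv_equality[OF gQ] L_at that by (metis L.inv_closed)
  qed
  have pairI: "(N, N) \<in> ?I" if "N \<lhd> K" "openin T N" for N
    using that by (simp add: open_normal_pairs_def)
  show ?thesis
  proof (intro equalityI subsetI)
    fix f assume "f \<in> complete_nabla K T"
    moreover have "subgroup ?Z ?L"
    proof (rule subgroup.intro)
      show "?Z \<subseteq> carrier ?L" by blast
    next
      fix f g assume "f \<in> ?Z" "g \<in> ?Z"
      then show "f \<otimes>\<^bsub>?L\<^esub> g \<in> ?Z"
      proof (safe intro!: L.m_closed)
        fix N assume N: "N \<lhd> K" "openin T N"
          and f: "\<forall>N. N \<lhd> K \<and> openin T N \<longrightarrow> (\<exists>w\<in>diagonal_words K N. f (N, N) = tensor_cong K N N `` {w})"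
          and g: "\<forall>N. N \<lhd> K \<and> openin T N \<longrightarrow> (\<exists>w\<in>diagonal_words K N. g (N, N) = tensor_cong K N N `` {w})"
        obtain u v where "u \<in> diagonal_words K N" "f (N, N) = tensor_cong K N N `` {u}"
          "v \<in> diagonal_words K N" "g (N, N) = tensor_cong K N N `` {v}"
          using f g N by blast
        then have "u @ v \<in> diagonal_words K N" "(f \<otimes>\<^bsub>?L\<^esub> g) (N, N) = tensor_cong K N N `` {u @ v}"
          using presented_group_mult[OF diag_lists diag_lists] mult_at[OF pairI[OF N]]
          by (simp_all add: diagonal_words_def quotient_tensor_def)
        then show "\<exists>w\<in>diagonal_words K N. (f \<otimes>\<^bsub>?L\<^esub> g) (N, N) = tensor_cong K N N `` {w}"
          by blast
      qed
    next
      have "\<exists>w\<in>diagonal_words K N. \<one>\<^bsub>?L\<^esub> (N, N) = tensor_cong K N N `` {w}" if N: "N \<lhd> K" "openin T N" for N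
        using one_at[OF pairI[OF N]] by (auto simp: diagonal_words_def quotient_tensor_def presented_group_def intro!: bexI[of _ "[]"])
      then show "\<one>\<^bsub>?L\<^esub> \<in> ?Z" by simp
    next
      fix f assume "f \<in> ?Z"
      then show "inv\<^bsub>?L\<^esub> f \<in> ?Z"
      proof (safe intro!: L.inv_closed)
        fix N assume N: "N \<lhd> K" "openin T N" and fL: "f \<in> carrier ?L"
          and f: "\<forall>N. N \<lhd> K \<and> openin T N \<longrightarrow> (\<exists>w\<in>diagonal_words K N. f (N, N) = tensor_cong K N N `` {w})"
        obtain u where u: "u \<in> diagonal_words K N" "f (N, N) = tensor_cong K N N `` {u}"
          using f N by blast
        let ?w = "rev (map (\<lambda>(x, b). (x, \<not> b)) u)"
        have "?w \<in> diagonal_words K N"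
          using u(1) by (auto simp: diagonal_words_def in_lists_conv_set)
        moreover have "(inv\<^bsub>?L\<^esub> f) (N, N) = tensor_cong K N N `` {?w}"
          using presented_group_inv[OF diag_lists[OF u(1)]] inv_at[OF fL pairI[OF N]] u(2)
          by (simp add: quotient_tensor_def)
        ultimately show "\<exists>w\<in>diagonal_words K N. (inv\<^bsub>?L\<^esub> f) (N, N) = tensor_cong K N N `` {w}"
          by blast
      qed
    qed
    moreover have "closedin (complete_tensor_topology K T) ?Z"
    proof -
      let ?P = "product_topology (\<lambda>i. discrete_topology (carrier (quotient_tensor K i))) ?I"
      let ?W = "\<lambda>N. {c \<in> carrier (quotient_tensor K (N, N)). \<exists>w\<in>diagonal_words K N. c = tensor_cong K N N `` {w}}"
      let ?C = "\<lambda>N. {f \<in> topspace ?P. f (N, N) \<in> ?W N}"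
      let ?D = "{?C N |N. N \<lhd> K \<and> openin T N}"
      have "closedin ?P (?C N)" if N: "N \<lhd> K" "openin T N" for N
        by (rule closedin_continuous_map_preimage[OF continuous_map_product_projection[OF pairI[OF N]]]) auto
      moreover have "?D \<noteq> {}"
        using K.normal_self tg openin_topspace[of T] by (auto simp: topological_group_def)
      ultimately have "closedin ?P (\<Inter>?D)"
        by (intro closedin_Inter) auto
      moreover have "?Z = carrier ?L \<inter> \<Inter>?D"
      proof (intro equalityI subsetI)
        fix f assume f: "f \<in> ?Z"
        then have "f \<in> topspace ?P"
          by (auto simp: complete_tensor_square_def inv_lim_def)
        with f show "f \<in> carrier ?L \<inter> \<Inter>?D"
          using L_at pairI by auto
      next
        fix f assume f: "f \<in> carrier ?L \<inter> \<Inter>?D"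
        have "\<exists>w\<in>diagonal_words K N. f (N, N) = tensor_cong K N N `` {w}" if "N \<lhd> K" "openin T N" for N
        proof -
          have "f \<in> ?C N" using f that by blast
          then show ?thesis by blast
        qed
        with f show "f \<in> ?Z" by blast
      qed
      ultimately show ?thesis
        by (auto simp: complete_tensor_topology_def inv_lim_topology_def closedin_subtopology
            complete_tensor_square_def[symmetric])
    qed
    moreover have "complete_tensor K T x x \<in> ?Z" if x: "x \<in> carrier K" for x
    proof -
      have "\<exists>w\<in>diagonal_words K N. complete_tensor K T x x (N, N) = tensor_cong K N N `` {w}"
        if N: "N \<lhd> K" "openin T N" for N
      proof (rule bexI)
        show "complete_tensor K T x x (N, N) = tensor_cong K N N `` {[((N #>\<^bsub>K\<^esub> x, N #>\<^bsub>K\<^esub> x), True)]}"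
          using pairI[OF N] by (simp add: complete_tensor_def tensor_symbol_def)
        show "[((N #>\<^bsub>K\<^esub> x, N #>\<^bsub>K\<^esub> x), True)] \<in> diagonal_words K N"
          using coset_in_Mod[OF x, of N] by (simp add: diagonal_words_def)
      qed
      then show ?thesis
        using complete_tensor_closed[OF K x x] by blast
    qed
    ultimately show "f \<in> ?Z"
      unfolding complete_nabla_def by blast
  next
    fix f assume f: "f \<in> ?Z"
    have "f \<in> S" if S: "subgroup S ?L" "closedin (complete_tensor_topology K T) S"
      "\<And>x. x \<in> carrier K \<Longrightarrow> complete_tensor K T x x \<in> S" for S
    proof (rule ccontr)
      assume nf: "f \<notin> S"
      let ?X = "\<lambda>i. discrete_topology (carrier (quotient_tensor K i))"
      obtain C where C: "closedin (product_topology ?X ?I) C" "S = C \<inter> carrier ?L"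
        using S(2) by (auto simp: complete_tensor_topology_def inv_lim_topology_def closedin_subtopology
            complete_tensor_square_def[symmetric])
      have "openin (product_topology ?X ?I) (topspace (product_topology ?X ?I) - C)"
        using C by blast
      moreover have "f \<in> topspace (product_topology ?X ?I) - C"
        using f nf C(2) by (auto simp: complete_tensor_square_def inv_lim_def)
      ultimately have "\<exists>U. finite {i \<in> ?I. U i \<noteq> topspace (?X i)} \<and> (\<forall>i\<in>?I. openin (?X i) (U i)) \<and>
          f \<in> PiE ?I U \<and> PiE ?I U \<subseteq> topspace (product_topology ?X ?I) - C"
        unfolding openin_product_topology_alt by (rule bspec)
      then obtain U where U: "finite {i \<in> ?I. U i \<noteq> topspace (?X i)}" "f \<in> PiE ?I U"
        "PiE ?I U \<subseteq> topspace (product_topology ?X ?I) - C"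
        by (elim exE conjE)
      obtain N where N: "N \<lhd> K" "openin T N" "\<forall>i\<in>{i \<in> ?I. U i \<noteq> topspace (?X i)}. pair_le (N, N) i"
        using finite_inter_open_normal[OF tg U(1)] by blast
      interpret S: subgroup S ?L by fact
      \<comment> \<open>A diagonal letter lifts to \<open>x \<otimes> x \<in> S\<close> or to its inverse, and a word to the product of these lifts.\<close>
      have lift: "\<exists>d\<in>S. d (N, N) = tensor_cong K N N `` {w}" if "w \<in> diagonal_words K N" for w
        using that
      proof (induction w rule: list.induct)
        case Nil
        have "\<one>\<^bsub>?L\<^esub> (N, N) = tensor_cong K N N `` {[]}"
          using one_at[OF pairI[OF N(1,2)]] by (simp add: quotient_tensor_def presented_group_def)
        then show ?case
          using S.one_closed by blast
      next
        case (Cons l w)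
        have w: "w \<in> diagonal_words K N" and "l \<in> (\<lambda>C. (C, C)) ` carrier (K Mod N) \<times> UNIV"
          using Cons.prems by (simp_all add: diagonal_words_def del: mem_Sigma_iff)
        then obtain x b where x: "x \<in> carrier K" and l: "l = ((N #>\<^bsub>K\<^esub> x, N #>\<^bsub>K\<^esub> x), b)"
          by (auto simp: FactGroup_def RCOSETS_def)
        obtain d where d: "d \<in> S" "d (N, N) = tensor_cong K N N `` {w}"
          using Cons.IH w by blast
        let ?e = "complete_tensor K T x x"
        have e: "?e \<in> S" "?e (N, N) = tensor_cong K N N `` {[((N #>\<^bsub>K\<^esub> x, N #>\<^bsub>K\<^esub> x), True)]}"
          using S(3)[OF x] pairI[OF N(1,2)] by (auto simp: complete_tensor_def tensor_symbol_def)
        have el: "[((N #>\<^bsub>K\<^esub> x, N #>\<^bsub>K\<^esub> x), b)] \<in> lists (tensor_gens K N N \<times> UNIV)" for b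
          using coset_in_Mod[OF x, of N] by (simp add: tensor_gens_def)
        have "\<exists>e'\<in>S. e' (N, N) = tensor_cong K N N `` {[l]}"
        proof (cases b)
          case True
          then show ?thesis using e l by auto
        next
          case False
          have "(inv\<^bsub>?L\<^esub> ?e) (N, N) = tensor_cong K N N `` {[l]}"
            using inv_at[of ?e "(N, N)"] complete_tensor_closed[OF K x x] pairI[OF N(1,2)] e(2) False
              presented_group_inv[OF el[of True]]
            by (simp add: l quotient_tensor_def)
          then show ?thesis using e(1) by blast
        qed
        then obtain e' where e': "e' \<in> S" "e' (N, N) = tensor_cong K N N `` {[l]}"
          by blast
        have "(e' \<otimes>\<^bsub>?L\<^esub> d) (N, N) = tensor_cong K N N `` {[l] @ w}"
          using mult_at[OF pairI[OF N(1,2)]] e' d presented_group_mult[OF el[of b] diag_lists[OF w]]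
          by (simp add: quotient_tensor_def l)
        then show ?case
          using e'(1) d(1) by auto
      qed
      obtain w where "w \<in> diagonal_words K N" "f (N, N) = tensor_cong K N N `` {w}"
        using f N by blast
      then obtain d where d: "d \<in> S" "d (N, N) = f (N, N)"
        using lift by metis
      have dL: "d \<in> carrier ?L" using d(1) S.subset by blast
      have compat: "quotient_tensor_map K (N, N) i (g (N, N)) = g i"
        if "g \<in> carrier ?L" "i \<in> ?I" "pair_le (N, N) i" for g i
        using that pairI[OF N(1,2)] by (auto simp: complete_tensor_square_def inv_lim_def)
      have "d \<in> PiE ?I U"
      proof (rule PiE_I)
        fix i assume i: "i \<in> ?I"
        show "d i \<in> U i"
        proof (cases "U i = topspace (?X i)")
          case True
          then show ?thesis using L_at[OF dL i] by simp
        next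
          case False
          then have "pair_le (N, N) i" using N(3) i by blast
          then have "d i = f i"
            using compat[OF dL i] compat[of f i] f i d(2) by auto
          then show ?thesis using U(2) i by auto
        qed
      next
        fix i assume "i \<notin> ?I"
        then show "d i = undefined"
          using dL by (auto simp: complete_tensor_square_def inv_lim_def dest: PiE_arb)
      qed
      then show False using U(3) d(1) C(2) by blast
    qed
    then show "f \<in> complete_nabla K T"
      unfolding complete_nabla_def by blast
  qed
qed

text \<open>The coset of \<open>x \<otimes> y\<close> is trivial iff \<open>x \<otimes> y\<close> lies in the closed subgroup just described, and the coordinate
  of \<open>x \<otimes> y\<close> at \<open>(N, N)\<close> is the class of the one-letter word \<open>Nx \<otimes> Ny\<close>.\<close>

lemma complete_wedge_eq_one_iff:
  assumes tg: "topological_group K T" and x: "x \<in> carrier K" and y: "y \<in> carrier K"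
  shows "complete_wedge K T x y = \<one>\<^bsub>complete_exterior_square K T\<^esub> \<longleftrightarrow>
    (\<forall>N. N \<lhd> K \<and> openin T N \<longrightarrow> wedge_trivial K N x y)"
proof -
  let ?L = "complete_tensor_square K T"
  let ?c = "complete_tensor K T x y"
  have K: "group K" using tg by (simp add: topological_group_def)
  interpret L: group ?L by (rule group_complete_tensor_square[OF K])
  have c: "?c \<in> carrier ?L" by (rule complete_tensor_closed[OF K x y])
  have sub: "subgroup (complete_nabla K T) ?L"
  proof (rule L.subgroupI)
    show "complete_nabla K T \<subseteq> carrier ?L"
      using complete_nabla_eq[OF tg] by auto
    show "complete_nabla K T \<noteq> {}"
      unfolding complete_nabla_def by (auto intro!: exI[of _ "\<one>\<^bsub>?L\<^esub>"] subgroup.one_closed)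
  qed (auto simp: complete_nabla_def intro: subgroup.m_inv_closed subgroup.m_closed)
  have "complete_wedge K T x y = \<one>\<^bsub>complete_exterior_square K T\<^esub> \<longleftrightarrow> ?c \<in> complete_nabla K T"
    using L.coset_join1[OF _ c sub] L.coset_join2[OF c sub] subgroup.subset[OF sub]
    by (auto simp: complete_wedge_def complete_exterior_square_def FactGroup_def)
  also have "\<dots> \<longleftrightarrow> (\<forall>N. N \<lhd> K \<and> openin T N \<longrightarrow> wedge_trivial K N x y)"
  proof -
    have "(\<exists>w\<in>diagonal_words K N. ?c (N, N) = tensor_cong K N N `` {w}) \<longleftrightarrow> wedge_trivial K N x y"
      if N: "N \<lhd> K" "openin T N" for N
    proof -
      have "?c (N, N) = tensor_cong K N N `` {[tensor_symbol K N N x y]}"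
        using N by (simp add: complete_tensor_def open_normal_pairs_def)
      moreover have "tensor_cong K N N `` {[tensor_symbol K N N x y]} = tensor_cong K N N `` {w} \<longleftrightarrow>
          ([tensor_symbol K N N x y], w) \<in> tensor_cong K N N" if "w \<in> diagonal_words K N" for w
      proof (rule eq_equiv_class_iff[OF equiv_pres_cong])
        show "[tensor_symbol K N N x y] \<in> lists (tensor_gens K N N \<times> UNIV)"
          using tensor_symbol_letter[OF x y] by simp
        show "w \<in> lists (tensor_gens K N N \<times> UNIV)"
          using that by (auto simp: diagonal_words_def tensor_gens_def in_lists_conv_set)
      qed
      ultimately show ?thesis
        by (simp add: wedge_trivial_def)
    qed
    then show ?thesis
      using c by (auto simp: complete_nabla_eq[OF tg])
  qed
  finally show ?thesis .
qed

section \<open>Finite Radon measures\<close>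

lemma finite_measures_agree:
  assumes "finite_measure M" "finite_measure M'" "space M = \<Omega>" "space M' = \<Omega>"
    and G: "Int_stable \<G>" "\<G> \<subseteq> sets M" "\<G> \<subseteq> sets M'" "\<Omega> \<in> \<G>"
    and eq: "\<And>E. E \<in> \<G> \<Longrightarrow> emeasure M E = emeasure M' E"
    and A: "A \<in> sigma_sets \<Omega> \<G>"
  shows "emeasure M A = emeasure M' A"
proof -
  interpret M: finite_measure M by fact
  interpret M': finite_measure M' by fact
  have sub: "sigma_sets \<Omega> \<G> \<subseteq> sets M" "sigma_sets \<Omega> \<G> \<subseteq> sets M'"
    using G sets.sigma_sets_subset[of \<G> M] sets.sigma_sets_subset[of \<G> M'] assms(3,4) by auto
  have "\<G> \<subseteq> Pow \<Omega>"
    using G(2) sets.space_closed[of M] assms(3) by auto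
  with G(1) show ?thesis
    using A
  proof (induction rule: sigma_sets_induct_disjoint)
    case (compl A)
    then have "A \<in> sets M" "A \<in> sets M'" using sub by auto
    then show ?case
      using emeasure_compl[of A M] emeasure_compl[of A M'] compl eq[OF G(4)] assms(3,4) by auto
  next
    case (union A)
    then have "range A \<subseteq> sets M" "range A \<subseteq> sets M'" using sub by auto
    then show ?case
      using suminf_emeasure[of A M] suminf_emeasure[of A M'] union by auto
  qed (use eq in auto)
qed

lemma finite_radon_sets_openin:
  "finite_radon_measure X M \<Longrightarrow> openin X U \<Longrightarrow> U \<in> sets M"
  by (auto simp: finite_radon_measure_def)

lemma finite_radon_sets_closedin:
  assumes "finite_radon_measure X M" "closedin X C"
  shows "C \<in> sets M"
proof -
  have "C = space M - (topspace X - C)"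
    using assms closedin_subset[OF assms(2)] by (auto simp: finite_radon_measure_def)
  then show ?thesis
    using finite_radon_sets_openin[OF assms(1), of "topspace X - C"] assms(2) by (metis closedin_def sets.compl_sets)
qed

lemma finite_radon_inner:
  assumes M: "finite_radon_measure X M" and A: "A \<in> sets M" and y: "y < measure M A"
  shows "\<exists>C. compactin X C \<and> C \<subseteq> A \<and> y < measure M C"
proof (cases "y < 0")
  case True
  then show ?thesis
    by (intro exI[of _ "{}"]) auto
next
  case False
  interpret finite_measure M using M by (simp add: finite_radon_measure_def)
  have "ennreal y < emeasure M A"
    using y False by (simp add: emeasure_eq_measure ennreal_less_iff)
  also have "emeasure M A = (SUP C\<in>{C. compactin X C \<and> C \<subseteq> A}. emeasure M C)"
    using M A by (simp add: finite_radon_measure_def)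
  finally obtain C where "compactin X C" "C \<subseteq> A" "ennreal y < emeasure M C"
    by (auto simp: less_SUP_iff)
  with False show ?thesis
    by (auto simp: emeasure_eq_measure ennreal_less_iff)
qed

lemma finite_radon_outer:
  assumes X: "Hausdorff_space X" and M: "finite_radon_measure X M" and A: "A \<in> sets M" and y: "measure M A < y"
  shows "\<exists>V. openin X V \<and> A \<subseteq> V \<and> measure M V < y"
proof -
  interpret finite_measure M using M by (simp add: finite_radon_measure_def)
  have sp: "space M = topspace X" using M by (simp add: finite_radon_measure_def)
  have "measure M (space M) - y < measure M (space M - A)"
    using y A by (simp add: finite_measure_compl)
  then obtain C where C: "compactin X C" "C \<subseteq> space M - A" "measure M (space M) - y < measure M C"
    using finite_radon_inner[OF M, of "space M - A" "measure M (space M) - y"] A by auto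
  have cl: "closedin X C" using compactin_imp_closedin[OF X C(1)] .
  have "measure M (topspace X - C) < y"
    using C(3) finite_measure_compl[OF finite_radon_sets_closedin[OF M cl]] sp by simp
  moreover have "A \<subseteq> topspace X - C"
    using C(2) sets.sets_into_space[OF A] sp by auto
  ultimately show ?thesis
    using cl by (intro exI[of _ "topspace X - C"]) auto
qed

text \<open>A compact subset of an open set \<open>U\<close> is covered by finitely many members of the base that lie in \<open>U\<close>, and
  the union of these belongs to the sigma-algebra generated by the base, on which both measures agree. By
  inner regularity they then agree on \<open>U\<close>. Inner regularity is essential here: in spaces that
  are not second countable the base can generate a smaller sigma-algebra than the Borel sets.\<close>

lemma finite_radon_eqI:
  assumes X: "Hausdorff_space X" and M: "finite_radon_measure X M" and M': "finite_radon_measure X M'"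
    and G: "Int_stable \<G>" "topspace X \<in> \<G>" "\<And>E. E \<in> \<G> \<Longrightarrow> openin X E"
    and base: "\<And>U x. openin X U \<Longrightarrow> x \<in> U \<Longrightarrow> \<exists>E\<in>\<G>. x \<in> E \<and> E \<subseteq> U"
    and eq: "\<And>E. E \<in> \<G> \<Longrightarrow> emeasure M E = emeasure M' E"
  shows "M = M'"
proof -
  have fin: "finite_measure M" "finite_measure M'" and sp: "space M = topspace X" "space M' = topspace X"
    and sets: "sets M = sigma_sets (topspace X) {U. openin X U}" "sets M' = sigma_sets (topspace X) {U. openin X U}"
    using M M' by (auto simp: finite_radon_measure_def)
  have le: "emeasure N U \<le> emeasure N' U"
    if N: "finite_radon_measure X N" "finite_radon_measure X N'" and U: "openin X U"
      and e: "\<And>E. E \<in> \<G> \<Longrightarrow> emeasure N E = emeasure N' E" for N N' U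
  proof -
    have "emeasure N U = (SUP C\<in>{C. compactin X C \<and> C \<subseteq> U}. emeasure N C)"
      using N finite_radon_sets_openin[OF N(1) U] by (simp add: finite_radon_measure_def)
    also have "\<dots> \<le> emeasure N' U"
    proof (rule SUP_least)
      fix C assume "C \<in> {C. compactin X C \<and> C \<subseteq> U}"
      then have C: "compactin X C" "C \<subseteq> U" by auto
      define \<F> where "\<F> = {E \<in> \<G>. E \<subseteq> U}"
      have "C \<subseteq> \<Union>\<F>"
        using base[OF U] C(2) by (fastforce simp: \<F>_def)
      then obtain \<F>' where F: "finite \<F>'" "\<F>' \<subseteq> \<F>" "C \<subseteq> \<Union>\<F>'"
        using compactinD[OF C(1), of \<F>] G(3) by (auto simp: \<F>_def)
      have "\<Union>\<F>' \<in> sigma_sets (topspace X) \<G>"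
        using F(1,2) by (intro sigma_sets_UNION countable_finite) (auto simp: \<F>_def)
      then have "emeasure N (\<Union>\<F>') = emeasure N' (\<Union>\<F>')"
        using N G finite_radon_sets_openin[OF N(1)] finite_radon_sets_openin[OF N(2)] e
        by - (rule finite_measures_agree[of N N' "topspace X" \<G>], auto simp: finite_radon_measure_def)
      moreover have "openin X (\<Union>\<F>')"
        using F(2) G(3) by (auto simp: \<F>_def)
      moreover have "\<Union>\<F>' \<subseteq> U"
        using F(2) by (auto simp: \<F>_def)
      ultimately show "emeasure N C \<le> emeasure N' U"
        using emeasure_mono[OF F(3), of N] emeasure_mono[of "\<Union>\<F>'" U N']
          finite_radon_sets_openin[OF N(1)] finite_radon_sets_openin[OF N(2) U] by fastforce
    qed
    finally show ?thesis .
  qed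
  have "emeasure M U = emeasure M' U" if "openin X U" for U
    using le[OF M M' that eq] le[OF M' M that eq[symmetric]] by (rule antisym)
  then have "emeasure M A = emeasure M' A" if "A \<in> sets M" for A
    using that fin sp sets
    by - (rule finite_measures_agree[of M M' "topspace X" "{U. openin X U}"], auto intro!: Int_stableI)
  then show ?thesis
    using sets by (intro measure_eqI) auto
qed

abbreviation borel_algebra :: "'a topology \<Rightarrow> 'a measure" where
  "borel_algebra X \<equiv> sigma (topspace X) {U. openin X U}"

lemma topology_subset_Pow: "{U. openin X U} \<subseteq> Pow (topspace X)"
  using openin_subset by blast

lemma sets_borel_algebra: "sets (borel_algebra X) = sigma_sets (topspace X) {U. openin X U}"
  using topology_subset_Pow by (rule sets_measure_of)

lemma space_borel_algebra: "space (borel_algebra X) = topspace X"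
  using topology_subset_Pow by (rule space_measure_of)

lemma continuous_map_measurable:
  assumes M: "finite_radon_measure X M" and f: "continuous_map X Y f"
  shows "f \<in> measurable M (borel_algebra Y)"
proof (rule measurable_measure_of[OF topology_subset_Pow])
  have sp: "space M = topspace X" using M by (simp add: finite_radon_measure_def)
  show "f \<in> space M \<rightarrow> topspace Y"
    using f sp by (auto simp: continuous_map_def)
  fix U assume "U \<in> {U. openin Y U}"
  then have "openin X {x \<in> topspace X. f x \<in> U}"
    using f by (simp add: continuous_map_def)
  moreover have "f -` U \<inter> space M = {x \<in> topspace X. f x \<in> U}"
    using sp by auto
  ultimately show "f -` U \<inter> space M \<in> sets M"
    using finite_radon_sets_openin[OF M] by simp
qed

text \<open>Inner regularity survives because the image of a compact set is compact.\<close>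

lemma finite_radon_distr:
  assumes M: "finite_radon_measure X M" and f: "continuous_map X Y f" and Y: "Hausdorff_space Y"
  shows "finite_radon_measure Y (distr M (borel_algebra Y) f)"
proof -
  let ?N = "distr M (borel_algebra Y) f"
  interpret finite_measure M using M by (simp add: finite_radon_measure_def)
  have sp: "space M = topspace X" using M by (simp add: finite_radon_measure_def)
  have meas: "f \<in> measurable M (borel_algebra Y)" by (rule continuous_map_measurable[OF M f])
  have sets: "sets ?N = sigma_sets (topspace Y) {U. openin Y U}"
    by (simp add: sets_borel_algebra)
  have "finite_measure ?N"
    by (rule finite_measure_distr[OF meas])
  moreover have "emeasure ?N A = (SUP C\<in>{C. compactin Y C \<and> C \<subseteq> A}. emeasure ?N C)" if A: "A \<in> sets ?N" for A
  proof (rule antisym)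
    have pre: "f -` A \<inter> space M \<in> sets M"
      using A meas by (auto intro: measurable_sets)
    have "emeasure ?N A = emeasure M (f -` A \<inter> space M)"
      using A meas by (simp add: emeasure_distr)
    also have "\<dots> = (SUP C\<in>{C. compactin X C \<and> C \<subseteq> f -` A \<inter> space M}. emeasure M C)"
      using M pre by (simp add: finite_radon_measure_def)
    also have "\<dots> \<le> (SUP C\<in>{C. compactin Y C \<and> C \<subseteq> A}. emeasure ?N C)"
    proof (rule SUP_mono)
      fix C assume "C \<in> {C. compactin X C \<and> C \<subseteq> f -` A \<inter> space M}"
      then have C: "compactin X C" "C \<subseteq> f -` A \<inter> space M" by auto
      have fC: "compactin Y (f ` C)" by (rule image_compactin[OF C(1) f])
      then have "f ` C \<in> sets ?N"
        using compactin_imp_closedin[OF Y fC] closedin_subset[OF compactin_imp_closedin[OF Y fC]] sets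
          sigma_sets.Compl[of "topspace Y - f ` C" "topspace Y" "{U. openin Y U}"]
        by (auto simp: closedin_def double_diff)
      then have "emeasure ?N (f ` C) = emeasure M (f -` f ` C \<inter> space M)"
        using meas by (simp add: emeasure_distr)
      moreover have "emeasure M C \<le> emeasure M (f -` f ` C \<inter> space M)"
        using C \<open>f ` C \<in> sets ?N\<close> meas by (intro emeasure_mono measurable_sets[OF meas]) auto
      ultimately show "\<exists>D\<in>{C. compactin Y C \<and> C \<subseteq> A}. emeasure M C \<le> emeasure ?N D"
        using fC C(2) by (intro bexI[of _ "f ` C"]) auto
    qed
    finally show "emeasure ?N A \<le> (SUP C\<in>{C. compactin Y C \<and> C \<subseteq> A}. emeasure ?N C)" .
    show "(SUP C\<in>{C. compactin Y C \<and> C \<subseteq> A}. emeasure ?N C) \<le> emeasure ?N A"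
      using A by (intro SUP_least emeasure_mono) auto
  qed
  ultimately show ?thesis
    using sets by (simp add: finite_radon_measure_def space_borel_algebra)
qed


lemma ennreal_less_add_pos:
  assumes "x < \<infinity>" "0 < e"
  shows "x < x + ennreal e"
  using assms by (cases x) (auto simp: ennreal_less_iff simp flip: ennreal_plus)

section \<open>Contents on compact zero-dimensional spaces\<close>

text \<open>Profinite groups and their products are of this kind. The clopen sets are the elementary sets on which
  measures are prescribed.\<close>

definition stone_space :: "'a topology \<Rightarrow> bool" where
  "stone_space X \<longleftrightarrow> compact_space X \<and> Hausdorff_space X \<and>
     (\<forall>U x. openin X U \<and> x \<in> U \<longrightarrow> (\<exists>C. openin X C \<and> closedin X C \<and> x \<in> C \<and> C \<subseteq> U))"

lemma stone_space_clopen_between: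
  assumes X: "stone_space X" and A: "closedin X A" and U: "openin X U" "A \<subseteq> U"
  shows "\<exists>C. openin X C \<and> closedin X C \<and> A \<subseteq> C \<and> C \<subseteq> U"
proof -
  define \<F> where "\<F> = {C. openin X C \<and> closedin X C \<and> C \<subseteq> U}"
  have "compactin X A"
    using X A by (simp add: stone_space_def closedin_compact_space)
  moreover have "A \<subseteq> \<Union>\<F>"
    using X U unfolding stone_space_def \<F>_def by blast
  ultimately obtain \<F>' where "finite \<F>'" "\<F>' \<subseteq> \<F>" "A \<subseteq> \<Union>\<F>'"
    using compactinD[of X A \<F>] by (auto simp: \<F>_def)
  then have "openin X (\<Union>\<F>')" "closedin X (\<Union>\<F>')" "\<Union>\<F>' \<subseteq> U"
    by (auto simp: \<F>_def intro!: closedin_Union)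
  with \<open>A \<subseteq> \<Union>\<F>'\<close> show ?thesis by blast
qed

text \<open>Such a content extends to a Radon measure by the usual method: measure open sets from inside by clopen sets, arbitrary sets from outside by open sets, and restrict
  to the measurable sets in the sense of Caratheodory.\<close>

locale clopen_content =
  fixes X :: "'a topology" and m :: "'a set \<Rightarrow> ennreal"
  assumes stone: "stone_space X"
    and empty: "m {} = 0"
    and additive: "openin X C \<Longrightarrow> closedin X C \<Longrightarrow> openin X D \<Longrightarrow> closedin X D \<Longrightarrow> C \<inter> D = {} \<Longrightarrow>
      m (C \<union> D) = m C + m D"
    and finite_top: "m (topspace X) < \<infinity>"
begin

definition inner_content :: "'a set \<Rightarrow> ennreal" where
  "inner_content U = (SUP C\<in>{C. openin X C \<and> closedin X C \<and> C \<subseteq> U}. m C)"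

definition outer_content :: "'a set \<Rightarrow> ennreal" where
  "outer_content A = (INF U\<in>{U. openin X U \<and> A \<subseteq> U}. inner_content U)"

lemma content_mono:
  assumes "openin X C" "closedin X C" "openin X D" "closedin X D" "C \<subseteq> D"
  shows "m C \<le> m D"
proof -
  have "m (C \<union> (D - C)) = m C + m (D - C)"
    using assms by (intro additive) auto
  moreover have "C \<union> (D - C) = D" using assms by auto
  ultimately show ?thesis by (metis le_iff_add)
qed

lemma inner_content_mono: "U \<subseteq> V \<Longrightarrow> inner_content U \<le> inner_content V"
  unfolding inner_content_def by (intro SUP_subset_mono) auto

lemma inner_content_clopen:
  assumes "openin X C" "closedin X C"
  shows "inner_content C = m C"
  unfolding inner_content_def
  using assms content_mono by (intro antisym SUP_least SUP_upper) auto

text \<open>The closed set \<open>C - V\<close> lies in \<open>U\<close>, so a clopen set fits in between and splits \<open>C\<close> into a part inside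
  \<open>U\<close> and a part inside \<open>V\<close>.\<close>

lemma content_subadditive:
  assumes C: "openin X C" "closedin X C" "C \<subseteq> U \<union> V" and U: "openin X U" and V: "openin X V"
  shows "m C \<le> inner_content U + inner_content V"
proof -
  have "closedin X (C - V)" "C - V \<subseteq> U"
    using C V by auto
  then obtain D where D: "openin X D" "closedin X D" "C - V \<subseteq> D" "D \<subseteq> U"
    using stone_space_clopen_between[OF stone _ U] by blast
  have "m C = m ((C \<inter> D) \<union> (C - D))"
    by (rule arg_cong[of _ _ m]) auto
  also have "\<dots> = m (C \<inter> D) + m (C - D)"
    using C D by (intro additive) auto
  also have "\<dots> \<le> inner_content U + inner_content V"
    unfolding inner_content_def using C D by (intro add_mono SUP_upper) auto
  finally show ?thesis .
qed

lemma inner_content_finite_subadditive: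
  fixes U :: "nat \<Rightarrow> 'a set"
  assumes "\<And>i. openin X (U i)"
  shows "inner_content (\<Union>i<n. U i) \<le> (\<Sum>i<n. inner_content (U i))"
proof (induction n)
  case 0
  then show ?case
    using inner_content_clopen[of "{}"] empty by simp
next
  case (Suc n)
  have un: "(\<Union>i<Suc n. U i) = (\<Union>i<n. U i) \<union> U n"
    by (auto simp: lessThan_Suc)
  have "inner_content (\<Union>i<Suc n. U i) \<le> inner_content (\<Union>i<n. U i) + inner_content (U n)"
    unfolding un inner_content_def[of "(\<Union>i<n. U i) \<union> U n"]
    using assms by (intro SUP_least content_subadditive) auto
  with Suc show ?case
    by (simp add: add_right_mono order.trans)
qed

text \<open>A clopen set is compact, so it is already covered by finitely many of the open sets: this
  is where countable additivity comes from.\<close>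

lemma inner_content_countably_subadditive:
  fixes U :: "nat \<Rightarrow> 'a set"
  assumes U: "\<And>i. openin X (U i)"
  shows "inner_content (\<Union>i. U i) \<le> (\<Sum>i. inner_content (U i))"
  unfolding inner_content_def[of "\<Union>i. U i"]
proof (rule SUP_least)
  fix C assume "C \<in> {C. openin X C \<and> closedin X C \<and> C \<subseteq> (\<Union>i. U i)}"
  then have C: "openin X C" "closedin X C" "C \<subseteq> (\<Union>i. U i)" by auto
  have "compactin X C"
    using stone C by (simp add: stone_space_def closedin_compact_space)
  then obtain \<F> where F: "finite \<F>" "\<F> \<subseteq> range U" "C \<subseteq> \<Union>\<F>"
    using compactinD[of X C "range U"] C(3) U by auto
  then obtain I where I: "finite I" "\<F> = U ` I"
    by (meson finite_subset_image)
  then have "C \<subseteq> (\<Union>i<Suc (Max (insert 0 I)). U i)"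
    using F(3) by (force simp: less_Suc_eq_le)
  then have "m C \<le> inner_content (\<Union>i<Suc (Max (insert 0 I)). U i)"
    unfolding inner_content_def using C by (intro SUP_upper) auto
  also have "\<dots> \<le> (\<Sum>i<Suc (Max (insert 0 I)). inner_content (U i))"
    using U by (rule inner_content_finite_subadditive)
  also have "\<dots> \<le> (\<Sum>i. inner_content (U i))"
    by (rule sum_le_suminf) auto
  finally show "m C \<le> (\<Sum>i. inner_content (U i))" .
qed

lemma outer_content_open: "openin X U \<Longrightarrow> outer_content U = inner_content U"
  unfolding outer_content_def by (intro antisym INF_lower INF_greatest inner_content_mono) auto

lemma outer_content_mono: "A \<subseteq> B \<Longrightarrow> outer_content A \<le> outer_content B"
  unfolding outer_content_def by (intro INF_superset_mono) auto

text \<open>Countable subadditivity: cover each \<open>A i\<close> by an open set whose content exceeds the outer content of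
  \<open>A i\<close> by at most \<open>e / 2 ^ (i + 1)\<close>, and use countable subadditivity on open sets.\<close>

lemma outer_measure_space_outer_content:
  "outer_measure_space (Pow (topspace X)) outer_content"
  unfolding outer_measure_space_def
proof (intro conjI)
  show "positive (Pow (topspace X)) outer_content"
    using outer_content_open[of "{}"] inner_content_clopen[of "{}"] empty by (simp add: positive_def)
  show "increasing (Pow (topspace X)) outer_content"
    by (simp add: increasing_def outer_content_mono)
  show "countably_subadditive (Pow (topspace X)) outer_content"
    unfolding countably_subadditive_def
  proof (intro allI impI)
    fix A :: "nat \<Rightarrow> 'a set"
    assume A: "range A \<subseteq> Pow (topspace X)"
    show "outer_content (\<Union>i. A i) \<le> (\<Sum>i. outer_content (A i))"
    proof (rule ennreal_le_epsilon)
      fix e :: real assume e: "0 < e" and fin: "(\<Sum>i. outer_content (A i)) < top_class.top"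
      have "\<exists>U. openin X U \<and> A i \<subseteq> U \<and> inner_content U \<le> outer_content (A i) + ennreal (e * (1/2) ^ Suc i)" for i
      proof -
        have "outer_content (A i) < \<infinity>"
          using ennreal_suminf_lessD fin by simp
        then have "outer_content (A i) < outer_content (A i) + ennreal (e * (1/2) ^ Suc i)"
          using e by (intro ennreal_less_add_pos) auto
        then obtain U where "openin X U" "A i \<subseteq> U" "inner_content U < outer_content (A i) + ennreal (e * (1/2) ^ Suc i)"
          by (subst (asm) outer_content_def) (auto simp: INF_less_iff)
        then show ?thesis by (auto intro: less_imp_le)
      qed
      then obtain U where U: "\<And>i. openin X (U i)" "\<And>i. A i \<subseteq> U i"
        "\<And>i. inner_content (U i) \<le> outer_content (A i) + ennreal (e * (1/2) ^ Suc i)"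
        by metis
      have "outer_content (\<Union>i. A i) \<le> inner_content (\<Union>i. U i)"
        unfolding outer_content_def using U(1,2) by (intro INF_lower) (auto; blast)
      also have "\<dots> \<le> (\<Sum>i. inner_content (U i))"
        by (rule inner_content_countably_subadditive[OF U(1)])
      also have "\<dots> \<le> (\<Sum>i. outer_content (A i) + ennreal (e * (1/2) ^ Suc i))"
        using U(3) by (intro suminf_le) auto
      also have "\<dots> = (\<Sum>i. outer_content (A i)) + (\<Sum>i. ennreal (e * (1/2) ^ Suc i))"
        by (rule suminf_add[symmetric]) auto
      also have "(\<Sum>i. ennreal (e * (1/2) ^ Suc i)) = ennreal e"
        using e sums_mult[OF power_half_series, of e] by (intro suminf_ennreal_eq) auto
      finally show "outer_content (\<Union>i. A i) \<le> (\<Sum>i. outer_content (A i)) + ennreal e" .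
    qed
  qed
qed

text \<open>Exhaust \<open>V \<inter> U\<close> by clopen sets \<open>C\<close>, and then the open set \<open>V - C\<close> by clopen sets \<open>D\<close>. As \<open>C\<close> and \<open>D\<close> are
  disjoint subsets of \<open>V\<close>, their contents add up to at most the content of \<open>V\<close>.\<close>

lemma open_in_lambda_system:
  assumes U: "openin X U"
  shows "U \<in> lambda_system (topspace X) (Pow (topspace X)) outer_content"
proof -
  interpret sigma_algebra "topspace X" "Pow (topspace X)" by (rule sigma_algebra_Pow)
  have sub: "subadditive (Pow (topspace X)) outer_content"
    using outer_measure_space_outer_content countably_subadditive_subadditive
    unfolding outer_measure_space_def by blast
  have "outer_content (A \<inter> U) + outer_content (A - U) = outer_content A" if A: "A \<subseteq> topspace X" for A
  proof (rule antisym)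
    have "outer_content ((A \<inter> U) \<union> (A - U)) \<le> outer_content (A \<inter> U) + outer_content (A - U)"
      using A by (intro subadditiveD[OF sub]) auto
    moreover have "(A \<inter> U) \<union> (A - U) = A" by auto
    ultimately show "outer_content A \<le> outer_content (A \<inter> U) + outer_content (A - U)" by simp
    show "outer_content (A \<inter> U) + outer_content (A - U) \<le> outer_content A"
      unfolding outer_content_def[of A]
    proof (rule INF_greatest)
      fix V assume "V \<in> {V. openin X V \<and> A \<subseteq> V}"
      then have V: "openin X V" "A \<subseteq> V" by auto
      have "outer_content (A \<inter> U) \<le> outer_content (V \<inter> U)"
        using V by (intro outer_content_mono) auto
      also have "\<dots> = inner_content (V \<inter> U)"
        using U V by (intro outer_content_open) auto
      finally have "outer_content (A \<inter> U) + outer_content (A - U) \<le> inner_content (V \<inter> U) + outer_content (A - U)"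
        by (rule add_right_mono)
      also have "\<dots> = (SUP C\<in>{C. openin X C \<and> closedin X C \<and> C \<subseteq> V \<inter> U}. m C + outer_content (A - U))"
        unfolding inner_content_def by (intro ennreal_SUP_add_left[symmetric]) auto
      also have "\<dots> \<le> inner_content V"
      proof (rule SUP_least)
        fix C assume "C \<in> {C. openin X C \<and> closedin X C \<and> C \<subseteq> V \<inter> U}"
        then have C: "openin X C" "closedin X C" "C \<subseteq> V \<inter> U" by auto
        have "outer_content (A - U) \<le> outer_content (V - C)"
          using C V by (intro outer_content_mono) auto
        also have "\<dots> = inner_content (V - C)"
          using C V by (intro outer_content_open) auto
        finally have "m C + outer_content (A - U) \<le> m C + inner_content (V - C)"
          by (rule add_left_mono)
        also have "\<dots> = (SUP D\<in>{D. openin X D \<and> closedin X D \<and> D \<subseteq> V - C}. m C + m D)"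
          unfolding inner_content_def add.commute[of "m C"] by (intro ennreal_SUP_add_left[symmetric]) auto
        also have "\<dots> \<le> inner_content V"
        proof (rule SUP_least)
          fix D assume "D \<in> {D. openin X D \<and> closedin X D \<and> D \<subseteq> V - C}"
          then have D: "openin X D" "closedin X D" "D \<subseteq> V - C" by auto
          have "m C + m D = m (C \<union> D)"
            using C D by (intro additive[symmetric]) auto
          also have "\<dots> \<le> inner_content V"
            unfolding inner_content_def using C D by (intro SUP_upper) auto
          finally show "m C + m D \<le> inner_content V" .
        qed
        finally show "m C + outer_content (A - U) \<le> inner_content V" .
      qed
      finally show "outer_content (A \<inter> U) + outer_content (A - U) \<le> inner_content V" .
    qed
  qed
  then show ?thesis
    using openin_subset[OF U] by (auto simp: lambda_system_eq)
qed

text \<open>Inner regularity follows from the outer approximation by open sets, which holds by construction, on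
  passing to complements: complements of open sets are compact.\<close>

proposition radon_extension:
  "\<exists>M. finite_radon_measure X M \<and> (\<forall>C. openin X C \<and> closedin X C \<longrightarrow> emeasure M C = m C)"
proof -
  interpret sigma_algebra "topspace X" "Pow (topspace X)" by (rule sigma_algebra_Pow)
  let ?L = "lambda_system (topspace X) (Pow (topspace X)) outer_content"
  let ?B = "sigma_sets (topspace X) {U. openin X U}"
  define M where "M = measure_of (topspace X) {U. openin X U} outer_content"
  have sets: "sets M = ?B" and space: "space M = topspace X"
    unfolding M_def by (rule sets_measure_of[OF topology_subset_Pow], rule space_measure_of[OF topology_subset_Pow])
  have L: "measure_space (topspace X) ?L outer_content"
    by (rule caratheodory_lemma[OF outer_measure_space_outer_content])
  have B: "?B \<subseteq> ?L"
    using L open_in_lambda_system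
    by (intro sigma_algebra.sigma_sets_subset) (auto simp: measure_space_def)
  have "positive (sets M) outer_content" "countably_additive (sets M) outer_content"
    using L B unfolding measure_space_def sets
    by (auto simp: positive_def countably_additive_def subset_iff image_subset_iff)
  then have em: "emeasure M A = outer_content A" if "A \<in> ?B" for A
    using that sets by (intro emeasure_measure_of[OF M_def topology_subset_Pow]) auto
  have clopen: "emeasure M C = m C" if "openin X C" "closedin X C" for C
    using that em[of C] by (simp add: sigma_sets.Basic outer_content_open inner_content_clopen)
  have fin: "finite_measure M"
    using clopen[of "topspace X"] finite_top space by (intro finite_measureI) auto
  interpret finite_measure M by fact
  have "emeasure M A = (SUP C\<in>{C. compactin X C \<and> C \<subseteq> A}. emeasure M C)" if A: "A \<in> sets M" for A
  proof (rule antisym)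
    show "(SUP C\<in>{C. compactin X C \<and> C \<subseteq> A}. emeasure M C) \<le> emeasure M A"
      using A by (intro SUP_least emeasure_mono) auto
    show "emeasure M A \<le> (SUP C\<in>{C. compactin X C \<and> C \<subseteq> A}. emeasure M C)"
    proof (rule ennreal_le_epsilon)
      fix e :: real assume e: "0 < e"
      have c: "topspace X - A \<in> sets M" using sets.compl_sets[OF A] space by simp
      have "outer_content (topspace X - A) < outer_content (topspace X - A) + ennreal e"
        using em[of "topspace X - A"] c sets emeasure_finite[of "topspace X - A"] e
        by (intro ennreal_less_add_pos) (auto simp: less_top)
      then obtain V where V: "openin X V" "topspace X - A \<subseteq> V" "inner_content V < outer_content (topspace X - A) + ennreal e"
        by (subst (asm) outer_content_def) (auto simp: INF_less_iff)
      have Vs: "V \<in> sets M" using V sets by (simp add: sigma_sets.Basic)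
      have mV: "measure M V < measure M (topspace X - A) + e"
      proof -
        have "ennreal (measure M V) < ennreal (measure M (topspace X - A)) + ennreal e"
          using V(3) em[of "topspace X - A"] em[of V] c Vs sets outer_content_open[OF V(1)]
          by (metis emeasure_eq_measure)
        also have "\<dots> = ennreal (measure M (topspace X - A) + e)"
          using e by (intro ennreal_plus[symmetric]) auto
        finally show ?thesis
          by (simp add: ennreal_less_iff)
      qed
      let ?C = "topspace X - V"
      have "compactin X ?C"
        using stone V(1) by (intro closedin_compact_space) (auto simp: stone_space_def)
      moreover have "?C \<subseteq> A"
        using V sets.sets_into_space[OF A] space by auto
      ultimately have "emeasure M ?C \<le> (SUP C\<in>{C. compactin X C \<and> C \<subseteq> A}. emeasure M C)"
        by (intro SUP_upper) auto
      moreover have "measure M A \<le> measure M ?C + e"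
        using mV finite_measure_compl[OF A] finite_measure_compl[OF Vs] space by simp
      then have "emeasure M A \<le> emeasure M ?C + ennreal e"
        using e by (simp add: emeasure_eq_measure flip: ennreal_plus)
      ultimately show "emeasure M A \<le> (SUP C\<in>{C. compactin X C \<and> C \<subseteq> A}. emeasure M C) + ennreal e"
        by (meson add_right_mono order.trans)
    qed
  qed
  then have "finite_radon_measure X M"
    using fin sets space by (simp add: finite_radon_measure_def)
  with clopen show ?thesis by blast
qed

end

section \<open>Products of Radon measures\<close>

lemma openin_prodE:
  assumes "openin (prod_topology X Y) W" "(x, y) \<in> W"
  obtains U V where "openin X U" "openin Y V" "x \<in> U" "y \<in> V" "U \<times> V \<subseteq> W"
  using assms(1)[unfolded openin_prod_topology_alt, rule_format, OF assms(2)] that by blast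

lemma stone_space_prod:
  assumes X: "stone_space X" and Y: "stone_space Y"
  shows "stone_space (prod_topology X Y)"
  unfolding stone_space_def
proof (intro conjI allI impI)
  show "compact_space (prod_topology X Y)"
    using X Y by (simp add: stone_space_def compact_space_prod_topology)
  show "Hausdorff_space (prod_topology X Y)"
    using X Y by (simp add: stone_space_def Hausdorff_space_prod_topology)
  fix W z assume "openin (prod_topology X Y) W \<and> z \<in> W"
  then obtain U V where UV: "openin X U" "openin Y V" "fst z \<in> U" "snd z \<in> V" "U \<times> V \<subseteq> W"
    unfolding openin_prod_topology_alt by (metis prod.collapse)
  obtain C where C: "openin X C" "closedin X C" "fst z \<in> C" "C \<subseteq> U"
    using X UV unfolding stone_space_def by blast
  obtain D where D: "openin Y D" "closedin Y D" "snd z \<in> D" "D \<subseteq> V"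
    using Y UV unfolding stone_space_def by blast
  show "\<exists>C. openin (prod_topology X Y) C \<and> closedin (prod_topology X Y) C \<and> z \<in> C \<and> C \<subseteq> W"
    using C D UV(5) by (intro exI[of _ "C \<times> D"])
      (auto simp: openin_prod_Times_iff closedin_prod_Times_iff mem_Times_iff)
qed

lemma finite_radon_prod_eqI:
  assumes XY: "Hausdorff_space (prod_topology X Y)"
    and P: "finite_radon_measure (prod_topology X Y) P" and P': "finite_radon_measure (prod_topology X Y) P'"
    and eq: "\<And>U V. openin X U \<Longrightarrow> openin Y V \<Longrightarrow> emeasure P (U \<times> V) = emeasure P' (U \<times> V)"
  shows "P = P'"
proof (rule finite_radon_eqI[OF XY P P', of "{U \<times> V |U V. openin X U \<and> openin Y V}"])
  show "Int_stable {U \<times> V |U V. openin X U \<and> openin Y V}"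
  proof (rule Int_stableI)
    fix E E' assume "E \<in> {U \<times> V |U V. openin X U \<and> openin Y V}" "E' \<in> {U \<times> V |U V. openin X U \<and> openin Y V}"
    then obtain U V U' V' where UV: "openin X U" "openin Y V" "openin X U'" "openin Y V'"
      and E: "E = U \<times> V" "E' = U' \<times> V'"
      by blast
    have "E \<inter> E' = (U \<inter> U') \<times> (V \<inter> V')" "openin X (U \<inter> U')" "openin Y (V \<inter> V')"
      using UV by (auto simp: E)
    then show "E \<inter> E' \<in> {U \<times> V |U V. openin X U \<and> openin Y V}"
      by blast
  qed
  show "topspace (prod_topology X Y) \<in> {U \<times> V |U V. openin X U \<and> openin Y V}"
    by auto
  show "openin (prod_topology X Y) E" if "E \<in> {U \<times> V |U V. openin X U \<and> openin Y V}" for E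
    using that by (auto simp: openin_prod_Times_iff)
  show "\<exists>E\<in>{U \<times> V |U V. openin X U \<and> openin Y V}. z \<in> E \<and> E \<subseteq> W" if W: "openin (prod_topology X Y) W" "z \<in> W" for W z
  proof -
    obtain U V where "openin X U" "openin Y V" "fst z \<in> U" "snd z \<in> V" "U \<times> V \<subseteq> W"
      using W unfolding openin_prod_topology_alt by (metis prod.collapse)
    then show ?thesis
      by (intro bexI[of _ "U \<times> V"]) (auto simp: mem_Times_iff)
  qed
qed (use eq in auto)

text \<open>In general the product sigma-algebra is smaller than the Borel sigma-algebra of the product, but a clopen
  set is compact and hence a finite union of open rectangles.\<close>

lemma clopen_in_pair_measure:
  assumes X: "stone_space X" and Y: "stone_space Y"
    and M: "finite_radon_measure X M" and N: "finite_radon_measure Y N"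
    and C: "openin (prod_topology X Y) C" "closedin (prod_topology X Y) C"
  shows "C \<in> sets (M \<Otimes>\<^sub>M N)"
proof -
  define \<F> where "\<F> = {U \<times> V |U V. openin X U \<and> openin Y V \<and> U \<times> V \<subseteq> C}"
  have "compactin (prod_topology X Y) C"
    using stone_space_prod[OF X Y] C(2) by (simp add: stone_space_def closedin_compact_space)
  moreover have "C \<subseteq> \<Union>\<F>"
  proof
    fix z assume "z \<in> C"
    then obtain U V where "openin X U" "openin Y V" "fst z \<in> U" "snd z \<in> V" "U \<times> V \<subseteq> C"
      using C(1) unfolding openin_prod_topology_alt by (metis prod.collapse)
    then show "z \<in> \<Union>\<F>"
      unfolding \<F>_def by (intro UnionI[of "U \<times> V"]) (auto simp: mem_Times_iff)
  qed
  moreover have "\<And>E. E \<in> \<F> \<Longrightarrow> openin (prod_topology X Y) E"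
    by (auto simp: \<F>_def openin_prod_Times_iff)
  ultimately obtain \<F>' where F: "finite \<F>'" "\<F>' \<subseteq> \<F>" "C \<subseteq> \<Union>\<F>'"
    using compactinD[of "prod_topology X Y" C \<F>] by blast
  have "E \<in> sets (M \<Otimes>\<^sub>M N)" if "E \<in> \<F>'" for E
    using that F(2) finite_radon_sets_openin[OF M] finite_radon_sets_openin[OF N] by (auto simp: \<F>_def)
  then have "\<Union>\<F>' \<in> sets (M \<Otimes>\<^sub>M N)"
    using F(1) by (intro sets.finite_Union) auto
  moreover have "\<Union>\<F>' = C"
    using F by (auto simp: \<F>_def)
  ultimately show ?thesis by simp
qed

lemma rectangle_in_sets:
  assumes M: "sets M = sets (borel_algebra X)" and N: "sets N = sets (borel_algebra Y)"
    and P: "finite_radon_measure (prod_topology X Y) P"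
    and A: "A \<in> sets M" and B: "B \<in> sets N"
  shows "A \<times> B \<in> sets P"
proof -
  have "fst -` A \<inter> space P \<in> sets P"
    using continuous_map_measurable[OF P continuous_map_fst] A M by (auto intro: measurable_sets)
  moreover have "snd -` B \<inter> space P \<in> sets P"
    using continuous_map_measurable[OF P continuous_map_snd] B N by (auto intro: measurable_sets)
  moreover have "A \<subseteq> topspace X" "B \<subseteq> topspace Y"
    using A B M N sets.sets_into_space[of A "borel_algebra X"] sets.sets_into_space[of B "borel_algebra Y"]
    by (simp_all add: space_borel_algebra)
  then have "A \<times> B = (fst -` A \<inter> space P) \<inter> (snd -` B \<inter> space P)"
    using P by (auto simp: finite_radon_measure_def)
  ultimately show ?thesis by auto
qed

lemma finite_radon_sets_borel: "finite_radon_measure X M \<Longrightarrow> sets M = sets (borel_algebra X)"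
  by (simp add: finite_radon_measure_def sets_borel_algebra)

text \<open>The ordinary product measure restricts to a content on the clopen sets, whose Radon extension \<open>P\<close> is
  the product. It has the right value on all measurable rectangles: for a compact rectangle
  \<open>P (A \<times> B)\<close> is approximated from above by clopen sets, where \<open>P\<close> is the product measure, so \<open>P (A \<times> B)\<close>
  is at least the product of the measures. Inner regularity of the factors extends this lower bound to
  all measurable rectangles, and the bounds for \<open>A \<times> B\<close> and for the two rectangles that partition its
  complement can only add up to the total mass if they are all attained.\<close>

lemma ex_radon_product:
  assumes X: "stone_space X" and Y: "stone_space Y"
    and M: "finite_radon_measure X M" and N: "finite_radon_measure Y N"
  shows "\<exists>P. finite_radon_measure (prod_topology X Y) P \<and>
    (\<forall>A\<in>sets M. \<forall>B\<in>sets N. emeasure P (A \<times> B) = emeasure M A * emeasure N B)"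
proof -
  interpret M: finite_measure M using M by (simp add: finite_radon_measure_def)
  interpret N: finite_measure N using N by (simp add: finite_radon_measure_def)
  let ?XY = "prod_topology X Y"
  have sp: "space M = topspace X" "space N = topspace Y"
    using M N by (simp_all add: finite_radon_measure_def)
  have XY: "stone_space ?XY" by (rule stone_space_prod[OF X Y])
  note clopen = clopen_in_pair_measure[OF X Y M N]
  have times: "emeasure (M \<Otimes>\<^sub>M N) (A \<times> B) = ennreal (measure M A * measure N B)"
    if "A \<in> sets M" "B \<in> sets N" for A B
    using that by (simp add: N.emeasure_pair_measure_Times M.emeasure_eq_measure N.emeasure_eq_measure ennreal_mult)
  have top_clopen: "openin ?XY (topspace ?XY)" "closedin ?XY (topspace ?XY)"
    by (rule openin_topspace, rule closedin_topspace)
  have top: "emeasure (M \<Otimes>\<^sub>M N) (topspace ?XY) = ennreal (measure M (space M) * measure N (space N))"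
    using times[OF sets.top sets.top] sp by simp
  interpret clopen_content ?XY "emeasure (M \<Otimes>\<^sub>M N)"
  proof
    show "emeasure (M \<Otimes>\<^sub>M N) (C \<union> D) = emeasure (M \<Otimes>\<^sub>M N) C + emeasure (M \<Otimes>\<^sub>M N) D"
      if "openin ?XY C" "closedin ?XY C" "openin ?XY D" "closedin ?XY D" "C \<inter> D = {}" for C D
      using that clopen by (intro plus_emeasure[symmetric]) auto
  qed (use XY top in auto)
  obtain P where P: "finite_radon_measure ?XY P"
    and Pc: "\<And>C. openin ?XY C \<Longrightarrow> closedin ?XY C \<Longrightarrow> emeasure P C = emeasure (M \<Otimes>\<^sub>M N) C"
    using radon_extension by blast
  interpret P: finite_measure P using P by (simp add: finite_radon_measure_def)
  have spP: "space P = space M \<times> space N"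
    using P sp by (simp add: finite_radon_measure_def)
  note rect = rectangle_in_sets[OF finite_radon_sets_borel[OF M] finite_radon_sets_borel[OF N] P]
  have Haus: "Hausdorff_space X" "Hausdorff_space Y" "Hausdorff_space ?XY"
    using X Y XY by (simp_all add: stone_space_def)
  have compact_le: "measure M A * measure N B \<le> measure P (A \<times> B)" if A: "compactin X A" and B: "compactin Y B" for A B
  proof (rule ccontr)
    assume less: "\<not> measure M A * measure N B \<le> measure P (A \<times> B)"
    have cl: "closedin X A" "closedin Y B"
      using A B Haus compactin_imp_closedin by auto
    then have AB: "A \<in> sets M" "B \<in> sets N"
      using finite_radon_sets_closedin M N by auto
    obtain V where V: "openin ?XY V" "A \<times> B \<subseteq> V" "measure P V < measure M A * measure N B"
      using finite_radon_outer[OF Haus(3) P rect[OF AB], of "measure M A * measure N B"] less by auto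
    have "closedin ?XY (A \<times> B)"
      using cl by (simp add: closedin_prod_Times_iff)
    then obtain W where W: "openin ?XY W" "closedin ?XY W" "A \<times> B \<subseteq> W" "W \<subseteq> V"
      using stone_space_clopen_between[OF XY _ V(1,2)] by blast
    have "ennreal (measure M A * measure N B) \<le> emeasure (M \<Otimes>\<^sub>M N) W"
      using W times[OF AB] clopen[OF W(1,2)] emeasure_mono[OF W(3), of "M \<Otimes>\<^sub>M N"] by simp
    also have "\<dots> = emeasure P W"
      using Pc[OF W(1,2)] by simp
    also have "\<dots> \<le> emeasure P V"
      using W V finite_radon_sets_openin[OF P] by (intro emeasure_mono) auto
    finally have "measure M A * measure N B \<le> measure P V"
      by (simp add: P.emeasure_eq_measure)
    with V(3) show False by simp
  qed
  have le: "measure M A * measure N B \<le> measure P (A \<times> B)" if A: "A \<in> sets M" and B: "B \<in> sets N" for A B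
  proof (rule ccontr)
    define z where "z = measure P (A \<times> B)"
    assume "\<not> measure M A * measure N B \<le> measure P (A \<times> B)"
    then have less: "z < measure M A * measure N B" and z: "z \<ge> 0"
      by (auto simp: z_def)
    then have "measure N B > 0"
      using measure_nonneg[of N B] by (metis less_le mult_zero_right not_less)
    \<comment> \<open>Choose \<open>C \<subseteq> A\<close> first and \<open>D \<subseteq> B\<close> afterwards, so that \<open>z < measure M C * measure N B\<close> and then
        \<open>z < measure M C * measure N D\<close>.\<close>
    then have "z / measure N B < measure M A"
      using less by (simp add: pos_divide_less_eq)
    then obtain C where C: "compactin X C" "C \<subseteq> A" "z / measure N B < measure M C"
      using finite_radon_inner[OF M A] by blast
    have "0 \<le> z / measure N B" using z by simp
    then have Cpos: "measure M C > 0" using C(3) by linarith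
    have "z / measure M C < measure N B"
      using C(3) Cpos \<open>measure N B > 0\<close> by (simp add: field_simps)
    then obtain D where D: "compactin Y D" "D \<subseteq> B" "z / measure M C < measure N D"
      using finite_radon_inner[OF N B] by blast
    have "z < measure M C * measure N D"
      using D(3) Cpos by (simp add: field_simps)
    also have "\<dots> \<le> measure P (C \<times> D)"
      by (rule compact_le[OF C(1) D(1)])
    also have "\<dots> \<le> z"
      unfolding z_def using C(2) D(2) rect[OF A B] by (intro P.finite_measure_mono) auto
    finally show False by simp
  qed
  have "emeasure P (A \<times> B) = emeasure M A * emeasure N B" if A: "A \<in> sets M" and B: "B \<in> sets N" for A B
  proof -
    let ?R1 = "(space M - A) \<times> space N" and ?R2 = "A \<times> (space N - B)"
    have AB: "A \<subseteq> space M" "B \<subseteq> space N"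
      using A B by (auto dest: sets.sets_into_space)
    have s: "A \<times> B \<in> sets P" "?R1 \<in> sets P" "?R2 \<in> sets P"
      using A B by (auto intro!: rect)
    have "space P = A \<times> B \<union> (?R1 \<union> ?R2)"
      using AB spP by auto
    then have "measure P (space P) = measure P (A \<times> B \<union> (?R1 \<union> ?R2))"
      by simp
    also have "\<dots> = measure P (A \<times> B) + measure P (?R1 \<union> ?R2)"
      using s by (intro P.finite_measure_Union) auto
    also have "measure P (?R1 \<union> ?R2) = measure P ?R1 + measure P ?R2"
      using s by (intro P.finite_measure_Union) auto
    finally have sum: "measure P (space P) = measure P (A \<times> B) + (measure P ?R1 + measure P ?R2)" .
    have "emeasure P (space P) = ennreal (measure M (space M) * measure N (space N))"
      using Pc[OF top_clopen] top sp spP by simp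
    then have tot: "measure P (space P) = measure M (space M) * measure N (space N)"
      by (simp add: P.emeasure_eq_measure)
    have "measure M (space M) * measure N (space N) =
        measure M A * measure N B + ((measure M (space M) - measure M A) * measure N (space N)
          + measure M A * (measure N (space N) - measure N B))"
      by (simp add: algebra_simps)
    moreover have "(measure M (space M) - measure M A) * measure N (space N) \<le> measure P ?R1"
      using le[of "space M - A" "space N"] A by (simp add: M.finite_measure_compl)
    moreover have "measure M A * (measure N (space N) - measure N B) \<le> measure P ?R2"
      using le[of A "space N - B"] A B by (simp add: N.finite_measure_compl)
    moreover note le[OF A B] sum tot
    ultimately have "measure P (A \<times> B) = measure M A * measure N B"
      by argo
    then show ?thesis
      by (simp add: P.emeasure_eq_measure M.emeasure_eq_measure N.emeasure_eq_measure ennreal_mult)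
  qed
  with P show ?thesis by blast
qed

lemma radon_product_props:
  assumes X: "stone_space X" and Y: "stone_space Y"
    and M: "finite_radon_measure X M" and N: "finite_radon_measure Y N"
  shows "finite_radon_measure (prod_topology X Y) (radon_product X Y M N)"
    and "A \<in> sets M \<Longrightarrow> B \<in> sets N \<Longrightarrow>
      emeasure (radon_product X Y M N) (A \<times> B) = emeasure M A * emeasure N B"
proof -
  let ?Q = "\<lambda>P. finite_radon_measure (prod_topology X Y) P \<and>
    (\<forall>A\<in>sets M. \<forall>B\<in>sets N. emeasure P (A \<times> B) = emeasure M A * emeasure N B)"
  have H: "Hausdorff_space (prod_topology X Y)"
    using stone_space_prod[OF X Y] by (simp add: stone_space_def)
  have "\<exists>!P. ?Q P"
  proof (rule ex_ex1I[OF ex_radon_product[OF X Y M N]])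
    fix P P' assume P: "?Q P" and P': "?Q P'"
    show "P = P'"
      using P P' finite_radon_sets_openin[OF M] finite_radon_sets_openin[OF N]
      by (intro finite_radon_prod_eqI[OF H]) auto
  qed
  from theI'[OF this] show "finite_radon_measure (prod_topology X Y) (radon_product X Y M N)"
    "A \<in> sets M \<Longrightarrow> B \<in> sets N \<Longrightarrow>
      emeasure (radon_product X Y M N) (A \<times> B) = emeasure M A * emeasure N B"
    unfolding radon_product_def by blast+
qed

section \<open>Haar measure on profinite groups\<close>

text \<open>An intrinsic description of the inverse limits of finite groups, which passes to direct products without
  any comparison of index sets.\<close>

locale profinite_group = group K for K :: "('a, 'm) monoid_scheme" (structure) +
  fixes T :: "'a topology"
  assumes topological_group: "topological_group K T"
    and compact_space: "compact_space T"
    and Hausdorff_space: "Hausdorff_space T"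
    and open_normal_subset: "openin T U \<Longrightarrow> \<one> \<in> U \<Longrightarrow> \<exists>N. N \<lhd> K \<and> openin T N \<and> N \<subseteq> U"
begin

lemma topspace: "topspace T = carrier K"
  using topological_group by (simp add: topological_group_def)

lemma continuous_translation:
  assumes "g \<in> carrier K"
  shows "continuous_map T T (\<lambda>x. g \<otimes> x)" "continuous_map T T (\<lambda>x. x \<otimes> g)"
proof -
  have mult: "continuous_map (prod_topology T T) T (\<lambda>(x, y). x \<otimes> y)"
    using topological_group by (simp add: topological_group_def)
  have "continuous_map T (prod_topology T T) (\<lambda>x. (g, x))" "continuous_map T (prod_topology T T) (\<lambda>x. (x, g))"
    using assms topspace by (auto intro!: continuous_map_pairedI)
  from this[THEN continuous_map_compose, OF mult]
  show "continuous_map T T (\<lambda>x. g \<otimes> x)" "continuous_map T T (\<lambda>x. x \<otimes> g)"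
    by (simp_all add: o_def)
qed

lemma r_coset_preimage:
  assumes "N \<subseteq> carrier K" "x \<in> carrier K"
  shows "N #> x = {y \<in> carrier K. y \<otimes> inv x \<in> N}"
proof (intro equalityI subsetI)
  fix y assume "y \<in> N #> x"
  then obtain n where "n \<in> N" "y = n \<otimes> x" by (auto simp: r_coset_def)
  then show "y \<in> {y \<in> carrier K. y \<otimes> inv x \<in> N}"
    using assms by (auto simp: m_assoc subset_iff)
next
  fix y assume y: "y \<in> {y \<in> carrier K. y \<otimes> inv x \<in> N}"
  then have "y = (y \<otimes> inv x) \<otimes> x"
    using assms by (simp add: m_assoc)
  with y show "y \<in> N #> x"
    by (auto simp: r_coset_def)
qed

lemma openin_coset:
  assumes N: "N \<lhd> K" "openin T N" and x: "x \<in> carrier K"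
  shows "openin T (N #> x)"
proof -
  interpret N: normal N K by fact
  have "openin T {y \<in> topspace T. y \<otimes> inv x \<in> N}"
    using continuous_translation(2)[of "inv x"] x N(2) by (simp add: continuous_map_def)
  then show ?thesis
    using r_coset_preimage[OF N.subset x] topspace by simp
qed

lemma openin_rcosets:
  "N \<lhd> K \<Longrightarrow> openin T N \<Longrightarrow> D \<in> rcosets N \<Longrightarrow> openin T D"
  using openin_coset by (auto simp: RCOSETS_def)

lemma rcosets_disjoint:
  assumes "N \<lhd> K" "D \<in> rcosets N" "D' \<in> rcosets N" "D \<noteq> D'"
  shows "D \<inter> D' = {}"
proof -
  interpret N: normal N K by fact
  show ?thesis
    using rcos_disjoint[OF N.subgroup_axioms] assms by (auto simp: pairwise_def disjnt_def)
qed

lemma rcosets_Union: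
  assumes "N \<lhd> K" shows "\<Union>(rcosets N) = carrier K"
proof -
  interpret N: normal N K by fact
  show ?thesis by (rule rcosets_part_G[OF N.subgroup_axioms])
qed

lemma rcosets_self:
  assumes "N \<lhd> K" "x \<in> carrier K"
  shows "x \<in> N #> x" "N #> x \<in> rcosets N"
proof -
  interpret N: normal N K by fact
  show "x \<in> N #> x" by (rule rcos_self[OF assms(2) N.subgroup_axioms])
  show "N #> x \<in> rcosets N" using assms(2) by (auto simp: RCOSETS_def)
qed

lemma rcosets_eq:
  assumes "N \<lhd> K" "D \<in> rcosets N" "x \<in> D"
  shows "D = N #> x"
proof -
  have "x \<in> carrier K" using rcosets_Union[OF assms(1)] assms by auto
  then show ?thesis
    using rcosets_disjoint[OF assms(1,2) rcosets_self(2)[OF assms(1)]] rcosets_self(1)[OF assms(1)] assms(3) by blast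
qed

lemma closedin_coset:
  assumes N: "N \<lhd> K" "openin T N" and D: "D \<in> rcosets N"
  shows "closedin T D"
proof -
  have "topspace T - D = \<Union>(rcosets N - {D})"
  proof (intro equalityI subsetI)
    fix x assume x: "x \<in> topspace T - D"
    then obtain E where "E \<in> rcosets N" "x \<in> E"
      using rcosets_Union[OF N(1)] topspace by auto
    with x show "x \<in> \<Union>(rcosets N - {D})" by blast
  next
    fix x assume "x \<in> \<Union>(rcosets N - {D})"
    then obtain E where "E \<in> rcosets N" "E \<noteq> D" "x \<in> E" by blast
    then show "x \<in> topspace T - D"
      using rcosets_Union[OF N(1)] rcosets_disjoint[OF N(1) D, of E] topspace by auto
  qed
  moreover have "openin T (\<Union>(rcosets N - {D}))"
    using openin_rcosets[OF N] by (intro openin_Union) auto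
  moreover have "D \<subseteq> topspace T"
    using rcosets_Union[OF N(1)] D topspace by auto
  ultimately show ?thesis
    by (simp add: closedin_def)
qed

lemma finite_rcosets:
  assumes N: "N \<lhd> K" "openin T N"
  shows "finite (rcosets N)" "card (rcosets N) > 0"
proof -
  obtain \<F> where F: "finite \<F>" "\<F> \<subseteq> rcosets N" "carrier K \<subseteq> \<Union>\<F>"
    using compact_space openin_rcosets[OF N] rcosets_Union[OF N(1)] topspace
    unfolding compact_space_alt by (metis order_refl)
  have "rcosets N \<subseteq> \<F>"
  proof
    fix D assume D: "D \<in> rcosets N"
    then obtain x where x: "x \<in> carrier K" "D = N #> x"
      by (auto simp: RCOSETS_def)
    then obtain D' where D': "D' \<in> \<F>" "x \<in> D'" using F(3) by auto
    then have "D' = N #> x" using F(2) rcosets_eq[OF N(1)] by auto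
    with x D' show "D \<in> \<F>" by simp
  qed
  then show fin: "finite (rcosets N)" using F(1) finite_subset by blast
  have "rcosets N \<noteq> {}" using rcosets_self(2)[OF N(1) one_closed] by auto
  with fin show "card (rcosets N) > 0" by (simp add: card_gt_0_iff)
qed

lemma coset_in_open:
  assumes U: "openin T U" and x: "x \<in> U"
  shows "\<exists>N. N \<lhd> K \<and> openin T N \<and> N #> x \<subseteq> U"
proof -
  have xc: "x \<in> carrier K" using openin_subset[OF U] x topspace by auto
  have "openin T {y \<in> topspace T. y \<otimes> x \<in> U}"
    using continuous_translation(2)[OF xc] U by (simp add: continuous_map_def)
  moreover have "\<one> \<in> {y \<in> topspace T. y \<otimes> x \<in> U}"
    using x xc topspace by simp
  ultimately obtain N where "N \<lhd> K" "openin T N" "N \<subseteq> {y \<in> topspace T. y \<otimes> x \<in> U}"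
    using open_normal_subset by blast
  then show ?thesis
    by (intro exI[of _ N]) (auto simp: r_coset_def)
qed

lemma stone_space: "stone_space T"
  unfolding stone_space_def
proof (intro conjI allI impI)
  fix U x assume U: "openin T U \<and> x \<in> U"
  then obtain N where N: "N \<lhd> K" "openin T N" "N #> x \<subseteq> U"
    using coset_in_open by blast
  have x: "x \<in> carrier K" using openin_subset[of T U] U topspace by auto
  show "\<exists>C. openin T C \<and> closedin T C \<and> x \<in> C \<and> C \<subseteq> U"
    using N(3) rcosets_self[OF N(1) x] openin_coset[OF N(1,2) x] closedin_coset[OF N(1,2)]
    by (intro exI[of _ "N #> x"]) auto
qed (rule compact_space Hausdorff_space)+

lemma coset_Int:
  assumes "N \<lhd> K" "M \<lhd> K" "z \<in> carrier K"
  shows "(N \<inter> M) #> z = (N #> z) \<inter> (M #> z)"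
proof -
  interpret N: normal N K by fact
  interpret M: normal M K by fact
  have "N \<inter> M \<subseteq> carrier K" using N.subset by auto
  then show ?thesis
    unfolding r_coset_preimage[OF \<open>N \<inter> M \<subseteq> carrier K\<close> assms(3)] r_coset_preimage[OF N.subset assms(3)]
      r_coset_preimage[OF M.subset assms(3)]
    by blast
qed

lemma l_coset_translate:
  assumes N: "N \<lhd> K" and g: "g \<in> carrier K" and x: "x \<in> carrier K"
  shows "g <# (N #> x) = N #> (g \<otimes> x)"
proof -
  interpret N: normal N K by fact
  have "g <# (N #> x) = (g <# N) #> x"
    using g x N.subset by (simp add: coset_assoc)
  also have "\<dots> = (N #> g) #> x"
    using N.coset_eq g by simp
  also have "\<dots> = N #> (g \<otimes> x)"
    using g x N.subset by (simp add: coset_mult_assoc)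
  finally show ?thesis .
qed

text \<open>The cosets of \<open>N\<close> partition the group into finitely many translates of \<open>N\<close>, all of the same measure.\<close>

lemma normalized_haar_coset:
  assumes M: "normalized_haar K T M" and N: "N \<lhd> K" "openin T N" and x: "x \<in> carrier K"
  shows "emeasure M (N #> x) = ennreal (1 / real (card (rcosets N)))"
proof -
  interpret N: normal N K by fact
  have rad: "finite_radon_measure T M" using M by (simp add: normalized_haar_def)
  then interpret M: finite_measure M by (simp add: finite_radon_measure_def)
  have sets: "D \<in> sets M" if "D \<in> rcosets N" for D
    using finite_radon_sets_openin[OF rad openin_rcosets[OF N that]] .
  have NN: "N \<in> rcosets N" using N.rcosets_carrier rcosets_self(2)[OF N(1) one_closed] coset_mult_one[OF N.subset] by simp
  have D: "emeasure M D = emeasure M N" if DN: "D \<in> rcosets N" for D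
  proof -
    obtain y where "y \<in> carrier K" "D = N #> y" using DN by (auto simp: RCOSETS_def)
    then have "y \<in> carrier K" "D = y <# N" using N.coset_eq by auto
    then show ?thesis
      using M sets[OF NN] by (simp add: normalized_haar_def)
  qed
  have "1 = emeasure M (\<Union>(rcosets N))"
    using M rcosets_Union[OF N(1)] by (simp add: normalized_haar_def)
  also have "\<dots> = emeasure M (\<Union>D\<in>rcosets N. D)"
    by simp
  also have "\<dots> = (\<Sum>D\<in>rcosets N. emeasure M D)"
    using finite_rcosets[OF N] sets rcosets_disjoint[OF N(1)]
    by (intro sum_emeasure[symmetric]) (auto simp: disjoint_family_on_def)
  also have "\<dots> = of_nat (card (rcosets N)) * emeasure M N"
    using D by simp
  finally have "1 = ennreal (real (card (rcosets N)) * measure M N)"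
    by (simp add: M.emeasure_eq_measure ennreal_mult ennreal_of_nat_eq_real_of_nat)
  then have "real (card (rcosets N)) * measure M N = 1"
    by (metis ennreal_eq_1)
  then have "measure M N = 1 / real (card (rcosets N))"
    using finite_rcosets(2)[OF N] by (simp add: field_simps)
  then show ?thesis
    using D[OF rcosets_self(2)[OF N(1) x]] by (simp add: M.emeasure_eq_measure)
qed

text \<open>Two cosets of open normal subgroups are disjoint or meet in a coset of the intersection, so together with
  the empty set they form a base that is stable under intersections.\<close>

lemma radon_cosets_eqI:
  assumes M: "finite_radon_measure T M" and M': "finite_radon_measure T M'"
    and eq: "\<And>N x. N \<lhd> K \<Longrightarrow> openin T N \<Longrightarrow> x \<in> carrier K \<Longrightarrow> emeasure M (N #> x) = emeasure M' (N #> x)"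
  shows "M = M'"
proof -
  let ?E = "insert {} {N #> x |N x. N \<lhd> K \<and> openin T N \<and> x \<in> carrier K}"
  show ?thesis
  proof (rule finite_radon_eqI[OF Hausdorff_space M M', of ?E])
    show "Int_stable ?E"
    proof (rule Int_stableI)
      fix D D' assume D: "D \<in> ?E" "D' \<in> ?E"
      show "D \<inter> D' \<in> ?E"
      proof (cases "D \<inter> D' = {}")
        case False
        then obtain z where z: "z \<in> D" "z \<in> D'" by blast
        obtain N x where N: "D = N #> x" "N \<lhd> K" "openin T N" "x \<in> carrier K"
          using D(1) z(1) by blast
        obtain N' x' where N': "D' = N' #> x'" "N' \<lhd> K" "openin T N'" "x' \<in> carrier K"
          using D(2) z(2) by blast
        have zc: "z \<in> carrier K"
          using z(1) N r_coset_preimage[of N x] normal.axioms(1)[OF N(2)] subgroup.subset by auto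
        have "D = N #> z" "D' = N' #> z"
          using z N N' rcosets_eq rcosets_self(2) by auto
        then have "D \<inter> D' = (N \<inter> N') #> z"
          using coset_Int[OF N(2) N'(2) zc] by simp
        moreover have "N \<inter> N' \<lhd> K" "openin T (N \<inter> N')"
          using N N' normal_subgroup_intersect by auto
        ultimately show ?thesis using zc by blast
      qed auto
    qed
    have "carrier K #> \<one> = carrier K"
      using coset_mult_one by simp
    moreover have "openin T (carrier K)"
      using openin_topspace[of T] topspace by simp
    ultimately show "topspace T \<in> ?E"
      using normal_self topspace by blast
    show "openin T E" if "E \<in> ?E" for E
      using that openin_coset by auto
    show "\<exists>E\<in>?E. x \<in> E \<and> E \<subseteq> U" if U: "openin T U" "x \<in> U" for U x
    proof -
      obtain N where N: "N \<lhd> K" "openin T N" "N #> x \<subseteq> U"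
        using coset_in_open[OF U] by blast
      have "x \<in> carrier K" using openin_subset[OF U(1)] U(2) topspace by auto
      with N rcosets_self(1)[OF N(1)] show ?thesis by blast
    qed
    show "emeasure M E = emeasure M' E" if "E \<in> ?E" for E
      using that eq by auto
  qed
qed

lemma normalized_haar_unique:
  assumes "normalized_haar K T M" "normalized_haar K T M'"
  shows "M = M'"
  using assms by (intro radon_cosets_eqI) (auto simp: normalized_haar_coset, auto simp: normalized_haar_def)

lemma translate_preimage:
  assumes "g \<in> carrier K" "A \<subseteq> carrier K"
  shows "g <# A = (\<lambda>x. inv g \<otimes> x) -` A \<inter> carrier K"
proof (intro equalityI subsetI)
  fix y assume "y \<in> g <# A"
  then obtain a where "a \<in> A" "y = g \<otimes> a" by (auto simp: l_coset_def)
  then show "y \<in> (\<lambda>x. inv g \<otimes> x) -` A \<inter> carrier K"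
    using assms by (auto simp: m_assoc[symmetric] subset_iff)
next
  fix y assume y: "y \<in> (\<lambda>x. inv g \<otimes> x) -` A \<inter> carrier K"
  then have "y = g \<otimes> (inv g \<otimes> y)"
    using assms by (simp add: m_assoc[symmetric])
  with y show "y \<in> g <# A"
    by (auto simp: l_coset_def)
qed

lemma openin_translate:
  assumes "g \<in> carrier K" "openin T U"
  shows "openin T (g <# U)"
proof -
  have "openin T {y \<in> topspace T. inv g \<otimes> y \<in> U}"
    using continuous_translation(1)[of "inv g"] assms by (simp add: continuous_map_def)
  moreover have "g <# U = {y \<in> topspace T. inv g \<otimes> y \<in> U}"
    using translate_preimage[OF assms(1)] openin_subset[OF assms(2)] topspace by auto
  ultimately show ?thesis by simp
qed

lemma emeasure_translate:
  assumes M: "finite_radon_measure T M" and g: "g \<in> carrier K" and A: "A \<in> sets M"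
  shows "emeasure (distr M (borel_algebra T) (\<lambda>x. inv g \<otimes> x)) A = emeasure M (g <# A)"
proof -
  have "(\<lambda>x. inv g \<otimes> x) \<in> measurable M (borel_algebra T)"
    using continuous_map_measurable[OF M continuous_translation(1)[of "inv g"]] g by simp
  moreover have "A \<in> sets (borel_algebra T)"
    using A finite_radon_sets_borel[OF M] by simp
  moreover have "space M = carrier K"
    using M topspace by (simp add: finite_radon_measure_def)
  ultimately show ?thesis
    using translate_preimage[OF g, of A] sets.sets_into_space[OF A] by (simp add: emeasure_distr)
qed

text \<open>Invariance is automatic: a left translate of a coset of \<open>N\<close> is again a coset of \<open>N\<close>, so a
  measure that gives all of them the same mass agrees with its translates on cosets, hence everywhere.\<close>

lemma normalized_haarI:
  assumes M: "finite_radon_measure T M"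
    and co: "\<And>N x. N \<lhd> K \<Longrightarrow> openin T N \<Longrightarrow> x \<in> carrier K \<Longrightarrow>
      emeasure M (N #> x) = ennreal (1 / real (card (rcosets N)))"
  shows "normalized_haar K T M"
  unfolding normalized_haar_def
proof (intro conjI ballI)
  have "rcosets (carrier K) = {carrier K}"
  proof -
    have "carrier K #> x = carrier K" if "x \<in> carrier K" for x
      using that coset_join2[OF that subgroup_self] by simp
    then show ?thesis unfolding RCOSETS_def using one_closed by blast
  qed
  then show "emeasure M (carrier K) = 1"
    using co[OF normal_self _ one_closed] openin_topspace[of T] topspace coset_mult_one[of "carrier K"] by simp
  fix g A assume g: "g \<in> carrier K" and A: "A \<in> sets M"
  have "distr M (borel_algebra T) (\<lambda>x. inv g \<otimes> x) = M"
  proof (rule radon_cosets_eqI)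
    show "finite_radon_measure T (distr M (borel_algebra T) (\<lambda>x. inv g \<otimes> x))"
      using finite_radon_distr[OF M continuous_translation(1)[of "inv g"] Hausdorff_space] g by simp
    fix N x assume N: "N \<lhd> K" "openin T N" "x \<in> carrier K"
    have "N #> x \<in> sets M"
      using finite_radon_sets_openin[OF M openin_coset[OF N]] .
    then show "emeasure (distr M (borel_algebra T) (\<lambda>x. inv g \<otimes> x)) (N #> x) = emeasure M (N #> x)"
      using emeasure_translate[OF M g] N g l_coset_translate[OF N(1) g N(3)] co by simp
  qed (rule M)
  then show "emeasure M (g <# A) = emeasure M A"
    using emeasure_translate[OF M g A] by simp
qed (rule M)

text \<open>If \<open>C\<close> is a union of cosets of \<open>N\<close>, this is the normalized counting measure of its image in \<open>K/N\<close>.\<close>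

definition coset_fraction :: "'a set \<Rightarrow> 'a set \<Rightarrow> real" where
  "coset_fraction N C = real (card {D \<in> rcosets N. D \<subseteq> C}) / real (card (rcosets N))"

definition coset_stable :: "'a set \<Rightarrow> 'a set \<Rightarrow> bool" where
  "coset_stable N C \<longleftrightarrow> N \<lhd> K \<and> openin T N \<and> C \<subseteq> carrier K \<and> (\<forall>x\<in>C. N #> x \<subseteq> C)"

text \<open>Each coset of \<open>N\<close> consists of equally many cosets of \<open>N'\<close>, since right translation carries those in \<open>N\<close> to
  those in \<open>Nx\<close>.\<close>

lemma card_cosets_refine:
  assumes N: "N \<lhd> K" "openin T N" and N': "N' \<lhd> K" "openin T N'" "N' \<subseteq> N" and C: "coset_stable N C"
  shows "card {D \<in> rcosets N'. D \<subseteq> C} = card {D \<in> rcosets N. D \<subseteq> C} * card {D \<in> rcosets N'. D \<subseteq> N}"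
proof -
  interpret N: normal N K by fact
  interpret N': normal N' K by fact
  let ?sub = "\<lambda>E. {D \<in> rcosets N'. D \<subseteq> E}"
  have fin: "finite (?sub E)" for E using finite_rcosets(1)[OF N'(1,2)] by simp
  have finN: "finite {D \<in> rcosets N. D \<subseteq> C}" using finite_rcosets(1)[OF N] by simp
  have ne: "D \<noteq> {}" if "D \<in> rcosets N'" for D
    using that rcosets_self(1)[OF N'(1)] by (auto simp: RCOSETS_def)
  have "?sub C = (\<Union>E\<in>{D \<in> rcosets N. D \<subseteq> C}. ?sub E)"
  proof (intro equalityI subsetI)
    fix D assume D: "D \<in> ?sub C"
    then obtain x where x: "x \<in> carrier K" "D = N' #> x" by (auto simp: RCOSETS_def)
    then have "x \<in> C" using D rcosets_self(1)[OF N'(1)] by auto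
    then have "N #> x \<in> {D \<in> rcosets N. D \<subseteq> C}"
      using C x(1) rcosets_self(2)[OF N(1)] by (auto simp: coset_stable_def)
    moreover have "D \<subseteq> N #> x" using x(2) N'(3) by (auto simp: r_coset_def)
    ultimately show "D \<in> (\<Union>E\<in>{D \<in> rcosets N. D \<subseteq> C}. ?sub E)" using D by blast
  qed auto
  then have "card (?sub C) = (\<Sum>E\<in>{D \<in> rcosets N. D \<subseteq> C}. card (?sub E))"
  proof (simp only:, intro card_UN_disjoint ballI impI)
    fix E E' assume "E \<in> {D \<in> rcosets N. D \<subseteq> C}" "E' \<in> {D \<in> rcosets N. D \<subseteq> C}" "E \<noteq> E'"
    then have "E \<inter> E' = {}" using rcosets_disjoint[OF N(1)] by auto
    then show "?sub E \<inter> ?sub E' = {}" using ne by blast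
  qed (use fin finN in auto)
  also have "\<dots> = (\<Sum>E\<in>{D \<in> rcosets N. D \<subseteq> C}. card (?sub N))"
  proof (rule sum.cong[OF HOL.refl])
    fix E assume "E \<in> {D \<in> rcosets N. D \<subseteq> C}"
    then obtain x where x: "x \<in> carrier K" "E = N #> x" by (auto simp: RCOSETS_def)
    have cos: "D #> y \<in> rcosets N'" if "D \<in> rcosets N'" "y \<in> carrier K" for D y
      using that N'.subset by (auto simp: RCOSETS_def coset_mult_assoc)
    have subc: "D \<subseteq> carrier K" if "D \<in> rcosets N'" for D
      using that rcosets_Union[OF N'(1)] by auto
    have inv_coset: "(D #> x) #> inv x = D" "(D #> inv x) #> x = D" if "D \<in> rcosets N'" for D
      using subc[OF that] x by (simp_all add: coset_mult_assoc)
    have mono: "D #> y \<subseteq> E #> y" if "D \<subseteq> E" for D E y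
      using that by (auto simp: r_coset_def)
    have Nx: "(N #> x) #> inv x = N"
      using x N.subset by (simp add: coset_mult_assoc)
    have "bij_betw (\<lambda>D. D #> x) (?sub N) (?sub E)"
    proof (rule bij_betwI[where g = "\<lambda>D. D #> inv x"])
      show "(\<lambda>D. D #> x) \<in> ?sub N \<rightarrow> ?sub E"
        using cos x mono by auto
      show "(\<lambda>D. D #> inv x) \<in> ?sub E \<rightarrow> ?sub N"
        using cos x mono[of _ "N #> x" "inv x"] Nx by auto
    qed (use inv_coset in auto)
    then show "card (?sub E) = card (?sub N)" by (simp add: bij_betw_same_card)
  qed
  finally show ?thesis by simp
qed

lemma coset_stable_carrier:
  assumes "N \<lhd> K" "openin T N"
  shows "coset_stable N (carrier K)" "{D \<in> rcosets N. D \<subseteq> carrier K} = rcosets N"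
proof -
  interpret N: normal N K by fact
  show "{D \<in> rcosets N. D \<subseteq> carrier K} = rcosets N"
    using rcosets_Union[OF assms(1)] by auto
  then show "coset_stable N (carrier K)"
    using assms rcosets_self(2)[OF assms(1)] by (auto simp: coset_stable_def)
qed

lemma coset_fraction_refine:
  assumes N: "N \<lhd> K" "openin T N" and N': "N' \<lhd> K" "openin T N'" "N' \<subseteq> N" and C: "coset_stable N C"
  shows "coset_fraction N' C = coset_fraction N C"
proof -
  let ?r = "card {D \<in> rcosets N'. D \<subseteq> N}"
  have 1: "card (rcosets N') = card (rcosets N) * ?r"
    using card_cosets_refine[OF N N' coset_stable_carrier(1)[OF N]] coset_stable_carrier(2)[OF N]
      coset_stable_carrier(2)[OF N'(1,2)] by simp
  then have "?r > 0" using finite_rcosets(2)[OF N'(1,2)] by (metis gr0I less_irrefl mult_0_right)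
  then show ?thesis
    using card_cosets_refine[OF N N' C] 1 by (simp add: coset_fraction_def)
qed

lemma coset_stable_subset:
  assumes "coset_stable N C" "N' \<lhd> K" "openin T N'" "N' \<subseteq> N"
  shows "coset_stable N' C"
  using assms unfolding coset_stable_def r_coset_def by blast

lemma coset_fraction_eq:
  assumes "coset_stable N C" "coset_stable N' C"
  shows "coset_fraction N C = coset_fraction N' C"
proof -
  have N: "N \<lhd> K" "openin T N" "N' \<lhd> K" "openin T N'"
    using assms by (auto simp: coset_stable_def)
  then have I: "N \<inter> N' \<lhd> K" "openin T (N \<inter> N')"
    using normal_subgroup_intersect by auto
  show ?thesis
    using coset_fraction_refine[OF N(1,2) I _ assms(1)] coset_fraction_refine[OF N(3,4) I _ assms(2)] by simp
qed

text \<open>A clopen set is compact, hence a finite union of cosets of open normal subgroups; it is a union of cosets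
  of the intersection of these subgroups.\<close>

lemma ex_coset_stable:
  assumes C: "openin T C" "closedin T C"
  shows "\<exists>N. coset_stable N C"
proof -
  define \<F> where "\<F> = {N #> x |N x. N \<lhd> K \<and> openin T N \<and> x \<in> C \<and> N #> x \<subseteq> C}"
  have Cc: "C \<subseteq> carrier K" using openin_subset[OF C(1)] topspace by simp
  have "compactin T C"
    using compact_space C(2) by (simp add: closedin_compact_space)
  moreover have "C \<subseteq> \<Union>\<F>"
  proof
    fix x assume x: "x \<in> C"
    then obtain N where "N \<lhd> K" "openin T N" "N #> x \<subseteq> C"
      using coset_in_open[OF C(1)] by blast
    with x Cc show "x \<in> \<Union>\<F>"
      using rcosets_self(1)[of N x] unfolding \<F>_def by blast
  qed
  moreover have "\<And>U. U \<in> \<F> \<Longrightarrow> openin T U"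
    using openin_coset Cc by (auto simp: \<F>_def)
  ultimately obtain \<F>' where F: "finite \<F>'" "\<F>' \<subseteq> \<F>" "C \<subseteq> \<Union>\<F>'"
    using compactinD[of T C \<F>] by blast
  have "\<exists>N. N \<lhd> K \<and> openin T N \<and> (\<forall>D\<in>\<F>'. \<forall>z\<in>D. N #> z \<subseteq> D)"
    using F(1,2)
  proof (induction \<F>')
    case empty
    then show ?case
      using normal_self openin_topspace[of T] topspace by auto
  next
    case (insert D \<F>')
    then obtain N where N: "N \<lhd> K" "openin T N" "\<forall>D\<in>\<F>'. \<forall>z\<in>D. N #> z \<subseteq> D"
      by auto
    obtain M x where M: "D = M #> x" "M \<lhd> K" "openin T M" "x \<in> carrier K"
      using insert.prems Cc by (auto simp: \<F>_def)
    have "M #> z \<subseteq> D" if "z \<in> D" for z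
      using rcosets_eq[OF M(2) rcosets_self(2)[OF M(2,4)]] M(1) that by auto
    moreover have "(N \<inter> M) #> z \<subseteq> N #> z" "(N \<inter> M) #> z \<subseteq> M #> z" for z
      by (auto simp: r_coset_def)
    moreover have "N \<inter> M \<lhd> K" "openin T (N \<inter> M)"
      using N M normal_subgroup_intersect by auto
    ultimately show ?case
      using N(3) by (intro exI[of _ "N \<inter> M"]) (fastforce)
  qed
  then obtain N where N: "N \<lhd> K" "openin T N" "\<forall>D\<in>\<F>'. \<forall>z\<in>D. N #> z \<subseteq> D" by blast
  have "N #> z \<subseteq> C" if "z \<in> C" for z
  proof -
    obtain D where "D \<in> \<F>'" "z \<in> D" using \<open>z \<in> C\<close> F(3) by auto
    moreover have "D \<subseteq> C" using \<open>D \<in> \<F>'\<close> F(2) by (auto simp: \<F>_def)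
    ultimately show ?thesis using N(3) by blast
  qed
  with N Cc show ?thesis unfolding coset_stable_def by blast
qed

text \<open>The counting measures of the finite quotients are compatible, so they define a finitely additive content
  on the clopen sets. Its Radon extension has the required values on cosets.\<close>

lemma ex_normalized_haar: "\<exists>M. normalized_haar K T M"
proof -
  define m where "m C = ennreal (coset_fraction (SOME N. coset_stable N C) C)" for C
  have m: "m C = ennreal (coset_fraction N C)" if "coset_stable N C" for N C
    unfolding m_def using coset_fraction_eq[OF someI[of "\<lambda>N. coset_stable N C", OF that] that] by simp
  have pos: "coset_fraction N C \<ge> 0" for N C by (simp add: coset_fraction_def)
  have topst: "coset_stable (carrier K) (carrier K)"
    using normal_self openin_topspace[of T] topspace by (intro coset_stable_carrier) auto
  interpret clopen_content T m
  proof
    show "stone_space T" by (rule stone_space)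
    have "coset_stable (carrier K) {}"
      using topst by (auto simp: coset_stable_def)
    moreover have "{D \<in> rcosets (carrier K). D \<subseteq> {}} = {}"
      using rcosets_self(1)[OF normal_self] by (auto simp: RCOSETS_def)
    ultimately show "m {} = 0"
      by (simp add: m coset_fraction_def)
    show "m (topspace T) < \<infinity>"
      by (simp add: m[OF topst] topspace)
    fix C D assume C: "openin T C" "closedin T C" and D: "openin T D" "closedin T D" and disj: "C \<inter> D = {}"
    obtain N M where N: "coset_stable N C" and M: "coset_stable M D"
      using ex_coset_stable C D by blast
    then have NM: "N \<inter> M \<lhd> K" "openin T (N \<inter> M)"
      using normal_subgroup_intersect by (auto simp: coset_stable_def)
    have st: "coset_stable (N \<inter> M) C" "coset_stable (N \<inter> M) D"
      using coset_stable_subset[OF N NM] coset_stable_subset[OF M NM] by auto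
    then have stU: "coset_stable (N \<inter> M) (C \<union> D)"
      by (auto simp: coset_stable_def)
    have eq: "{E \<in> rcosets (N \<inter> M). E \<subseteq> C \<union> D} = {E \<in> rcosets (N \<inter> M). E \<subseteq> C} \<union> {E \<in> rcosets (N \<inter> M). E \<subseteq> D}"
    proof (intro equalityI subsetI)
      fix E assume E: "E \<in> {E \<in> rcosets (N \<inter> M). E \<subseteq> C \<union> D}"
      then obtain x where x: "x \<in> carrier K" "E = (N \<inter> M) #> x" by (auto simp: RCOSETS_def)
      then have "x \<in> C \<union> D" using rcosets_self(1)[OF NM(1) x(1)] E by auto
      then show "E \<in> {E \<in> rcosets (N \<inter> M). E \<subseteq> C} \<union> {E \<in> rcosets (N \<inter> M). E \<subseteq> D}"
        using st E x(2) by (auto simp: coset_stable_def)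
    qed auto
    have "{E \<in> rcosets (N \<inter> M). E \<subseteq> C} \<inter> {E \<in> rcosets (N \<inter> M). E \<subseteq> D} = {}"
    proof -
      have "E \<noteq> {}" if "E \<in> rcosets (N \<inter> M)" for E
        using that rcosets_self(1)[OF NM(1)] by (auto simp: RCOSETS_def)
      then show ?thesis using disj by blast
    qed
    then have "coset_fraction (N \<inter> M) (C \<union> D) = coset_fraction (N \<inter> M) C + coset_fraction (N \<inter> M) D"
      using finite_rcosets[OF NM] by (simp add: coset_fraction_def eq card_Un_disjoint add_divide_distrib)
    then show "m (C \<union> D) = m C + m D"
      using m[OF st(1)] m[OF st(2)] m[OF stU] pos by (simp add: ennreal_plus)
  qed
  obtain M where M: "finite_radon_measure T M" "\<And>C. openin T C \<Longrightarrow> closedin T C \<Longrightarrow> emeasure M C = m C"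
    using radon_extension by blast
  have "normalized_haar K T M"
  proof (rule normalized_haarI[OF M(1)])
    fix N x assume N: "N \<lhd> K" "openin T N" and x: "x \<in> carrier K"
    have Nx: "N #> x \<in> rcosets N" by (rule rcosets_self(2)[OF N(1) x])
    have "N #> x \<subseteq> carrier K" using Nx rcosets_Union[OF N(1)] by auto
    then have st: "coset_stable N (N #> x)"
      using N rcosets_eq[OF N(1) Nx] by (auto simp: coset_stable_def)
    have "{D \<in> rcosets N. D \<subseteq> N #> x} = {N #> x}"
    proof -
      have "D = N #> x" if D: "D \<in> rcosets N" "D \<subseteq> N #> x" for D
      proof -
        obtain y where "y \<in> carrier K" "D = N #> y" using D by (auto simp: RCOSETS_def)
        then show ?thesis
          using rcosets_self(1)[OF N(1)] rcosets_eq[OF N(1) Nx] D by blast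
      qed
      then show ?thesis using Nx by blast
    qed
    then show "emeasure M (N #> x) = ennreal (1 / real (card (rcosets N)))"
      using M(2)[OF openin_coset[OF N x] closedin_coset[OF N Nx]] m[OF st] by (simp add: coset_fraction_def)
  qed
  then show ?thesis by blast
qed

lemma haar_eqI: "normalized_haar K T M \<Longrightarrow> haar K T = M"
  unfolding haar_def using normalized_haar_unique by (intro the_equality)

lemma normalized_haar_haar: "normalized_haar K T (haar K T)"
  using ex_normalized_haar haar_eqI by metis

lemma finite_radon_haar: "finite_radon_measure T (haar K T)"
  using normalized_haar_haar by (simp add: normalized_haar_def)

end

section \<open>Pro-p-groups are profinite\<close>

text \<open>A family outside the limit violates a single compatibility condition, and so do all families that agree
  with it in the two coordinates concerned.\<close>

lemma closedin_inv_lim: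
  "closedin (product_topology (\<lambda>i. discrete_topology (carrier (A i))) I) (carrier (inv_lim I r A \<pi>))"
proof -
  let ?P = "product_topology (\<lambda>i. discrete_topology (carrier (A i))) I"
  let ?L = "carrier (inv_lim I r A \<pi>)"
  have "\<exists>V. openin ?P V \<and> f \<in> V \<and> V \<subseteq> topspace ?P - ?L" if f: "f \<in> topspace ?P - ?L" for f
  proof -
    obtain i j where ij: "i \<in> I" "j \<in> I" "r i j" "\<pi> i j (f i) \<noteq> f j"
      using f by (auto simp: inv_lim_def)
    let ?V = "\<lambda>i. {g \<in> topspace ?P. g i \<in> {f i}}"
    have "openin ?P (?V k)" if "k \<in> I" for k
      using f that by (intro openin_continuous_map_preimage[OF continuous_map_product_projection[OF that]]) auto
    then have "openin ?P (?V i \<inter> ?V j)"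
      using ij by blast
    moreover have "f \<in> ?V i \<inter> ?V j"
      using f by auto
    moreover have "?V i \<inter> ?V j \<subseteq> topspace ?P - ?L"
      using ij by (auto simp: inv_lim_def)
    ultimately show ?thesis by blast
  qed
  then have "openin ?P (topspace ?P - ?L)"
    by (subst openin_subopen) blast
  moreover have "?L \<subseteq> topspace ?P"
    by (auto simp: inv_lim_def)
  ultimately show ?thesis
    by (simp only: closedin_def)
qed

lemma index_torsion:
  assumes N: "N \<lhd> G" and card: "finite (carrier (G Mod N))" "card (carrier (G Mod N)) = n" and x: "x \<in> carrier G"
  shows "x [^]\<^bsub>G\<^esub> n \<in> N"
proof -
  interpret N: normal N G by fact
  interpret Q: group "G Mod N" by (rule N.factorgroup_is_group)
  have "(N #>\<^bsub>G\<^esub> x) [^]\<^bsub>G Mod N\<^esub> n = \<one>\<^bsub>G Mod N\<^esub>"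
    using Q.pow_order_eq_1[of "N #>\<^bsub>G\<^esub> x"] x card by (simp add: order_def coset_in_Mod)
  then have "N #>\<^bsub>G\<^esub> (x [^]\<^bsub>G\<^esub> n) = N"
    using N.FactGroup_pow[OF x] by (simp add: FactGroup_def)
  then show ?thesis
    using N.coset_join1[OF _ _ N.subgroup_axioms] x by simp
qed

text \<open>The limit is a closed subspace of a product of finite discrete spaces, hence compact and Hausdorff.
  A basic neighbourhood of the identity in the limit is given by finitely many subgroups of \<open>p\<close>-power index. Every
  element has a \<open>p\<close>-power in each of them, and hence, adding the exponents, in their intersection.\<close>

lemma pro_p_group_profinite:
  assumes "pro_p_group p G T"
  shows "profinite_group G T"
    and "openin T U \<Longrightarrow> \<one>\<^bsub>G\<^esub> \<in> U \<Longrightarrow>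
      \<exists>N. N \<lhd> G \<and> openin T N \<and> N \<subseteq> U \<and> (\<forall>x\<in>carrier G. \<exists>k. x [^]\<^bsub>G\<^esub> (p ^ k) \<in> N)"
proof -
  define I where "I = p_index_subgroups p G T"
  define \<pi> where "\<pi> = (\<lambda>(N :: 'a set) N' C. N' <#>\<^bsub>G\<^esub> C)"
  define \<phi> where "\<phi> = (\<lambda>g. \<lambda>N\<in>I. N #>\<^bsub>G\<^esub> g)"
  let ?L = "inv_lim I (\<subseteq>) (\<lambda>N. G Mod N) \<pi>"
  let ?LT = "inv_lim_topology I (\<subseteq>) (\<lambda>N. G Mod N) \<pi>"
  let ?P = "product_topology (\<lambda>N. discrete_topology (carrier (G Mod N))) I"
  have tg: "topological_group G T" and iso: "\<phi> \<in> iso G ?L" and homeo: "homeomorphic_map T ?LT \<phi>"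
    using assms unfolding pro_p_group_def Let_def I_def[symmetric] \<pi>_def[symmetric] \<phi>_def[symmetric] by auto
  interpret G: group G using tg by (simp add: topological_group_def)
  have ts: "topspace T = carrier G" using tg by (simp add: topological_group_def)
  have LT: "?LT = subtopology ?P (carrier ?L)"
    by (simp add: inv_lim_topology_def)
  have I: "N \<lhd> G" "finite (carrier (G Mod N))" "\<exists>k. card (carrier (G Mod N)) = p ^ k" if "N \<in> I" for N
    using that by (auto simp: I_def p_index_subgroups_def)
  have "compact_space ?P"
    using I(2) by (auto simp: compact_space_product_topology compact_space_discrete_topology)
  then have "compact_space ?LT"
    unfolding LT by (intro compact_space_subtopology closedin_compact_space closedin_inv_lim)
  moreover have "Hausdorff_space ?LT"
    unfolding LT by (intro Hausdorff_space_subtopology) (simp add: Hausdorff_space_product_topology)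
  ultimately have top: "compact_space T" "Hausdorff_space T"
    using homeomorphic_map_imp_homeomorphic_space[OF homeo] homeomorphic_compact_space homeomorphic_Hausdorff_space by blast+
  have cont: "continuous_map T ?P \<phi>"
    using homeomorphic_imp_continuous_map[OF homeo] by (simp add: LT continuous_map_in_subtopology)
  have op: "openin T N" if N: "N \<in> I" for N
  proof -
    interpret N: normal N G by (rule I(1)[OF N])
    have "continuous_map T (discrete_topology (carrier (G Mod N))) (\<lambda>x. \<phi> x N)"
      using continuous_map_compose[OF cont continuous_map_product_projection[OF N]] by (simp add: o_def)
    then have "openin T {x \<in> topspace T. \<phi> x N \<in> {N}}"
      using coset_in_Mod[OF G.one_closed, of N] N.subset
      by (intro openin_continuous_map_preimage) auto
    moreover have "\<phi> x N = N \<longleftrightarrow> x \<in> N" if "x \<in> carrier G" for x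
      using N that G.coset_join1[OF _ _ N.subgroup_axioms] G.coset_join2[OF _ N.subgroup_axioms]
      by (auto simp: \<phi>_def)
    then have "{x \<in> topspace T. \<phi> x N \<in> {N}} = N"
      using ts N.subset by auto
    ultimately show ?thesis by simp
  qed
  have inter: "\<exists>N. N \<lhd> G \<and> openin T N \<and> (\<forall>M\<in>F. N \<subseteq> M) \<and> (\<forall>x\<in>carrier G. \<exists>k. x [^]\<^bsub>G\<^esub> (p ^ k) \<in> N)"
    if "finite F" "F \<subseteq> I" for F
    using that
  proof (induction F)
    case empty
    then show ?case
      using G.normal_self openin_topspace[of T] ts by (intro exI[of _ "carrier G"]) auto
  next
    case (insert M F)
    then obtain N where N: "N \<lhd> G" "openin T N" "\<forall>M\<in>F. N \<subseteq> M"
      and tor: "\<And>x. x \<in> carrier G \<Longrightarrow> \<exists>k. x [^]\<^bsub>G\<^esub> (p ^ k) \<in> N"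
      by auto
    have M: "M \<in> I" using insert.prems by simp
    interpret N: normal N G by fact
    interpret M: normal M G by (rule I(1)[OF M])
    obtain m where m: "card (carrier (G Mod M)) = p ^ m" using I(3)[OF M] by blast
    have "\<exists>k. x [^]\<^bsub>G\<^esub> (p ^ k) \<in> N \<inter> M" if x: "x \<in> carrier G" for x
    proof -
      obtain k where k: "x [^]\<^bsub>G\<^esub> (p ^ k) \<in> N" using tor[OF x] by blast
      have pow_in: "y [^]\<^bsub>G\<^esub> l \<in> S" if "subgroup S G" "y \<in> S" for y S and l :: nat
        using that by (induction l) (auto simp: subgroup.one_closed subgroup.m_closed)
      have "x [^]\<^bsub>G\<^esub> (p ^ (k + m)) = (x [^]\<^bsub>G\<^esub> (p ^ k)) [^]\<^bsub>G\<^esub> (p ^ m)"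
        using x by (simp add: G.nat_pow_pow power_add)
      moreover have "x [^]\<^bsub>G\<^esub> (p ^ (k + m)) = (x [^]\<^bsub>G\<^esub> (p ^ m)) [^]\<^bsub>G\<^esub> (p ^ k)"
        using x by (simp add: G.nat_pow_pow power_add mult.commute)
      moreover have "x [^]\<^bsub>G\<^esub> (p ^ m) \<in> M"
        by (rule index_torsion[OF I(1,2)[OF M] m x])
      ultimately have "x [^]\<^bsub>G\<^esub> (p ^ (k + m)) \<in> N \<inter> M"
        using pow_in[OF N.subgroup_axioms k, of "p ^ m"] pow_in[OF M.subgroup_axioms, of "x [^]\<^bsub>G\<^esub> (p ^ m)" "p ^ k"]
        by (metis IntI)
      then show ?thesis by blast
    qed
    moreover have "N \<inter> M \<lhd> G" "openin T (N \<inter> M)"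
      using N op[OF M] I(1)[OF M] G.normal_subgroup_intersect by auto
    ultimately show ?case
      using N(3) by (intro exI[of _ "N \<inter> M"]) auto
  qed
  have base: "\<exists>N. N \<lhd> G \<and> openin T N \<and> N \<subseteq> U \<and> (\<forall>x\<in>carrier G. \<exists>k. x [^]\<^bsub>G\<^esub> (p ^ k) \<in> N)"
    if U: "openin T U" "\<one>\<^bsub>G\<^esub> \<in> U" for U
  proof -
    let ?X = "\<lambda>N. discrete_topology (carrier (G Mod N))"
    have Uc: "U \<subseteq> carrier G" using openin_subset[OF U(1)] ts by simp
    have "openin ?LT (\<phi> ` U)"
      using homeomorphic_imp_open_map[OF homeo] U(1) by (simp add: open_map_def)
    then obtain W where W: "openin ?P W" "\<phi> ` U = W \<inter> carrier ?L"
      by (auto simp: LT openin_subtopology)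
    have "\<phi> \<one>\<^bsub>G\<^esub> \<in> W" using W(2) U(2) by blast
    with W(1) have "\<exists>V. finite {i \<in> I. V i \<noteq> topspace (?X i)} \<and> (\<forall>i\<in>I. openin (?X i) (V i)) \<and>
        \<phi> \<one>\<^bsub>G\<^esub> \<in> PiE I V \<and> PiE I V \<subseteq> W"
      unfolding openin_product_topology_alt by (rule bspec)
    then obtain V where V: "finite {i \<in> I. V i \<noteq> topspace (?X i)}" "\<phi> \<one>\<^bsub>G\<^esub> \<in> PiE I V" "PiE I V \<subseteq> W"
      by (elim exE conjE)
    obtain N where N: "N \<lhd> G" "openin T N" "\<forall>M\<in>{i \<in> I. V i \<noteq> topspace (?X i)}. N \<subseteq> M"
      "\<forall>x\<in>carrier G. \<exists>k. x [^]\<^bsub>G\<^esub> (p ^ k) \<in> N"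
      using inter[OF V(1)] by blast
    interpret N: normal N G by fact
    have "N \<subseteq> U"
    proof
      fix x assume x: "x \<in> N"
      then have xc: "x \<in> carrier G" using N.subset by auto
      have "\<phi> x \<in> PiE I V"
      proof (rule PiE_I)
        fix M assume M: "M \<in> I"
        interpret M: normal M G by (rule I(1)[OF M])
        show "\<phi> x M \<in> V M"
        proof (cases "V M = topspace (?X M)")
          case True
          then show ?thesis using M coset_in_Mod[OF xc] by (simp add: \<phi>_def)
        next
          case False
          then have "x \<in> M" using N(3) M x by blast
          then have "\<phi> x M = \<phi> \<one>\<^bsub>G\<^esub> M"
            using M G.coset_join2[OF xc M.subgroup_axioms] G.coset_mult_one[OF M.subset] by (simp add: \<phi>_def)
          then show ?thesis using V(2) M by auto
        qed
      qed (simp add: \<phi>_def)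
      moreover have "\<phi> x \<in> carrier ?L"
        using iso xc by (auto simp: iso_def hom_def)
      ultimately have "\<phi> x \<in> \<phi> ` U" using V(3) W(2) by blast
      moreover have "inj_on \<phi> (carrier G)" using iso by (auto simp: iso_def bij_betw_def)
      ultimately show "x \<in> U"
        using xc Uc by (meson inj_on_image_mem_iff)
    qed
    with N show ?thesis by blast
  qed
  show "profinite_group G T"
    by (intro profinite_group.intro profinite_group_axioms.intro G.group_axioms tg top) (use base in blast)
  show "openin T U \<Longrightarrow> \<one>\<^bsub>G\<^esub> \<in> U \<Longrightarrow>
      \<exists>N. N \<lhd> G \<and> openin T N \<and> N \<subseteq> U \<and> (\<forall>x\<in>carrier G. \<exists>k. x [^]\<^bsub>G\<^esub> (p ^ k) \<in> N)"
    by (rule base)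
qed


section \<open>Direct products of profinite groups\<close>

lemma topological_group_DirProd:
  assumes G: "topological_group G S" and H: "topological_group H T"
  shows "topological_group (G \<times>\<times> H) (prod_topology S T)"
proof -
  let ?K = "G \<times>\<times> H" and ?X = "prod_topology S T"
  interpret G: group G using G by (simp add: topological_group_def)
  interpret H: group H using H by (simp add: topological_group_def)
  have ts: "topspace S = carrier G" "topspace T = carrier H"
    using G H by (simp_all add: topological_group_def)
  have mult: "continuous_map (prod_topology S S) S (\<lambda>(x, y). x \<otimes>\<^bsub>G\<^esub> y)"
    "continuous_map (prod_topology T T) T (\<lambda>(x, y). x \<otimes>\<^bsub>H\<^esub> y)"
    and inv: "continuous_map S S (\<lambda>x. inv\<^bsub>G\<^esub> x)" "continuous_map T T (\<lambda>x. inv\<^bsub>H\<^esub> x)"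
    using G H by (simp_all add: topological_group_def)
  have proj: "continuous_map (prod_topology ?X ?X) (prod_topology S S) (\<lambda>z. (fst (fst z), fst (snd z)))"
    "continuous_map (prod_topology ?X ?X) (prod_topology T T) (\<lambda>z. (snd (fst z), snd (snd z)))"
    using continuous_map_compose[OF continuous_map_fst[of ?X ?X] continuous_map_fst[of S T]]
      continuous_map_compose[OF continuous_map_snd[of ?X ?X] continuous_map_fst[of S T]]
      continuous_map_compose[OF continuous_map_fst[of ?X ?X] continuous_map_snd[of S T]]
      continuous_map_compose[OF continuous_map_snd[of ?X ?X] continuous_map_snd[of S T]]
    by (simp_all add: continuous_map_pairedI o_def)
  have "continuous_map (prod_topology ?X ?X) ?X
      (\<lambda>z. (fst (fst z) \<otimes>\<^bsub>G\<^esub> fst (snd z), snd (fst z) \<otimes>\<^bsub>H\<^esub> snd (snd z)))"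
    using continuous_map_compose[OF proj(1) mult(1)] continuous_map_compose[OF proj(2) mult(2)]
    by (auto intro!: continuous_map_pairedI simp: o_def)
  then have "continuous_map (prod_topology ?X ?X) ?X (\<lambda>(x, y). x \<otimes>\<^bsub>?K\<^esub> y)"
    by (simp add: case_prod_unfold mult_DirProd')
  moreover have "continuous_map ?X ?X (\<lambda>z. (inv\<^bsub>G\<^esub> (fst z), inv\<^bsub>H\<^esub> (snd z)))"
    using continuous_map_compose[OF continuous_map_fst inv(1)] continuous_map_compose[OF continuous_map_snd inv(2)]
    by (auto intro!: continuous_map_pairedI simp: o_def)
  then have "continuous_map ?X ?X (\<lambda>z. inv\<^bsub>?K\<^esub> z)"
    by (rule continuous_map_eq) (auto simp: ts inv_DirProd[OF G.group_axioms H.group_axioms])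
  ultimately show ?thesis
    using DirProd_group[OF G.group_axioms H.group_axioms] ts by (simp add: topological_group_def)
qed

lemma profinite_group_DirProd:
  assumes G: "profinite_group G S" and H: "profinite_group H T"
  shows "profinite_group (G \<times>\<times> H) (prod_topology S T)"
proof -
  interpret G: profinite_group G S by fact
  interpret H: profinite_group H T by fact
  show ?thesis
  proof (intro profinite_group.intro profinite_group_axioms.intro)
    show "group (G \<times>\<times> H)" by (rule DirProd_group[OF G.group_axioms H.group_axioms])
    show "topological_group (G \<times>\<times> H) (prod_topology S T)"
      by (rule topological_group_DirProd[OF G.topological_group H.topological_group])
    show "compact_space (prod_topology S T)" "Hausdorff_space (prod_topology S T)"
      using G.compact_space H.compact_space G.Hausdorff_space H.Hausdorff_space
      by (simp_all add: compact_space_prod_topology Hausdorff_space_prod_topology)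
    fix W assume W: "openin (prod_topology S T) W" "\<one>\<^bsub>G \<times>\<times> H\<^esub> \<in> W"
    then obtain U V where UV: "openin S U" "openin T V" "\<one>\<^bsub>G\<^esub> \<in> U" "\<one>\<^bsub>H\<^esub> \<in> V" "U \<times> V \<subseteq> W"
      unfolding openin_prod_topology_alt by (auto; metis)
    obtain N where N: "N \<lhd> G" "openin S N" "N \<subseteq> U" using G.open_normal_subset UV by blast
    obtain M where M: "M \<lhd> H" "openin T M" "M \<subseteq> V" using H.open_normal_subset UV by blast
    show "\<exists>N. N \<lhd> G \<times>\<times> H \<and> openin (prod_topology S T) N \<and> N \<subseteq> W"
      using N M UV(5) G.DirProd_normal[OF H.group_axioms N(1) M(1)]
      by (intro exI[of _ "N \<times> M"]) (auto simp: openin_prod_Times_iff)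
  qed
qed

text \<open>A translation of the product acts on rectangles through translations of the factors; as a Radon measure
  is determined by its values on open rectangles, the product of the Haar measures is invariant.\<close>

lemma haar_DirProd:
  assumes G: "profinite_group G S" and H: "profinite_group H T"
  shows "haar (G \<times>\<times> H) (prod_topology S T) = radon_product S T (haar G S) (haar H T)"
proof -
  interpret G: profinite_group G S by fact
  interpret H: profinite_group H T by fact
  interpret K: profinite_group "G \<times>\<times> H" "prod_topology S T" by (rule profinite_group_DirProd[OF G H])
  let ?P = "radon_product S T (haar G S) (haar H T)"
  note P = radon_product_props[OF G.stone_space H.stone_space G.finite_radon_haar H.finite_radon_haar]
  have nh: "normalized_haar G S (haar G S)" "normalized_haar H T (haar H T)"
    by (rule G.normalized_haar_haar, rule H.normalized_haar_haar)
  have "normalized_haar (G \<times>\<times> H) (prod_topology S T) ?P"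
    unfolding normalized_haar_def
  proof (intro conjI ballI)
    have "carrier G \<in> sets (haar G S)" "carrier H \<in> sets (haar H T)"
      using finite_radon_sets_openin[OF G.finite_radon_haar openin_topspace]
        finite_radon_sets_openin[OF H.finite_radon_haar openin_topspace] G.topspace H.topspace by auto
    then show "emeasure ?P (carrier (G \<times>\<times> H)) = 1"
      using P(2) nh by (simp add: normalized_haar_def)
    fix z A assume z: "z \<in> carrier (G \<times>\<times> H)" and A: "A \<in> sets ?P"
    obtain g h where gh: "z = (g, h)" "g \<in> carrier G" "h \<in> carrier H" using z by auto
    have "distr ?P (borel_algebra (prod_topology S T)) (\<lambda>x. inv\<^bsub>G \<times>\<times> H\<^esub> z \<otimes>\<^bsub>G \<times>\<times> H\<^esub> x) = ?P"
    proof (rule finite_radon_prod_eqI[OF K.Hausdorff_space _ P(1)])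
      show "finite_radon_measure (prod_topology S T)
          (distr ?P (borel_algebra (prod_topology S T)) (\<lambda>x. inv\<^bsub>G \<times>\<times> H\<^esub> z \<otimes>\<^bsub>G \<times>\<times> H\<^esub> x))"
        using z by (intro finite_radon_distr[OF P(1) K.continuous_translation(1) K.Hausdorff_space]) (rule K.inv_closed)
      fix U V assume UV: "openin S U" "openin T V"
      have sets: "U \<in> sets (haar G S)" "V \<in> sets (haar H T)"
        using UV finite_radon_sets_openin G.finite_radon_haar H.finite_radon_haar by blast+
      have "openin S (g <#\<^bsub>G\<^esub> U)" "openin T (h <#\<^bsub>H\<^esub> V)"
        using G.openin_translate[OF gh(2) UV(1)] H.openin_translate[OF gh(3) UV(2)] .
      then have sets': "g <#\<^bsub>G\<^esub> U \<in> sets (haar G S)" "h <#\<^bsub>H\<^esub> V \<in> sets (haar H T)"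
        using finite_radon_sets_openin G.finite_radon_haar H.finite_radon_haar by blast+
      have "U \<times> V \<in> sets ?P"
        using UV by (intro finite_radon_sets_openin[OF P(1)]) (auto simp: openin_prod_Times_iff)
      then have "emeasure (distr ?P (borel_algebra (prod_topology S T)) (\<lambda>x. inv\<^bsub>G \<times>\<times> H\<^esub> z \<otimes>\<^bsub>G \<times>\<times> H\<^esub> x)) (U \<times> V) =
          emeasure ?P (z <#\<^bsub>G \<times>\<times> H\<^esub> (U \<times> V))"
        by (rule K.emeasure_translate[OF P(1) z])
      also have "z <#\<^bsub>G \<times>\<times> H\<^esub> (U \<times> V) = (g <#\<^bsub>G\<^esub> U) \<times> (h <#\<^bsub>H\<^esub> V)"
        by (auto simp: l_coset_def gh(1))
      also have "emeasure ?P ((g <#\<^bsub>G\<^esub> U) \<times> (h <#\<^bsub>H\<^esub> V)) = emeasure ?P (U \<times> V)"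
        using nh sets gh by (simp add: P(2)[OF sets'] P(2)[OF sets] normalized_haar_def)
      finally show "emeasure (distr ?P (borel_algebra (prod_topology S T)) (\<lambda>x. inv\<^bsub>G \<times>\<times> H\<^esub> z \<otimes>\<^bsub>G \<times>\<times> H\<^esub> x)) (U \<times> V) =
          emeasure ?P (U \<times> V)" .
    qed
    then show "emeasure ?P (z <#\<^bsub>G \<times>\<times> H\<^esub> A) = emeasure ?P A"
      using K.emeasure_translate[OF P(1) z A] by simp
  qed (rule P(1))
  then show ?thesis by (rule K.haar_eqI)
qed


section \<open>The exterior degree of a direct product\<close>

definition exterior_kernel :: "('a, 'm) monoid_scheme \<Rightarrow> 'a topology \<Rightarrow> ('a \<times> 'a) set" where
  "exterior_kernel K T =
    {(x, y). x \<in> carrier K \<and> y \<in> carrier K \<and> complete_wedge K T x y = \<one>\<^bsub>complete_exterior_square K T\<^esub>}"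

lemma (in profinite_group) exterior_kernel_iff:
  "(x, y) \<in> exterior_kernel K T \<longleftrightarrow> x \<in> carrier K \<and> y \<in> carrier K \<and>
    (\<forall>N. N \<lhd> K \<and> openin T N \<longrightarrow> wedge_trivial K N x y)"
  using complete_wedge_eq_one_iff[OF topological_group] by (auto simp: exterior_kernel_def)

text \<open>If \<open>x \<and> y\<close> is nontrivial, this is visible in some \<open>K/N\<close>, and then \<open>x' \<and> y'\<close> is nontrivial for all
  \<open>x' \<in> Nx\<close> and \<open>y' \<in> Ny\<close>.\<close>

lemma (in profinite_group) closedin_exterior_kernel: "closedin (prod_topology T T) (exterior_kernel K T)"
proof -
  let ?X = "prod_topology T T"
  have "\<exists>V. openin ?X V \<and> z \<in> V \<and> V \<subseteq> topspace ?X - exterior_kernel K T" if z: "z \<in> topspace ?X - exterior_kernel K T" for z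
  proof -
    obtain x y where xy: "z = (x, y)" "x \<in> carrier K" "y \<in> carrier K"
      using z topspace by auto
    then obtain N where N: "N \<lhd> K" "openin T N" "\<not> wedge_trivial K N x y"
      using z exterior_kernel_iff by auto
    let ?V = "(N #> x) \<times> (N #> y)"
    have op: "openin T (N #> x)" "openin T (N #> y)" using openin_coset[OF N(1,2)] xy by auto
    have "(x', y') \<notin> exterior_kernel K T" if "x' \<in> N #> x" "y' \<in> N #> y" for x' y'
    proof -
      have "N #> x = N #> x'" "N #> y = N #> y'"
        using rcosets_eq[OF N(1) rcosets_self(2)[OF N(1) xy(2)] that(1)]
          rcosets_eq[OF N(1) rcosets_self(2)[OF N(1) xy(3)] that(2)] .
      then have "\<not> wedge_trivial K N x' y'"
        using N(3) by (simp add: wedge_trivial_def tensor_symbol_def)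
      then show ?thesis using N exterior_kernel_iff by auto
    qed
    then have "?V \<subseteq> topspace ?X - exterior_kernel K T"
      using op[THEN openin_subset] by auto
    moreover have "z \<in> ?V" using xy rcosets_self(1)[OF N(1)] by auto
    moreover have "openin ?X ?V" using op by (simp add: openin_prod_Times_iff)
    ultimately show ?thesis by blast
  qed
  then have "openin ?X (topspace ?X - exterior_kernel K T)"
    by (subst openin_subopen) blast
  moreover have "exterior_kernel K T \<subseteq> topspace ?X"
    using topspace by (auto simp: exterior_kernel_def)
  ultimately show ?thesis
    by (simp only: closedin_def)
qed

lemma wedge_trivial_mono:
  assumes "group K" "N \<lhd> K" "M \<lhd> K" "N \<subseteq> M" "x \<in> carrier K" "y \<in> carrier K" "wedge_trivial K N x y"
  shows "wedge_trivial K M x y"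
  using wedge_trivial_hom[of K K "\<lambda>x. x" N M x y] assms by (auto simp: hom_def)

text \<open>The products \<open>N \<times> M\<close> of small open normal subgroups of the factors are cofinal among the open normal
  subgroups of the direct product, so the statement reduces to the quotients by such products, where it
  is the splitting of the exterior square for coprime torsion.\<close>

lemma exterior_kernel_DirProd:
  assumes "coprime p q" and G: "pro_p_group p G S" and H: "pro_p_group q H T"
  shows "((a, b), (a', b')) \<in> exterior_kernel (G \<times>\<times> H) (prod_topology S T) \<longleftrightarrow>
    (a, a') \<in> exterior_kernel G S \<and> (b, b') \<in> exterior_kernel H T"
proof (cases "a \<in> carrier G \<and> a' \<in> carrier G \<and> b \<in> carrier H \<and> b' \<in> carrier H")
  case False
  then show ?thesis by (auto simp: exterior_kernel_def)
next
  case True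
  interpret G: profinite_group G S by (rule pro_p_group_profinite(1)[OF G])
  interpret H: profinite_group H T by (rule pro_p_group_profinite(1)[OF H])
  interpret K: profinite_group "G \<times>\<times> H" "prod_topology S T"
    by (rule profinite_group_DirProd[OF G.profinite_group_axioms H.profinite_group_axioms])
  have split: "wedge_trivial (G \<times>\<times> H) (N \<times> M) (a, b) (a', b') \<longleftrightarrow> wedge_trivial G N a a' \<and> wedge_trivial H M b b'"
    if "N \<lhd> G" "\<forall>x\<in>carrier G. \<exists>k. x [^]\<^bsub>G\<^esub> (p ^ k) \<in> N" "M \<lhd> H" "\<forall>x\<in>carrier H. \<exists>k. x [^]\<^bsub>H\<^esub> (q ^ k) \<in> M" for N M
    using wedge_trivial_DirProd[OF G.group_axioms H.group_axioms that(1,3) \<open>coprime p q\<close>] that True by blast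
  have prod: "N \<times> M \<lhd> G \<times>\<times> H" "openin (prod_topology S T) (N \<times> M)" if "N \<lhd> G" "openin S N" "M \<lhd> H" "openin T M" for N M
    using G.DirProd_normal[OF H.group_axioms] that by (auto simp: openin_prod_Times_iff)
  have subG: "\<exists>N'. N' \<lhd> G \<and> openin S N' \<and> N' \<subseteq> N \<and> (\<forall>x\<in>carrier G. \<exists>k. x [^]\<^bsub>G\<^esub> (p ^ k) \<in> N')"
    if "openin S N" "\<one>\<^bsub>G\<^esub> \<in> N" for N
    using pro_p_group_profinite(2)[OF G that] .
  have subH: "\<exists>M'. M' \<lhd> H \<and> openin T M' \<and> M' \<subseteq> M \<and> (\<forall>x\<in>carrier H. \<exists>k. x [^]\<^bsub>H\<^esub> (q ^ k) \<in> M')"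
    if "openin T M" "\<one>\<^bsub>H\<^esub> \<in> M" for M
    using pro_p_group_profinite(2)[OF H that] .
  have one: "\<one>\<^bsub>G\<^esub> \<in> topspace S" "\<one>\<^bsub>H\<^esub> \<in> topspace T"
    using G.topspace H.topspace by auto
  have oneN: "\<one>\<^bsub>J\<^esub> \<in> N" if "N \<lhd> J" for N and J :: "('x, 'y) monoid_scheme"
    using that by (simp add: normal_def subgroup.one_closed)
  show ?thesis
  proof
    assume "((a, b), (a', b')) \<in> exterior_kernel (G \<times>\<times> H) (prod_topology S T)"
    then have all: "wedge_trivial (G \<times>\<times> H) L (a, b) (a', b')" if "L \<lhd> G \<times>\<times> H" "openin (prod_topology S T) L" for L
      using K.exterior_kernel_iff that by blast
    have "wedge_trivial G N a a'" if N: "N \<lhd> G" "openin S N" for N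
    proof -
      obtain N' where N': "N' \<lhd> G" "openin S N'" "N' \<subseteq> N" "\<forall>x\<in>carrier G. \<exists>k. x [^]\<^bsub>G\<^esub> (p ^ k) \<in> N'"
        using subG[OF N(2) oneN[OF N(1)]] by blast
      obtain M' where M': "M' \<lhd> H" "openin T M'" "\<forall>x\<in>carrier H. \<exists>k. x [^]\<^bsub>H\<^esub> (q ^ k) \<in> M'"
        using subH[OF openin_topspace one(2)] by blast
      have "wedge_trivial G N' a a'"
        using split[OF N'(1,4) M'(1,3)] all[OF prod[OF N'(1,2) M'(1,2)]] by blast
      then show ?thesis
        using wedge_trivial_mono[OF G.group_axioms N'(1) N(1) N'(3)] True by blast
    qed
    moreover have "wedge_trivial H M b b'" if M: "M \<lhd> H" "openin T M" for M
    proof -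
      obtain M' where M': "M' \<lhd> H" "openin T M'" "M' \<subseteq> M" "\<forall>x\<in>carrier H. \<exists>k. x [^]\<^bsub>H\<^esub> (q ^ k) \<in> M'"
        using subH[OF M(2) oneN[OF M(1)]] by blast
      obtain N' where N': "N' \<lhd> G" "openin S N'" "\<forall>x\<in>carrier G. \<exists>k. x [^]\<^bsub>G\<^esub> (p ^ k) \<in> N'"
        using subG[OF openin_topspace one(1)] by blast
      have "wedge_trivial H M' b b'"
        using split[OF N'(1,3) M'(1,4)] all[OF prod[OF N'(1,2) M'(1,2)]] by blast
      then show ?thesis
        using wedge_trivial_mono[OF H.group_axioms M'(1) M(1) M'(3)] True by blast
    qed
    ultimately show "(a, a') \<in> exterior_kernel G S \<and> (b, b') \<in> exterior_kernel H T"
      using True G.exterior_kernel_iff H.exterior_kernel_iff by blast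
  next
    assume "(a, a') \<in> exterior_kernel G S \<and> (b, b') \<in> exterior_kernel H T"
    then have allG: "\<And>N. N \<lhd> G \<Longrightarrow> openin S N \<Longrightarrow> wedge_trivial G N a a'"
      and allH: "\<And>M. M \<lhd> H \<Longrightarrow> openin T M \<Longrightarrow> wedge_trivial H M b b'"
      using G.exterior_kernel_iff H.exterior_kernel_iff by blast+
    have "wedge_trivial (G \<times>\<times> H) L (a, b) (a', b')" if L: "L \<lhd> G \<times>\<times> H" "openin (prod_topology S T) L" for L
    proof -
      obtain U V where UV: "openin S U" "openin T V" "\<one>\<^bsub>G\<^esub> \<in> U" "\<one>\<^bsub>H\<^esub> \<in> V" "U \<times> V \<subseteq> L"
        using L(2)[unfolded openin_prod_topology_alt, rule_format, OF oneN[OF L(1), unfolded one_DirProd]] by blast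
      obtain N where N: "N \<lhd> G" "openin S N" "N \<subseteq> U" "\<forall>x\<in>carrier G. \<exists>k. x [^]\<^bsub>G\<^esub> (p ^ k) \<in> N"
        using subG[OF UV(1,3)] by blast
      obtain M where M: "M \<lhd> H" "openin T M" "M \<subseteq> V" "\<forall>x\<in>carrier H. \<exists>k. x [^]\<^bsub>H\<^esub> (q ^ k) \<in> M"
        using subH[OF UV(2,4)] by blast
      have "wedge_trivial (G \<times>\<times> H) (N \<times> M) (a, b) (a', b')"
        using split[OF N(1,4) M(1,4)] allG[OF N(1,2)] allH[OF M(1,2)] by blast
      moreover have "N \<times> M \<subseteq> L" using N(3) M(3) UV(5) by blast
      ultimately show ?thesis
        using wedge_trivial_mono[OF K.group_axioms prod(1)[OF N(1,2) M(1,2)] L(1)] True by simp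
    qed
    then show "((a, b), (a', b')) \<in> exterior_kernel (G \<times>\<times> H) (prod_topology S T)"
      using True K.exterior_kernel_iff by simp
  qed
qed

text \<open>Both measures are Radon, and on a product of four open sets either one is the product of the four measures;
  such products form a base.\<close>

lemma radon_product_interchange:
  assumes S: "stone_space S" and T: "stone_space T"
    and M: "finite_radon_measure S M" and N: "finite_radon_measure T N"
  defines "P \<equiv> radon_product S T M N"
  shows "distr (radon_product (prod_topology S S) (prod_topology T T) (radon_product S S M M) (radon_product T T N N))
      (borel_algebra (prod_topology (prod_topology S T) (prod_topology S T)))
      (\<lambda>((g, g'), (h, h')). ((g, h), (g', h'))) =
    radon_product (prod_topology S T) (prod_topology S T) P P"
    (is "distr ?Q (borel_algebra ?Y) ?s = ?R")
    and "continuous_map (prod_topology (prod_topology S S) (prod_topology T T)) (prod_topology (prod_topology S T) (prod_topology S T))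
      (\<lambda>((g, g'), (h, h')). ((g, h), (g', h')))"
proof -
  let ?X = "prod_topology (prod_topology S S) (prod_topology T T)"
  have st: "stone_space (prod_topology S T)" "stone_space (prod_topology S S)" "stone_space (prod_topology T T)"
    using S T stone_space_prod by blast+
  have sY: "stone_space ?Y" by (rule stone_space_prod[OF st(1) st(1)])
  note P = radon_product_props[OF S T M N, folded P_def]
  note PM = radon_product_props[OF S S M M]
  note PN = radon_product_props[OF T T N N]
  note Q = radon_product_props[OF st(2,3) PM(1) PN(1)]
  note R = radon_product_props[OF st(1,1) P(1) P(1)]
  have proj: "continuous_map ?X S (\<lambda>z. fst (fst z))" "continuous_map ?X S (\<lambda>z. snd (fst z))"
    "continuous_map ?X T (\<lambda>z. fst (snd z))" "continuous_map ?X T (\<lambda>z. snd (snd z))"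
    using continuous_map_compose[OF continuous_map_fst[of "prod_topology S S" "prod_topology T T"] continuous_map_fst[of S S]]
      continuous_map_compose[OF continuous_map_fst[of "prod_topology S S" "prod_topology T T"] continuous_map_snd[of S S]]
      continuous_map_compose[OF continuous_map_snd[of "prod_topology S S" "prod_topology T T"] continuous_map_fst[of T T]]
      continuous_map_compose[OF continuous_map_snd[of "prod_topology S S" "prod_topology T T"] continuous_map_snd[of T T]]
    by (simp_all add: o_def)
  have "continuous_map ?X ?Y (\<lambda>z. ((fst (fst z), fst (snd z)), (snd (fst z), snd (snd z))))"
    by (intro continuous_map_pairedI proj)
  then show s: "continuous_map ?X ?Y ?s"
    by (simp add: case_prod_unfold)
  let ?E = "{(U \<times> V) \<times> (U' \<times> V') |U V U' V'. openin S U \<and> openin T V \<and> openin S U' \<and> openin T V'}"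
  show "distr ?Q (borel_algebra ?Y) ?s = ?R"
  proof (rule finite_radon_eqI[OF _ finite_radon_distr[OF Q(1) s] R(1), of ?E])
    show "Hausdorff_space ?Y" "Hausdorff_space ?Y"
      using sY by (simp_all add: stone_space_def)
    show "Int_stable ?E"
    proof (rule Int_stableI)
      fix A B assume A: "A \<in> ?E" and B: "B \<in> ?E"
      obtain U V U' V' where oA: "openin S U" "openin T V" "openin S U'" "openin T V'" "A = (U \<times> V) \<times> (U' \<times> V')"
        using A by blast
      obtain W Z W' Z' where oB: "openin S W" "openin T Z" "openin S W'" "openin T Z'" "B = (W \<times> Z) \<times> (W' \<times> Z')"
        using B by blast
      have "A \<inter> B = ((U \<inter> W) \<times> (V \<inter> Z)) \<times> ((U' \<inter> W') \<times> (V' \<inter> Z'))"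
        "openin S (U \<inter> W)" "openin T (V \<inter> Z)" "openin S (U' \<inter> W')" "openin T (V' \<inter> Z')"
        using oA oB by (simp_all add: Times_Int_Times openin_Int)
      then show "A \<inter> B \<in> ?E" unfolding mem_Collect_eq by (intro exI conjI)
    qed
    show "topspace ?Y \<in> ?E"
      unfolding topspace_prod_topology using openin_topspace[of S] openin_topspace[of T] by blast
    show "openin ?Y A" if "A \<in> ?E" for A
      using that by (auto simp: openin_prod_Times_iff)
    show "\<exists>A\<in>?E. z \<in> A \<and> A \<subseteq> W" if W: "openin ?Y W" "z \<in> W" for W z
    proof -
      obtain g h g' h' where z: "z = ((g, h), (g', h'))" by (metis prod.collapse)
      obtain A B where AB: "openin (prod_topology S T) A" "openin (prod_topology S T) B" "(g, h) \<in> A" "(g', h') \<in> B" "A \<times> B \<subseteq> W"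
        using openin_prodE[OF W(1) W(2)[unfolded z]] .
      obtain U V where UV: "openin S U" "openin T V" "g \<in> U" "h \<in> V" "U \<times> V \<subseteq> A"
        using openin_prodE[OF AB(1,3)] .
      obtain U' V' where UV': "openin S U'" "openin T V'" "g' \<in> U'" "h' \<in> V'" "U' \<times> V' \<subseteq> B"
        using openin_prodE[OF AB(2,4)] .
      show ?thesis
      proof (rule bexI)
        show "z \<in> (U \<times> V) \<times> (U' \<times> V') \<and> (U \<times> V) \<times> (U' \<times> V') \<subseteq> W"
          using UV(3,4,5) UV'(3,4,5) AB(5) unfolding z by blast
        show "(U \<times> V) \<times> (U' \<times> V') \<in> ?E"
          unfolding mem_Collect_eq using UV(1,2) UV'(1,2) 
          by (intro exI[of _ U] exI[of _ V] exI[of _ U'] exI[of _ V']) simp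
      qed
    qed
    fix A assume A: "A \<in> ?E"
    then obtain U V U' V' where o: "openin S U" "openin T V" "openin S U'" "openin T V'" and AA: "A = (U \<times> V) \<times> (U' \<times> V')"
      by blast
    have sets: "U \<in> sets M" "U' \<in> sets M" "V \<in> sets N" "V' \<in> sets N"
      using o finite_radon_sets_openin M N by blast+
    have setsP: "U \<times> V \<in> sets P" "U' \<times> V' \<in> sets P" "U \<times> U' \<in> sets (radon_product S S M M)" "V \<times> V' \<in> sets (radon_product T T N N)"
      using o finite_radon_sets_openin[OF P(1)] finite_radon_sets_openin[OF PM(1)] finite_radon_sets_openin[OF PN(1)]
      by (auto simp: openin_prod_Times_iff)
    have sub: "U \<subseteq> topspace S" "U' \<subseteq> topspace S" "V \<subseteq> topspace T" "V' \<subseteq> topspace T"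
      using o openin_subset by blast+
    have "A \<in> sets (borel_algebra ?Y)"
      unfolding sets_borel_algebra AA using o by (intro sigma_sets.Basic) (simp add: openin_prod_Times_iff)
    then have "emeasure (distr ?Q (borel_algebra ?Y) ?s) A = emeasure ?Q (?s -` A \<inter> space ?Q)"
      by (intro emeasure_distr continuous_map_measurable[OF Q(1) s])
    also have "?s -` A \<inter> space ?Q = (U \<times> U') \<times> (V \<times> V')"
      using Q(1) sub by (auto simp: AA finite_radon_measure_def)
    also have "emeasure ?Q \<dots> = emeasure ?R A"
      unfolding AA R(2)[OF setsP(1,2)] Q(2)[OF setsP(3,4)] PM(2)[OF sets(1,2)] PN(2)[OF sets(3,4)]
        P(2)[OF sets(1,3)] P(2)[OF sets(2,4)]
      by (simp add: ac_simps)
    finally show "emeasure (distr ?Q (borel_algebra ?Y) ?s) A = emeasure ?R A" .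
  qed
qed

lemma exterior_degree_eq:
  "exterior_degree K T = measure (radon_product T T (haar K T) (haar K T)) (exterior_kernel K T)"
  by (simp add: exterior_degree_def exterior_kernel_def)

theorem theorem3p12:
  fixes p q :: nat
    and G :: "'a monoid" and S :: "'a topology"
    and H :: "'b monoid" and T :: "'b topology"
  assumes "prime p" and "prime q" and "p \<noteq> q"
    and "pro_p_group p G S" and "pro_p_group q H T"
  shows "exterior_degree (G \<times>\<times> H) (prod_topology S T) = exterior_degree G S * exterior_degree H T"
proof -
  have cop: "coprime p q" using assms(1-3) by (simp add: primes_coprime)
  interpret G: profinite_group G S by (rule pro_p_group_profinite(1)[OF assms(4)])
  interpret H: profinite_group H T by (rule pro_p_group_profinite(1)[OF assms(5)])
  interpret K: profinite_group "G \<times>\<times> H" "prod_topology S T"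
    by (rule profinite_group_DirProd[OF G.profinite_group_axioms H.profinite_group_axioms])
  let ?M = "haar G S" and ?N = "haar H T"
  let ?PG = "radon_product S S ?M ?M" and ?PH = "radon_product T T ?N ?N"
  let ?Q = "radon_product (prod_topology S S) (prod_topology T T) ?PG ?PH"
  let ?Y = "prod_topology (prod_topology S T) (prod_topology S T)"
  let ?s = "\<lambda>((g, g'), (h, h')). ((g, h), (g', h'))"
  let ?DG = "exterior_kernel G S" and ?DH = "exterior_kernel H T"
  let ?DK = "exterior_kernel (G \<times>\<times> H) (prod_topology S T)"
  note inter = radon_product_interchange[OF G.stone_space H.stone_space G.finite_radon_haar H.finite_radon_haar]
  note PG = radon_product_props[OF G.stone_space G.stone_space G.finite_radon_haar G.finite_radon_haar]
  note PH = radon_product_props[OF H.stone_space H.stone_space H.finite_radon_haar H.finite_radon_haar]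
  note Q = radon_product_props[OF stone_space_prod[OF G.stone_space G.stone_space]
      stone_space_prod[OF H.stone_space H.stone_space] PG(1) PH(1)]
  have meas: "?s \<in> measurable ?Q (borel_algebra ?Y)"
    by (rule continuous_map_measurable[OF Q(1) inter(2)])
  have DK: "?DK \<in> sets (borel_algebra ?Y)"
    using finite_radon_sets_closedin[OF finite_radon_distr[OF Q(1) inter(2)] K.closedin_exterior_kernel]
      stone_space_prod[OF K.stone_space K.stone_space] by (simp add: stone_space_def)
  have DG: "?DG \<in> sets ?PG" and DH: "?DH \<in> sets ?PH"
    using finite_radon_sets_closedin[OF PG(1) G.closedin_exterior_kernel]
      finite_radon_sets_closedin[OF PH(1) H.closedin_exterior_kernel] .
  have "exterior_degree (G \<times>\<times> H) (prod_topology S T) = measure (distr ?Q (borel_algebra ?Y) ?s) ?DK"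
    by (simp only: exterior_degree_eq haar_DirProd[OF G.profinite_group_axioms H.profinite_group_axioms] inter(1))
  also have "\<dots> = measure ?Q (?s -` ?DK \<inter> space ?Q)"
    by (rule measure_distr[OF meas DK])
  also have "?s -` ?DK \<inter> space ?Q = ?DG \<times> ?DH"
  proof -
    have "?DG \<times> ?DH \<subseteq> space ?Q"
      using Q(1) G.topspace H.topspace by (auto simp: finite_radon_measure_def exterior_kernel_def)
    then show ?thesis
      using exterior_kernel_DirProd[OF cop assms(4,5)] by auto
  qed
  also have "measure ?Q (?DG \<times> ?DH) = measure ?PG ?DG * measure ?PH ?DH"
    using Q(2)[OF DG DH] by (simp add: measure_def enn2real_mult)
  finally show ?thesis
    by (simp add: exterior_degree_eq)
qed

end
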